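(* Let $[M,\mathcal S]$ be a compatible pair, and let $b_+\in\mathcal S_+$, $b_-\in\mathcal S_-$. Put $a_\pm=\exp(b_\pm)$, $b=b_++b_-$ and $a=a_+a_-=\exp(b)$. Then, for $N\ge1$, $$\det P_NM(a)P_N=G[a]^N\,E[a]\,F[a]\,\det(I+Q_NKQ_N),$$ where $$F[a]=\det T^{-1}(a)M(a)=\exp\Big(\mathrm{trace}(M(b)-T(b))-\tfrac12\,\mathrm{trace}\,H(b)^2\Big),$$ $$E[a]=\det T(a^{-1})T(a)=\exp\Big(\mathrm{trace}\,H(b)H(\tilde b)\Big),$$ and $K=M(a_-a_+^{-1}\tilde a_+^{-1})\,T(a_+\tilde a_+a_-^{-1})-I$.
   Context: Notation. $\mathbb T$ is the unit circle; for $a\in L^1(\mathbb T)$ the Fourier coefficients are $a_n=[a]_n=\frac1{2\pi}\int_{-\pi}^{\pi}a(e^{i\theta})e^{-in\theta}\,d\theta$, $n\in\mathbb Z$; $\tilde a(t)=a(t^{-1})$. $\ell^2$ is the space of complex square-summable sequences $\{x_n\}_{n=0}^\infty$, $\mathcal L(\ell^2)$ the bounded linear operators on it, $\mathcal C_1(\ell^2)$ the trace class operators. For $a\in L^\infty(\mathbb T)$, $T(a)=(a_{j-k})_{j,k\ge0}$ and $H(a)=(a_{j+k+1})_{j,k\ge0}$ are the Toeplitz and Hankel operators on $\ell^2$. $T^{-1}(a)$ denotes the inverse of the operator $T(a)$. For operators of the form identity plus trace class, $\det$ is the operator (Fredholm) determinant. Compatible pair. $\mathcal S$ is a unital Banach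 algebra of functions on $\mathbb T$, continuously embedded in $L^\infty(\mathbb T)$, such that (i) the Riesz projection $\sum_{k\in\mathbb Z}a_ke^{ik\theta}\mapsto\sum_{k\ge0}a_ke^{ik\theta}$ is well defined and bounded on $\mathcal S$, and (ii) $a\mapsto\tilde a$ is well defined and bounded on $\mathcal S$. Put $\mathcal S_\pm=\{a\in\mathcal S: a_n=0 \text{ for all } n \text{ with } \pm n<0\}$ and $\mathcal S_0=\{a\in\mathcal S:a=\tilde a\}$. $M:\mathcal S\to\mathcal L(\ell^2)$ is a linear continuous map such that: (a) for $a\in\mathcal S$, $M(a)-T(a)\in\mathcal C_1(\ell^2)$ and $\|M(a)-T(a)\|_{\mathcal C_1(\ell^2)}\le C\|a\|_{\mathcal S}$ with a constant $C$ independent of $a$; (b) $M(abc)=T(a)M(b)M(c)$ whenever $a\in\mathcal S_-$, $b\in\mathcal S$, $c\in\mathcal S_0$; (c) $M(1)=I$. Then $[M,\mathcal S]$ is called a compatible pair. $P_N$ is the projection on $\ell^2$ keeping the first $N$ entries $x_0,\dots,x_{N-1}$ and replacing the others by $0$; $Q_N=I-P_N$; $\det P_NAP_N$ is the determinant of $P_NAP_N$ acting on the image of $P_N$, i.e. of the upper-left $N\times N$ section of $A$. For $a=\exp(b)$, $G[a]=\exp\big(\frac1{2\pi}\int_{-\pi}^\pi \log a(e^{i\theta})\,d\theta\big)$ with $\log a=b$. *)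

theory Defs
  imports "HOL-Analysis.Analysis" "Jordan_Normal_Form.Determinant"
begin

section \<open>The Hilbert space of square-summable complex sequences\<close>

typedef ell2 = "{x :: nat \<Rightarrow> complex. summable (\<lambda>n. (cmod (x n))\<^sup>2)}"
  morphisms coord Abs_ell2
  by (rule exI[of _ "\<lambda>_. 0"]) simp

setup_lifting type_definition_ell2

class scaleC =
  fixes scaleC :: "complex \<Rightarrow> 'a \<Rightarrow> 'a" (infixr "*\<^sub>C" 75)

lemma summable_coord: "summable (\<lambda>n. (cmod (coord x n))\<^sup>2)"
  using coord[of x] by simp

lemma square_summable_add:
  fixes x y :: "nat \<Rightarrow> complex"
  assumes "summable (\<lambda>n. (cmod (x n))\<^sup>2)" "summable (\<lambda>n. (cmod (y n))\<^sup>2)"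
  shows "summable (\<lambda>n. (cmod (x n + y n))\<^sup>2)"
proof (rule summable_comparison_test')
  show "summable (\<lambda>n. 2 * (cmod (x n))\<^sup>2 + 2 * (cmod (y n))\<^sup>2)"
    using assms by (intro summable_add summable_mult)
  fix n
  have "(cmod (x n + y n))\<^sup>2 \<le> (cmod (x n) + cmod (y n))\<^sup>2"
    by (intro power_mono norm_triangle_ineq) simp
  also have "\<dots> \<le> 2 * (cmod (x n))\<^sup>2 + 2 * (cmod (y n))\<^sup>2"
    using sum_squares_bound[of "cmod (x n)" "cmod (y n)"] by (simp add: power2_sum)
  finally show "norm ((cmod (x n + y n))\<^sup>2) \<le> 2 * (cmod (x n))\<^sup>2 + 2 * (cmod (y n))\<^sup>2"
    by simp
qed

lemma square_summable_scale:
  fixes x :: "nat \<Rightarrow> complex"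
  assumes "summable (\<lambda>n. (cmod (x n))\<^sup>2)"
  shows "summable (\<lambda>n. (cmod (c * x n))\<^sup>2)"
  using summable_mult[OF assms, of "(cmod c)\<^sup>2"] by (simp add: norm_mult power_mult_distrib)

lemma square_summable_inner:
  fixes x y :: "nat \<Rightarrow> complex"
  assumes "summable (\<lambda>n. (cmod (x n))\<^sup>2)" "summable (\<lambda>n. (cmod (y n))\<^sup>2)"
  shows "summable (\<lambda>n. inner (x n) (y n))"
proof (rule summable_comparison_test')
  show "summable (\<lambda>n. (cmod (x n))\<^sup>2 + (cmod (y n))\<^sup>2)"
    using assms by (intro summable_add)
  fix n
  have "\<bar>inner (x n) (y n)\<bar> \<le> cmod (x n) * cmod (y n)"
    by (rule Cauchy_Schwarz_ineq2)
  also have "\<dots> \<le> 2 * cmod (x n) * cmod (y n)" by simp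
  also have "\<dots> \<le> (cmod (x n))\<^sup>2 + (cmod (y n))\<^sup>2"
    by (rule sum_squares_bound)
  finally show "norm (inner (x n) (y n)) \<le> (cmod (x n))\<^sup>2 + (cmod (y n))\<^sup>2" by simp
qed

instantiation ell2 :: real_inner
begin

lift_definition zero_ell2 :: ell2 is "\<lambda>_. 0" by simp
lift_definition plus_ell2 :: "ell2 \<Rightarrow> ell2 \<Rightarrow> ell2" is "\<lambda>x y n. x n + y n"
  by (rule square_summable_add)
lift_definition uminus_ell2 :: "ell2 \<Rightarrow> ell2" is "\<lambda>x n. - x n" by simp
lift_definition minus_ell2 :: "ell2 \<Rightarrow> ell2 \<Rightarrow> ell2" is "\<lambda>x y n. x n - y n"
  using square_summable_add[of _ "\<lambda>n. - _ n"] by simp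
lift_definition scaleR_ell2 :: "real \<Rightarrow> ell2 \<Rightarrow> ell2" is "\<lambda>r x n. complex_of_real r * x n"
  by (rule square_summable_scale)

text \<open>The real part of the usual sesquilinear inner product of \<open>\<ell>\<^sup>2\<close>: on \<^typ>\<open>complex\<close>,
  \<open>inner x y\<close> is the real part of \<open>x * cnj y\<close>.\<close>

lift_definition inner_ell2 :: "ell2 \<Rightarrow> ell2 \<Rightarrow> real" is "\<lambda>x y. \<Sum>n. inner (x n) (y n)" .

definition norm_ell2 :: "ell2 \<Rightarrow> real" where "norm_ell2 x = sqrt (inner x x)"
definition sgn_ell2 :: "ell2 \<Rightarrow> ell2" where "sgn_ell2 x = inverse (norm x) *\<^sub>R x"
definition dist_ell2 :: "ell2 \<Rightarrow> ell2 \<Rightarrow> real" where "dist_ell2 x y = norm (x - y)"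
definition uniformity_ell2 :: "(ell2 \<times> ell2) filter"
  where "uniformity_ell2 = (INF e\<in>{0<..}. principal {(x, y). dist x y < e})"
definition open_ell2 :: "ell2 set \<Rightarrow> bool"
  where "open_ell2 U = (\<forall>x\<in>U. eventually (\<lambda>(x', y). x' = x \<longrightarrow> y \<in> U) uniformity)"

instance
proof
  fix x y z :: ell2 and r s :: real
  show "x + y + z = x + (y + z)" "x + y = y + x" "0 + x = x" "- x + x = 0" "x - y = x + - y"
    by (transfer; simp add: algebra_simps)+
  show "r *\<^sub>R (x + y) = r *\<^sub>R x + r *\<^sub>R y" "(r + s) *\<^sub>R x = r *\<^sub>R x + s *\<^sub>R x"
    "r *\<^sub>R s *\<^sub>R x = (r * s) *\<^sub>R x" "1 *\<^sub>R x = x"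
    by (transfer; simp add: algebra_simps)+
  show "sgn x = inverse (norm x) *\<^sub>R x" "dist x y = norm (x - y)"
    by (simp_all add: sgn_ell2_def dist_ell2_def)
  show "uniformity = (INF e\<in>{0<..}. principal {(x :: ell2, y). dist x y < e})"
    by (rule uniformity_ell2_def)
  show "open U = (\<forall>x\<in>U. eventually (\<lambda>(x', y). x' = x \<longrightarrow> y \<in> U) uniformity)" for U :: "ell2 set"
    by (rule open_ell2_def)
  show "inner x y = inner y x" by transfer (simp add: inner_commute)
  show "inner (x + y) z = inner x z + inner y z"
    by transfer (simp add: inner_add_left suminf_add square_summable_inner)
  show "inner (r *\<^sub>R x) y = r * inner x y"
    by transfer (simp add: suminf_mult square_summable_inner flip: scaleR_conv_of_real)
  show "0 \<le> inner x x" by transfer (simp add: suminf_nonneg square_summable_inner)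
  show "inner x x = 0 \<longleftrightarrow> x = 0"
    by transfer (auto simp: suminf_eq_zero_iff square_summable_inner fun_eq_iff)
  show "norm x = sqrt (inner x x)" by (rule norm_ell2_def)
qed

end

lemma norm_ell2_eq: "norm x = sqrt (\<Sum>n. (cmod (coord x n))\<^sup>2)"
  unfolding norm_ell2_def by transfer (simp add: power2_norm_eq_inner)

lemma norm_ell2_power2: "(norm x)\<^sup>2 = (\<Sum>n. (cmod (coord x n))\<^sup>2)"
proof -
  have "0 \<le> (\<Sum>n. (cmod (coord x n))\<^sup>2)"
    by (rule suminf_nonneg[OF summable_coord]) simp
  then show ?thesis unfolding norm_ell2_eq by (rule real_sqrt_pow2)
qed

lemma coord_simps [simp]:
  "coord 0 n = 0" "coord (x + y) n = coord x n + coord y n" "coord (- x) n = - coord x n"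
  "coord (x - y) n = coord x n - coord y n" "coord (r *\<^sub>R x) n = complex_of_real r * coord x n"
  by (transfer; simp)+

lemma norm_coord_le: "cmod (coord x n) \<le> norm x"
proof -
  have "(\<Sum>i\<in>{n}. (cmod (coord x i))\<^sup>2) \<le> (\<Sum>i. (cmod (coord x i))\<^sup>2)"
    by (rule sum_le_suminf[OF summable_coord]) auto
  then show ?thesis unfolding norm_ell2_eq by (simp add: real_le_rsqrt)
qed

instance ell2 :: banach
proof
  fix X :: "nat \<Rightarrow> ell2"
  assume X: "Cauchy X"
  have "Cauchy (\<lambda>k. coord (X k) n)" for n
  proof (rule metric_CauchyI)
    fix e :: real assume e: "0 < e"
    obtain K where K: "\<And>k l. k \<ge> K \<Longrightarrow> l \<ge> K \<Longrightarrow> dist (X k) (X l) < e"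
      using metric_CauchyD[OF X e] by (elim exE) blast
    have "dist (coord (X k) n) (coord (X l) n) < e" if "k \<ge> K" "l \<ge> K" for k l
      using K[OF that] norm_coord_le[of "X k - X l" n] by (simp add: dist_norm)
    then show "\<exists>K. \<forall>k\<ge>K. \<forall>l\<ge>K. dist (coord (X k) n) (coord (X l) n) < e" by blast
  qed
  then have "\<forall>n. \<exists>l. (\<lambda>k. coord (X k) n) \<longlonglongrightarrow> l"
    using Cauchy_convergent convergent_def by blast
  then obtain y where y: "\<And>n. (\<lambda>k. coord (X k) n) \<longlonglongrightarrow> y n" by metis
  have partial: "(\<Sum>i<n. (cmod (coord (X k) i - y i))\<^sup>2) \<le> e\<^sup>2"
    if K: "\<And>k l. k \<ge> K \<Longrightarrow> l \<ge> K \<Longrightarrow> dist (X k) (X l) < e" and k: "k \<ge> K" for K k n and e :: real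
  proof (rule LIMSEQ_le_const2)
    show "(\<lambda>l. \<Sum>i<n. (cmod (coord (X k) i - coord (X l) i))\<^sup>2)
        \<longlonglongrightarrow> (\<Sum>i<n. (cmod (coord (X k) i - y i))\<^sup>2)"
      by (intro tendsto_intros y)
    have "(\<Sum>i<n. (cmod (coord (X k) i - coord (X l) i))\<^sup>2) \<le> e\<^sup>2" if l: "l \<ge> K" for l
    proof -
      have "(\<Sum>i<n. (cmod (coord (X k - X l) i))\<^sup>2) \<le> (\<Sum>i. (cmod (coord (X k - X l) i))\<^sup>2)"
        by (rule sum_le_suminf[OF summable_coord]) auto
      also have "\<dots> = (norm (X k - X l))\<^sup>2"
        by (rule norm_ell2_power2[symmetric])
      also have "\<dots> \<le> e\<^sup>2"
        using K[OF k l] by (intro power_mono) (auto simp: dist_norm)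
      finally show ?thesis by simp
    qed
    then show "\<exists>K. \<forall>l\<ge>K. (\<Sum>i<n. (cmod (coord (X k) i - coord (X l) i))\<^sup>2) \<le> e\<^sup>2" by blast
  qed
  have diff: "summable (\<lambda>i. (cmod (coord (X k) i - y i))\<^sup>2)"
    if "\<And>k l. k \<ge> K \<Longrightarrow> l \<ge> K \<Longrightarrow> dist (X k) (X l) < e" and "k \<ge> K" for K k and e :: real
    by (rule summableI_nonneg_bounded[OF _ partial[OF that]]) auto
  obtain K1 where K1: "\<And>k l. k \<ge> K1 \<Longrightarrow> l \<ge> K1 \<Longrightarrow> dist (X k) (X l) < 1"
    using metric_CauchyD[OF X, where e = 1] by (simp, elim exE) blast
  have "summable (\<lambda>i. (cmod (coord (X K1) i + - (coord (X K1) i - y i)))\<^sup>2)"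
    using diff[OF K1 order_refl] by (intro square_summable_add summable_coord) (simp add: norm_minus_commute)
  then have "summable (\<lambda>i. (cmod (y i))\<^sup>2)" by simp
  then have Y: "coord (Abs_ell2 y) = y" by (simp add: Abs_ell2_inverse)
  have "X \<longlonglongrightarrow> Abs_ell2 y"
  proof (rule metric_LIMSEQ_I)
    fix r :: real assume r: "0 < r"
    obtain K where K: "\<And>k l. k \<ge> K \<Longrightarrow> l \<ge> K \<Longrightarrow> dist (X k) (X l) < r / 2"
      using metric_CauchyD[OF X half_gt_zero[OF r]] by (elim exE) blast
    have "dist (X k) (Abs_ell2 y) < r" if "k \<ge> K" for k
    proof -
      have "(\<Sum>i. (cmod (coord (X k - Abs_ell2 y) i))\<^sup>2) \<le> (r / 2)\<^sup>2"
        using partial[OF K that] diff[OF K that] by (intro suminf_le_const) (auto simp: Y)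
      then have "norm (X k - Abs_ell2 y) \<le> r / 2"
        unfolding norm_ell2_eq using r by (intro real_le_lsqrt) auto
      then show ?thesis using r by (simp add: dist_norm)
    qed
    then show "\<exists>K. \<forall>k\<ge>K. dist (X k) (Abs_ell2 y) < r" by blast
  qed
  then show "convergent X" by (auto simp: convergent_def)
qed

instantiation ell2 :: scaleC
begin
lift_definition scaleC_ell2 :: "complex \<Rightarrow> ell2 \<Rightarrow> ell2" is "\<lambda>c x n. c * x n"
  by (rule square_summable_scale)
instance ..
end

lemma coord_scaleC [simp]: "coord (c *\<^sub>C x) n = c * coord x n"
  by transfer simp

lemma ell2_eqI: "(\<And>n. coord x n = coord y n) \<Longrightarrow> x = y"
  by transfer auto

lemma norm_scaleC: "norm (c *\<^sub>C (x :: ell2)) = cmod c * norm x"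
proof -
  have "(\<Sum>n. (cmod (c * coord x n))\<^sup>2) = (cmod c)\<^sup>2 * (\<Sum>n. (cmod (coord x n))\<^sup>2)"
    by (simp add: norm_mult power_mult_distrib suminf_mult summable_coord)
  then show ?thesis by (simp add: norm_ell2_eq real_sqrt_mult)
qed

lemma scaleC_simps:
  fixes x y :: ell2
  shows "c *\<^sub>C (x + y) = c *\<^sub>C x + c *\<^sub>C y" "c *\<^sub>C (x - y) = c *\<^sub>C x - c *\<^sub>C y"
    "c *\<^sub>C (- x) = - (c *\<^sub>C x)" "c *\<^sub>C 0 = (0 :: ell2)" "c *\<^sub>C (r *\<^sub>R x) = r *\<^sub>R (c *\<^sub>C x)"
    "c *\<^sub>C (d *\<^sub>C x) = d *\<^sub>C (c *\<^sub>C x)"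
  by (rule ell2_eqI, simp add: algebra_simps)+

lemma bounded_linear_scaleC: "bounded_linear (\<lambda>x :: ell2. c *\<^sub>C x)"
  by (rule bounded_linear_intro[where K = "cmod c"])
    (simp_all add: scaleC_simps norm_scaleC mult.commute)

definition basis_ell2 :: "nat \<Rightarrow> ell2"
  where "basis_ell2 k = Abs_ell2 (\<lambda>n. if n = k then 1 else 0)"

lemma coord_basis_ell2 [simp]: "coord (basis_ell2 k) n = (if n = k then 1 else 0)"
proof -
  have "summable (\<lambda>n. (cmod (if n = k then 1 else 0))\<^sup>2)"
    by (rule summable_finite[of "{k}"]) auto
  then show ?thesis by (simp add: basis_ell2_def Abs_ell2_inverse)
qed


section \<open>Bounded complex-linear operators\<close>

typedef ell2_op = "{A :: ell2 \<Rightarrow>\<^sub>L ell2. \<forall>c x. A (c *\<^sub>C x) = c *\<^sub>C A x}"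
  morphisms blinfun_of Abs_ell2_op
  by (rule exI[of _ 0]) (simp add: scaleC_simps)

setup_lifting type_definition_ell2_op

definition op_apply :: "ell2_op \<Rightarrow> ell2 \<Rightarrow> ell2"
  where "op_apply A x = blinfun_apply (blinfun_of A) x"

instantiation ell2_op :: real_normed_algebra_1
begin

lift_definition zero_ell2_op :: ell2_op is 0 by (simp add: scaleC_simps)
lift_definition one_ell2_op :: ell2_op is id_blinfun by simp
lift_definition plus_ell2_op :: "ell2_op \<Rightarrow> ell2_op \<Rightarrow> ell2_op" is "(+)"
  by (simp add: blinfun.bilinear_simps scaleC_simps)
lift_definition minus_ell2_op :: "ell2_op \<Rightarrow> ell2_op \<Rightarrow> ell2_op" is "(-)"
  by (simp add: blinfun.bilinear_simps scaleC_simps)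
lift_definition uminus_ell2_op :: "ell2_op \<Rightarrow> ell2_op" is uminus
  by (simp add: blinfun.bilinear_simps scaleC_simps)
lift_definition times_ell2_op :: "ell2_op \<Rightarrow> ell2_op \<Rightarrow> ell2_op" is "(o\<^sub>L)"
  by simp
lift_definition scaleR_ell2_op :: "real \<Rightarrow> ell2_op \<Rightarrow> ell2_op" is scaleR
  by (simp add: blinfun.bilinear_simps scaleC_simps)
lift_definition norm_ell2_op :: "ell2_op \<Rightarrow> real" is norm .

definition sgn_ell2_op :: "ell2_op \<Rightarrow> ell2_op" where "sgn_ell2_op x = inverse (norm x) *\<^sub>R x"
definition dist_ell2_op :: "ell2_op \<Rightarrow> ell2_op \<Rightarrow> real" where "dist_ell2_op x y = norm (x - y)"
definition uniformity_ell2_op :: "(ell2_op \<times> ell2_op) filter"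
  where "uniformity_ell2_op = (INF e\<in>{0<..}. principal {(x, y). dist x y < e})"
definition open_ell2_op :: "ell2_op set \<Rightarrow> bool"
  where "open_ell2_op U = (\<forall>x\<in>U. eventually (\<lambda>(x', y). x' = x \<longrightarrow> y \<in> U) uniformity)"

instance
proof
  fix x y z :: ell2_op and r s :: real
  show "x + y + z = x + (y + z)" "x + y = y + x" "0 + x = x" "- x + x = 0" "x - y = x + - y"
    by (transfer; simp)+
  show "r *\<^sub>R (x + y) = r *\<^sub>R x + r *\<^sub>R y" "(r + s) *\<^sub>R x = r *\<^sub>R x + s *\<^sub>R x"
    "r *\<^sub>R s *\<^sub>R x = (r * s) *\<^sub>R x" "1 *\<^sub>R x = x"
    by (transfer; simp add: algebra_simps)+
  show "sgn x = inverse (norm x) *\<^sub>R x" "dist x y = norm (x - y)"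
    by (simp_all add: sgn_ell2_op_def dist_ell2_op_def)
  show "uniformity = (INF e\<in>{0<..}. principal {(x :: ell2_op, y). dist x y < e})"
    by (rule uniformity_ell2_op_def)
  show "open U = (\<forall>x\<in>U. eventually (\<lambda>(x', y). x' = x \<longrightarrow> y \<in> U) uniformity)" for U :: "ell2_op set"
    by (rule open_ell2_op_def)
  show "x * y * z = x * (y * z)" "1 * x = x" "x * 1 = x"
    by (transfer; simp add: blinfun_eqI)+
  show "(x + y) * z = x * z + y * z" "x * (y + z) = x * y + x * z"
    "r *\<^sub>R x * y = r *\<^sub>R (x * y)" "x * r *\<^sub>R y = r *\<^sub>R (x * y)"
    by (transfer; simp add: blinfun_eqI blinfun.bilinear_simps)+
  show "norm x = 0 \<longleftrightarrow> x = 0" "norm (r *\<^sub>R x) = \<bar>r\<bar> * norm x" by (transfer; simp)+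
  show "norm (x + y) \<le> norm x + norm y" by transfer (rule norm_triangle_ineq)
  show "norm (x * y) \<le> norm x * norm y" by transfer (rule norm_blinfun_compose)
  have ne: "basis_ell2 0 \<noteq> 0" using coord_basis_ell2[of 0 0] by fastforce
  have id: "norm (id_blinfun :: ell2 \<Rightarrow>\<^sub>L ell2) = 1"
    by (rule norm_blinfun_eqI[where x = "basis_ell2 0"]) (use ne in auto)
  then show "norm (1 :: ell2_op) = 1" by transfer
  then show "(0 :: ell2_op) \<noteq> 1" using id by transfer force
qed

end

instantiation ell2_op :: scaleC
begin
lift_definition scaleC_ell2_op :: "complex \<Rightarrow> ell2_op \<Rightarrow> ell2_op"
  is "\<lambda>c A. Blinfun (\<lambda>x. c *\<^sub>C x) o\<^sub>L A"
  by (simp add: bounded_linear_scaleC bounded_linear_Blinfun_apply scaleC_simps)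
instance ..
end

definition entry :: "ell2_op \<Rightarrow> nat \<Rightarrow> nat \<Rightarrow> complex"
  where "entry A j k = coord (op_apply A (basis_ell2 k)) j"

text \<open>The bounded operator with a given matrix. A bounded operator is determined by its matrix, and
  for the Toeplitz and Hankel matrices of a function in \<open>L\<^sup>\<infinity>\<close> such an operator exists.\<close>

definition op_of_matrix :: "(nat \<Rightarrow> nat \<Rightarrow> complex) \<Rightarrow> ell2_op"
  where "op_of_matrix m = (THE A. \<forall>j k. entry A j k = m j k)"

definition op_invertible :: "ell2_op \<Rightarrow> bool"
  where "op_invertible A \<longleftrightarrow> (\<exists>B. A * B = 1 \<and> B * A = 1)"

definition op_inverse :: "ell2_op \<Rightarrow> ell2_op"
  where "op_inverse A = (THE B. A * B = 1 \<and> B * A = 1)"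

lift_definition cutoff :: "nat \<Rightarrow> ell2 \<Rightarrow> ell2" is "\<lambda>N x n. if n < N then x n else 0"
proof -
  fix N and x :: "nat \<Rightarrow> complex"
  show "summable (\<lambda>n. (cmod (if n < N then x n else 0))\<^sup>2)"
    by (rule summable_finite[of "{..<N}"]) auto
qed

lemma coord_cutoff [simp]: "coord (cutoff N x) n = (if n < N then coord x n else 0)"
  by transfer simp

lemma bounded_linear_cutoff: "bounded_linear (cutoff N)"
proof (rule bounded_linear_intro[where K = 1])
  fix x y :: ell2 and r :: real
  show "cutoff N (x + y) = cutoff N x + cutoff N y" "cutoff N (r *\<^sub>R x) = r *\<^sub>R cutoff N x"
    by (rule ell2_eqI, simp)+
  show "norm (cutoff N x) \<le> norm x * 1"
    unfolding norm_ell2_eq mult_1_right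
    by (intro real_sqrt_le_mono suminf_le summable_coord) simp
qed

lift_definition op_P :: "nat \<Rightarrow> ell2_op" is "\<lambda>N. Blinfun (cutoff N)"
  by (simp add: bounded_linear_cutoff bounded_linear_Blinfun_apply ell2_eqI)

definition op_Q :: "nat \<Rightarrow> ell2_op"
  where "op_Q N = 1 - op_P N"

definition section_det :: "nat \<Rightarrow> ell2_op \<Rightarrow> complex"
  where "section_det N A = Determinant.det (mat N N (\<lambda>(j, k). entry A j k))"


section \<open>Trace class, trace and Fredholm determinant\<close>

definition rank_le :: "nat \<Rightarrow> ell2_op \<Rightarrow> bool"
  where "rank_le n F \<longleftrightarrow>
    (\<exists>v :: nat \<Rightarrow> ell2. \<forall>x. \<exists>c :: nat \<Rightarrow> complex. op_apply F x = (\<Sum>i<n. c i *\<^sub>C v i))"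

text \<open>The singular values, as approximation numbers: \<open>s\<^sub>n(A)\<close> is the distance of \<open>A\<close> from the
  operators of rank at most \<open>n\<close>. The indexing starts with \<open>s\<^sub>0(A) = \<parallel>A\<parallel>\<close>.\<close>

definition singular_value :: "nat \<Rightarrow> ell2_op \<Rightarrow> real"
  where "singular_value n A = Inf {norm (A - F) |F. rank_le n F}"

definition trace_class :: "ell2_op \<Rightarrow> bool"
  where "trace_class A \<longleftrightarrow> summable (\<lambda>n. singular_value n A)"

definition trace_norm :: "ell2_op \<Rightarrow> real"
  where "trace_norm A = (\<Sum>n. singular_value n A)"

definition op_trace :: "ell2_op \<Rightarrow> complex"
  where "op_trace A = (\<Sum>n. entry A n n)"

definition principal_minor :: "ell2_op \<Rightarrow> nat set \<Rightarrow> complex"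
  where "principal_minor A J = Determinant.det (mat (card J) (card J)
    (\<lambda>(p, q). entry A (sorted_list_of_set J ! p) (sorted_list_of_set J ! q)))"

text \<open>The Fredholm series \<open>det (I + A) = \<Sum>\<^sub>k tr (\<Lambda>\<^sup>k A)\<close> for trace class \<open>A\<close>. The trace of the \<open>k\<close>-th
  exterior power, computed in the orthonormal basis of the wedge products
  \<open>e\<^sub>j\<^sub>1 \<and> \<dots> \<and> e\<^sub>j\<^sub>k\<close> with increasing indices, is the absolutely convergent sum of the
  \<open>k \<times> k\<close> principal minors of \<open>A\<close>.\<close>

definition trace_exterior_power :: "nat \<Rightarrow> ell2_op \<Rightarrow> complex"
  where "trace_exterior_power k A = (\<Sum>\<^sub>\<infinity>J\<in>{J. finite J \<and> card J = k}. principal_minor A J)"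

definition fredholm_det :: "ell2_op \<Rightarrow> complex"
  where "fredholm_det X = (\<Sum>k. trace_exterior_power k (X - 1))"


section \<open>Toeplitz and Hankel operators\<close>

text \<open>Functions on the unit circle are represented by functions on \<^typ>\<open>complex\<close>, whose values
  off the circle are irrelevant.\<close>

definition fourier :: "(complex \<Rightarrow> complex) \<Rightarrow> int \<Rightarrow> complex"
  where "fourier a n =
    complex_of_real (1 / (2 * pi)) *
      (LINT \<theta>|lebesgue_on {-pi..pi}. a (cis \<theta>) * cis (- (of_int n * \<theta>)))"

definition tilde :: "(complex \<Rightarrow> complex) \<Rightarrow> complex \<Rightarrow> complex"
  where "tilde a = (\<lambda>t. a (inverse t))"

definition circle_ae_eq :: "(complex \<Rightarrow> complex) \<Rightarrow> (complex \<Rightarrow> complex) \<Rightarrow> bool"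
  where "circle_ae_eq a b \<longleftrightarrow> (AE \<theta> in lebesgue_on {-pi..pi}. a (cis \<theta>) = b (cis \<theta>))"

definition toeplitz :: "(complex \<Rightarrow> complex) \<Rightarrow> ell2_op"
  where "toeplitz a = op_of_matrix (\<lambda>j k. fourier a (int j - int k))"

definition hankel :: "(complex \<Rightarrow> complex) \<Rightarrow> ell2_op"
  where "hankel a = op_of_matrix (\<lambda>j k. fourier a (int j + int k + 1))"


section \<open>Compatible pairs\<close>

text \<open>A subspace of \<open>L\<^sup>\<infinity>\<close> consists of classes of functions modulo equality almost everywhere; here
  it is given by the set \<open>S\<close> of all representatives of its elements. Accordingly \<open>S\<close> is closed
  under changes on null sets, and \<open>nrm\<close> vanishes exactly on the null functions.\<close>

locale circle_banach_algebra =
  fixes S :: "(complex \<Rightarrow> complex) set" and nrm :: "(complex \<Rightarrow> complex) \<Rightarrow> real"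
  assumes measurable: "a \<in> S \<Longrightarrow> (\<lambda>\<theta>. a (cis \<theta>)) \<in> borel_measurable (lebesgue_on {-pi..pi})"
    and ae_closed: "a \<in> S \<Longrightarrow> circle_ae_eq a b \<Longrightarrow> b \<in> S"
    and one: "(\<lambda>_. 1) \<in> S"
    and add: "a \<in> S \<Longrightarrow> b \<in> S \<Longrightarrow> (\<lambda>t. a t + b t) \<in> S"
    and scale: "a \<in> S \<Longrightarrow> (\<lambda>t. z * a t) \<in> S"
    and mult: "a \<in> S \<Longrightarrow> b \<in> S \<Longrightarrow> (\<lambda>t. a t * b t) \<in> S"
    and nrm_nonneg: "a \<in> S \<Longrightarrow> 0 \<le> nrm a"
    and nrm_zero: "a \<in> S \<Longrightarrow> nrm a = 0 \<longleftrightarrow> circle_ae_eq a (\<lambda>_. 0)"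
    and nrm_add: "a \<in> S \<Longrightarrow> b \<in> S \<Longrightarrow> nrm (\<lambda>t. a t + b t) \<le> nrm a + nrm b"
    and nrm_scale: "a \<in> S \<Longrightarrow> nrm (\<lambda>t. z * a t) = cmod z * nrm a"
    and nrm_mult: "a \<in> S \<Longrightarrow> b \<in> S \<Longrightarrow> nrm (\<lambda>t. a t * b t) \<le> nrm a * nrm b"
    and complete: "(\<And>n :: nat. f n \<in> S) \<Longrightarrow>
      (\<And>e. e > 0 \<Longrightarrow> \<exists>n0. \<forall>m\<ge>n0. \<forall>n\<ge>n0. nrm (\<lambda>t. f m t - f n t) < e) \<Longrightarrow>
      \<exists>a\<in>S. (\<lambda>n. nrm (\<lambda>t. f n t - a t)) \<longlonglongrightarrow> 0"
    and embedding: "\<exists>C. \<forall>a\<in>S. AE \<theta> in lebesgue_on {-pi..pi}. cmod (a (cis \<theta>)) \<le> C * nrm a"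

definition plus_part :: "(complex \<Rightarrow> complex) set \<Rightarrow> (complex \<Rightarrow> complex) set"
  where "plus_part S = {a \<in> S. \<forall>n<0. fourier a n = 0}"

definition minus_part :: "(complex \<Rightarrow> complex) set \<Rightarrow> (complex \<Rightarrow> complex) set"
  where "minus_part S = {a \<in> S. \<forall>n>0. fourier a n = 0}"

definition even_part :: "(complex \<Rightarrow> complex) set \<Rightarrow> (complex \<Rightarrow> complex) set"
  where "even_part S = {a \<in> S. circle_ae_eq a (tilde a)}"

locale compatible_pair = circle_banach_algebra S nrm
  for S :: "(complex \<Rightarrow> complex) set" and nrm :: "(complex \<Rightarrow> complex) \<Rightarrow> real" +
  fixes M :: "(complex \<Rightarrow> complex) \<Rightarrow> ell2_op"
  assumes riesz_projection: "\<exists>C. \<forall>a\<in>S. \<exists>p\<in>S.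
      (\<forall>n. fourier p n = (if 0 \<le> n then fourier a n else 0)) \<and> nrm p \<le> C * nrm a"
    and tilde: "\<exists>C. \<forall>a\<in>S. tilde a \<in> S \<and> nrm (tilde a) \<le> C * nrm a"
    and M_add: "a \<in> S \<Longrightarrow> b \<in> S \<Longrightarrow> M (\<lambda>t. a t + b t) = M a + M b"
    and M_scale: "a \<in> S \<Longrightarrow> M (\<lambda>t. z * a t) = z *\<^sub>C M a"
    and M_bounded: "\<exists>C. \<forall>a\<in>S. norm (M a) \<le> C * nrm a"
    and M_toeplitz: "\<exists>C. \<forall>a\<in>S. trace_class (M a - toeplitz a) \<and>
      trace_norm (M a - toeplitz a) \<le> C * nrm a"
    and M_mult: "a \<in> minus_part S \<Longrightarrow> b \<in> S \<Longrightarrow> c \<in> even_part S \<Longrightarrow>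
      M (\<lambda>t. a t * b t * c t) = toeplitz a * M b * M c"
    and M_one: "M (\<lambda>_. 1) = 1"


section \<open>The constants of the determinant identity\<close>

text \<open>\<open>const_G b\<close> is \<open>G[a]\<close> for \<open>a = exp b\<close>, with the logarithm \<open>b\<close> of \<open>a\<close>.\<close>

definition const_G :: "(complex \<Rightarrow> complex) \<Rightarrow> complex"
  where "const_G b = exp (complex_of_real (1 / (2 * pi)) * (LINT \<theta>|lebesgue_on {-pi..pi}. b (cis \<theta>)))"

definition const_E :: "(complex \<Rightarrow> complex) \<Rightarrow> complex"
  where "const_E a = fredholm_det (toeplitz (\<lambda>t. inverse (a t)) * toeplitz a)"

definition const_F :: "((complex \<Rightarrow> complex) \<Rightarrow> ell2_op) \<Rightarrow> (complex \<Rightarrow> complex) \<Rightarrow> complex"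
  where "const_F M a = fredholm_det (op_inverse (toeplitz a) * M a)"

end

theory Submission
  imports Defs
begin

text \<open>A trace class operator factors as \<open>U V\<close> with Hilbert-Schmidt operators \<open>U\<close>, \<open>V\<close>, so its
  entries are dominated by \<open>p\<^sub>j q\<^sub>k\<close> with square-summable \<open>p\<close>, \<open>q\<close>. This domination makes the
  Fredholm series the limit of the determinants of finite sections, from which multiplicativity,
  \<open>det (I + A B) = det (I + B A)\<close> and \<open>det (I + A) = 1 + tr A + O(\<parallel>A\<parallel>\<^sub>1\<^sup>2)\<close> follow.

  The formulas for \<open>E[a]\<close> and \<open>F[a]\<close> concern determinants of products of one-parameter groups
  such as \<open>T(exp (s b\<^sub>+))\<close>. Since multiplicative commutators are multiplicative in each argument
  under the determinant, these reduce to powers of determinants at \<open>s = 1/n\<close>, whose limit only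
  depends on the leading term of a trace. No series has to be summed in trace norm: all expansions
  take place in \<open>S\<close>, where the exponential series converges, and are carried over by the continuity
  of \<open>a \<mapsto> M(a) - T(a)\<close> and of \<open>(a, b) \<mapsto> H(a) H(b)\<close> into the trace class. The identity for the
  finite sections is Jacobi's identity applied to
  \<open>X = T(a\<^sub>+\<^sup>-\<^sup>1) M(a) T(a\<^sub>-\<^sup>-\<^sup>1)\<close>, whose inverse is \<open>I + K\<close>.\<close>

section \<open>Principal minors and infinite determinants of matrices\<close>

text \<open>\<open>M\<close> is multiplicative only for a minus factor on the left and an even
  factor on the right; it gives no direct hold on a function of the plus part. The way round is to
  write \<open>a_p\<close> as the inverse of \<open>tilde a_p\<close> (a minus function) times the
  even function \<open>a_p * tilde a_p\<close>. Then \<open>M a\<close> is a product of a Toeplitz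
  operator of \<open>a_m\<close>, a Toeplitz operator of the inverse of \<open>tilde a_p\<close>,
  and \<open>M\<close> of an even exponential. All three are invertible and lie in one-parameter
  groups, which yields both the inverse of X and the limits at s = 1/n. The factor G enters because
  the two outer Toeplitz factors of X are triangular with constant diagonal. The coefficient 1/2 in
  F counts commutators: comparing a product of n-th powers with the n-th power of the product costs
  0 + 1 + ... + (n-1) of them, each of order 1/n^2. The trace class is given by approximation
  numbers and the determinant by minors in the standard basis, so nothing spectral links them; the
  factorization into Hilbert-Schmidt operators is the bridge. The trace norm is used with a triangle
  inequality carrying a factor 2, so the estimates only ever add a bounded number of terms.\<close>

definition pminor :: "(nat \<Rightarrow> nat \<Rightarrow> complex) \<Rightarrow> nat set \<Rightarrow> complex"
  where "pminor x J = (\<Sum>\<pi> | \<pi> permutes J. of_int (sign \<pi>) * (\<Prod>j\<in>J. x j (\<pi> j)))"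

text \<open>Finite index sets are enumerated through their binary codes, which turns the sum over
  all minors into an ordinary series to which dominated convergence applies.\<close>

definition fdet :: "(nat \<Rightarrow> nat \<Rightarrow> complex) \<Rightarrow> complex"
  where "fdet x = (\<Sum>i. pminor x (set_decode i))"

definition idet :: "nat \<Rightarrow> (nat \<Rightarrow> nat \<Rightarrow> complex) \<Rightarrow> complex"
  where "idet n x = Determinant.det (mat n n (\<lambda>(j, k). (if j = k then 1 else 0) + x j k))"

text \<open>Conjugation with the increasing enumeration of \<open>J\<close> carries the permutations
  of \<open>{0..<k}\<close> to those of \<open>J\<close> and preserves signs. The form without
  enumeration is the one that the expansion of det (I + x) produces.\<close>

lemma principal_minor_eq:
  assumes "finite J"
  shows "principal_minor A J = pminor (entry A) J"
proof -
  define k where "k = card J"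
  define f where "f p = sorted_list_of_set J ! p" for p
  have f: "bij_betw f {0..<k} J"
    using bij_betw_nth[of "sorted_list_of_set J" "{0..<k}" J] assms
    by (auto simp: f_def[abs_def] k_def atLeast0LessThan)
  define g where "g = inv_into {0..<k} f"
  have inj: "inj_on f {0..<k}" using f by (simp add: bij_betw_def)
  have g: "bij_betw g J {0..<k}" unfolding g_def by (rule bij_betw_inv_into[OF f])
  have gf: "g (f x) = x" if "x \<in> {0..<k}" for x
    unfolding g_def by (rule inv_into_f_f[OF inj that])
  have fg: "f (g x) = x" if "x \<in> J" for x
    unfolding g_def using f that by (meson bij_betw_inv_into_right)
  have "principal_minor A J = (\<Sum>p | p permutes {0..<k}. signof p * (\<Prod>i = 0..<k. entry A (f i) (f (p i))))"
  proof -
    have "(\<Prod>i = 0..<k. mat k k (\<lambda>(p, q). entry A (f p) (f q)) $$ (i, p i))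
      = (\<Prod>i = 0..<k. entry A (f i) (f (p i)))" if "p permutes {0..<k}" for p
      using that by (intro prod.cong) (auto dest: permutes_in_image)
    then show ?thesis
      unfolding principal_minor_def f_def[symmetric] k_def[symmetric]
      by (subst det_def'[where n = k]) (auto intro!: sum.cong)
  qed
  also have "\<dots> = pminor (entry A) J"
    unfolding pminor_def
  proof (rule sum.reindex_bij_witness[where i = "map_permutation J g" and j = "map_permutation {0..<k} f"])
    fix p assume p: "p \<in> {p. p permutes {0..<k}}"
    then have p: "p permutes {0..<k}" by simp
    show "map_permutation J g (map_permutation {0..<k} f p) = p"
      by (rule map_permutation_compose_inv[OF f p gf])
    show "map_permutation {0..<k} f p \<in> {\<pi>. \<pi> permutes J}"
      using map_permutation_permutes[OF f p] by simp
    have "(\<Prod>j\<in>J. entry A j (map_permutation {0..<k} f p j))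
      = (\<Prod>i\<in>{0..<k}. entry A (f i) (map_permutation {0..<k} f p (f i)))"
      by (rule prod.reindex_bij_betw[OF f, symmetric])
    also have "\<dots> = (\<Prod>i = 0..<k. entry A (f i) (f (p i)))"
      by (intro prod.cong) (simp_all add: map_permutation_apply[OF inj])
    finally show "of_int (sign (map_permutation {0..<k} f p)) * (\<Prod>j\<in>J. entry A j (map_permutation {0..<k} f p j))
      = signof p * (\<Prod>i = 0..<k. entry A (f i) (f (p i)))"
      by (simp add: sign_map_permutation[OF inj p])
  next
    fix p assume "p \<in> {p. p permutes J}"
    then have p: "p permutes J" by simp
    show "map_permutation {0..<k} f (map_permutation J g p) = p"
      by (rule map_permutation_compose_inv[OF g p fg])
    show "map_permutation J g p \<in> {\<pi>. \<pi> permutes {0..<k}}"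
      using map_permutation_permutes[OF g p] by simp
  qed
  finally show ?thesis .
qed

text \<open>When the products of \<open>x + I\<close> are multiplied out, \<open>J\<close> collects
  the indices at which the factor is taken from \<open>x\<close>. The Kronecker factors on the
  complement survive only if the permutation fixes it, that is, permutes \<open>J\<close>.\<close>

lemma idet_eq_sum_pminor: "idet n x = (\<Sum>J\<in>Pow {..<n}. pminor x J)"
proof -
  let ?d = "\<lambda>j k :: nat. (if j = k then 1 else 0 :: complex)"
  have perm: "{\<pi>. \<pi> permutes {..<n} \<and> (\<forall>i\<in>{..<n} - J. i = \<pi> i)} = {\<pi>. \<pi> permutes J}"
    if "J \<in> Pow {..<n}" for J
    using that by (auto intro: permutes_subset simp: permutes_not_in)
      (metis DiffI lessThan_iff permutes_superset)
  have fin: "finite {\<pi>. \<pi> permutes {..<n}}" by (simp add: finite_permutations)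
  have "idet n x = (\<Sum>p | p permutes {0..<n}. signof p * (\<Prod>i = 0..<n. x i (p i) + ?d i (p i)))"
  proof -
    have "(\<Prod>i = 0..<n. mat n n (\<lambda>(j, k). ?d j k + x j k) $$ (i, p i))
      = (\<Prod>i = 0..<n. x i (p i) + ?d i (p i))" if "p permutes {0..<n}" for p
      using that by (intro prod.cong) (auto dest: permutes_in_image)
    then show ?thesis
      unfolding idet_def
      by (subst det_def'[where n = n]) (auto intro!: sum.cong)
  qed
  also have "\<dots> = (\<Sum>p | p permutes {..<n}. of_int (sign p) *
      (\<Sum>J\<in>Pow {..<n}. (\<Prod>i\<in>J. x i (p i)) * (\<Prod>i\<in>{..<n} - J. ?d i (p i))))"
    by (simp only: atLeast0LessThan prod_add[OF finite_lessThan])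
  also have "\<dots> = (\<Sum>J\<in>Pow {..<n}. \<Sum>p | p permutes {..<n}.
      if \<forall>i\<in>{..<n} - J. i = p i then of_int (sign p) * (\<Prod>i\<in>J. x i (p i)) else 0)"
    unfolding sum_distrib_left
    by (subst sum.swap, intro sum.cong refl) (auto intro!: prod_zero)
  also have "\<dots> = (\<Sum>J\<in>Pow {..<n}. pminor x J)"
  proof (rule sum.cong[OF refl])
    fix J assume J: "J \<in> Pow {..<n}"
    show "(\<Sum>p | p permutes {..<n}.
      if \<forall>i\<in>{..<n} - J. i = p i then of_int (sign p) * (\<Prod>i\<in>J. x i (p i)) else 0) = pminor x J"
      unfolding pminor_def perm[OF J, symmetric]
      using fin by (simp add: sum.If_cases Int_def conj_commute)
  qed
  finally show ?thesis .
qed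

section \<open>Majorants of principal minors\<close>

text \<open>A permutation only reorders the factors \<open>q\<close>, so every term of the Leibniz
  sum has the same majorant. The factorial is the number of terms; it is absorbed by the next
  lemma.\<close>

lemma cmod_pminor_le:
  assumes "finite J" and "\<And>j k. cmod (x j k) \<le> p j * q k"
  shows "cmod (pminor x J) \<le> fact (card J) * (\<Prod>j\<in>J. p j * q j)"
proof -
  have "cmod (pminor x J) \<le> (\<Sum>\<pi> | \<pi> permutes J. cmod (of_int (sign \<pi>) * (\<Prod>j\<in>J. x j (\<pi> j))))"
    unfolding pminor_def by (rule norm_sum)
  also have "\<dots> \<le> (\<Sum>\<pi> | \<pi> permutes J. \<Prod>j\<in>J. p j * q j)"
  proof (rule sum_mono)
    fix \<pi> assume "\<pi> \<in> {\<pi>. \<pi> permutes J}"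
    then have \<pi>: "\<pi> permutes J" by simp
    have s: "cmod (of_int (sign \<pi>)) = 1" by (cases \<pi> rule: sign_cases) auto
    have "cmod (of_int (sign \<pi>) * (\<Prod>j\<in>J. x j (\<pi> j))) = (\<Prod>j\<in>J. cmod (x j (\<pi> j)))"
      by (simp only: norm_mult s prod_norm mult_1_left)
    also have "\<dots> \<le> (\<Prod>j\<in>J. p j * q (\<pi> j))"
      by (intro prod_mono) (simp add: assms)
    also have "\<dots> = (\<Prod>j\<in>J. p j) * (\<Prod>j\<in>J. q (\<pi> j))" by (rule prod.distrib)
    also have "(\<Prod>j\<in>J. q (\<pi> j)) = (\<Prod>j\<in>J. q j)"
      using prod.permute[OF \<pi>, of q] by (simp add: o_def)
    finally show "cmod (of_int (sign \<pi>) * (\<Prod>j\<in>J. x j (\<pi> j))) \<le> (\<Prod>j\<in>J. p j * q j)"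
      by (simp add: prod.distrib)
  qed
  also have "\<dots> = fact (card J) * (\<Prod>j\<in>J. p j * q j)"
    using assms(1) by (simp add: card_permutations[OF refl])
  finally show ?thesis .
qed

text \<open>The left side collects those terms of the expanded power that belong to ordered k-tuples
  of distinct indices. This cancels the factorial of \<open>cmod_pminor_le\<close>, but leaves a
  geometric and not an exponential majorant, hence the need for small sums below.\<close>

lemma fact_elementary_symmetric_le:
  fixes c :: "'a \<Rightarrow> real"
  assumes "finite X" and "\<And>j. 0 \<le> c j"
  shows "fact k * (\<Sum>J | J \<subseteq> X \<and> card J = k. \<Prod>j\<in>J. c j) \<le> (\<Sum>j\<in>X. c j) ^ k"
  using assms(1)
proof (induction X arbitrary: k rule: finite_induct)
  case empty
  have *: "{J. J \<subseteq> {} \<and> card J = k} = (if k = 0 then {{}} else {})" by auto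
  show ?case by (subst *) simp
next
  case (insert x X)
  define s where "s = (\<Sum>j\<in>X. c j)"
  have s0: "0 \<le> s" unfolding s_def by (intro sum_nonneg assms)
  have cx: "0 \<le> c x" by (rule assms)
  show ?case
  proof (cases k)
    case 0
    have "{J. J \<subseteq> insert x X \<and> card J = k} = {{}}"
      using insert.hyps(1) 0 by (auto dest: finite_subset)
    then show ?thesis by (simp add: 0)
  next
    case (Suc m)
    have eq: "{J. J \<subseteq> insert x X \<and> card J = Suc m}
      = {J. J \<subseteq> X \<and> card J = Suc m} \<union> insert x ` {J. J \<subseteq> X \<and> card J = m}" (is "?L = ?A \<union> ?B")
    proof (intro equalityI subsetI)
      fix J assume J: "J \<in> ?L"
      show "J \<in> ?A \<union> ?B"
      proof (cases "x \<in> J")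
        case True
        have "card (J - {x}) = m" using J True by simp
        moreover have "J = insert x (J - {x})" "J - {x} \<subseteq> X" using J True by auto
        ultimately show ?thesis by blast
      qed (use J in auto)
    next
      fix J assume "J \<in> ?A \<union> ?B"
      then show "J \<in> ?L"
        using insert.hyps by (auto simp: card_insert_if finite_subset)
    qed
    have inj: "inj_on (insert x) {J. J \<subseteq> X \<and> card J = m}"
      using insert.hyps(2) by (auto simp: inj_on_def)
    have "(\<Sum>J\<in>?L. \<Prod>j\<in>J. c j) = (\<Sum>J\<in>?A. \<Prod>j\<in>J. c j) + (\<Sum>J\<in>?B. \<Prod>j\<in>J. c j)"
      unfolding eq using insert.hyps by (intro sum.union_disjoint) auto
    also have "(\<Sum>J\<in>?B. \<Prod>j\<in>J. c j) = (\<Sum>J | J \<subseteq> X \<and> card J = m. c x * (\<Prod>j\<in>J. c j))"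
      unfolding sum.reindex[OF inj]
    proof (rule sum.cong[OF refl])
      fix J assume "J \<in> {J. J \<subseteq> X \<and> card J = m}"
      then have "finite J" "x \<notin> J" using insert.hyps finite_subset by auto
      then show "(prod c \<circ> insert x) J = c x * (\<Prod>j\<in>J. c j)" by simp
    qed
    finally have "fact k * (\<Sum>J\<in>?L. \<Prod>j\<in>J. c j)
      = fact k * (\<Sum>J\<in>?A. \<Prod>j\<in>J. c j) + real k * c x * (fact m * (\<Sum>J | J \<subseteq> X \<and> card J = m. \<Prod>j\<in>J. c j))"
      by (simp add: Suc sum_distrib_left algebra_simps)
    also have "\<dots> \<le> s ^ k + real k * c x * s ^ m"
      using insert.IH[of k] insert.IH[of m] cx
      by (intro add_mono mult_left_mono) (auto simp: s_def Suc)
    also have "\<dots> \<le> (c x + s) ^ k"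
    proof -
      \<comment> \<open>These are the first two terms of the binomial expansion of the right
        side.\<close>
      have "s ^ Suc m + real (Suc m) * c x * s ^ m \<le> (c x + s) ^ Suc m" for m
      proof (induction m)
        case (Suc m)
        have "s ^ Suc (Suc m) + real (Suc (Suc m)) * c x * s ^ Suc m
          \<le> (c x + s) * (s ^ Suc m + real (Suc m) * c x * s ^ m)"
          using cx s0 by (simp add: algebra_simps)
        also have "\<dots> \<le> (c x + s) * (c x + s) ^ Suc m"
          by (intro mult_left_mono Suc.IH) (use cx s0 in auto)
        finally show ?case by simp
      qed simp
      then show ?thesis by (simp add: Suc)
    qed
    finally show ?thesis using insert.hyps by (simp add: Suc s_def)
  qed
qed

text \<open>With \<open>c j = p j * q j\<close> this is the bound from
  \<open>cmod_pminor_le\<close>.\<close>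

definition pweight :: "(nat \<Rightarrow> real) \<Rightarrow> nat set \<Rightarrow> real"
  where "pweight c J = fact (card J) * (\<Prod>j\<in>J. c j)"

lemma pweight_nonneg: "(\<And>j. 0 \<le> c j) \<Longrightarrow> 0 \<le> pweight c J"
  by (simp add: pweight_def prod_nonneg)

text \<open>The free weight \<open>w\<close> is used in two ways: as the indicator of k >= 2, which
  isolates the error of the linear approximation, and as 2^k for the tail in
  \<open>sum_pweight_bounded\<close>.\<close>

lemma sum_pweight_by_card:
  assumes "finite X" and "\<And>j. 0 \<le> c j" and "\<And>k. 0 \<le> (w k :: real)"
  shows "(\<Sum>J\<in>Pow X. w (card J) * pweight c J) \<le> (\<Sum>k\<le>card X. w k * (\<Sum>j\<in>X. c j) ^ k)"
proof -
  have "(\<Sum>J\<in>Pow X. w (card J) * pweight c J)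
    = (\<Sum>k\<le>card X. \<Sum>J | J \<in> Pow X \<and> card J = k. w (card J) * pweight c J)"
    using assms(1) by (intro sum.group[symmetric]) (auto intro: card_mono)
  also have "\<dots> = (\<Sum>k\<le>card X. w k * (fact k * (\<Sum>J | J \<subseteq> X \<and> card J = k. \<Prod>j\<in>J. c j)))"
    by (intro sum.cong refl) (auto simp: sum_distrib_left pweight_def intro!: sum.cong)
  also have "\<dots> \<le> (\<Sum>k\<le>card X. w k * (\<Sum>j\<in>X. c j) ^ k)"
    by (intro sum_mono mult_left_mono fact_elementary_symmetric_le assms)
  finally show ?thesis .
qed

text \<open>The geometric tail is s^2 / (1 - s), and the factor 2 reflects s <= 1/2.\<close>

lemma sum_pweight_ge2:
  assumes "\<And>j. 0 \<le> c j" and "(\<Sum>j<n. c j) \<le> s" and "s \<le> 1 / 2"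
  shows "(\<Sum>J\<in>{J \<in> Pow {..<n}. 2 \<le> card J}. pweight c J) \<le> 2 * s\<^sup>2"
proof -
  have s0: "0 \<le> s" using assms(2) sum_nonneg[of "{..<n}" c] assms(1) by fastforce
  define w :: "nat \<Rightarrow> real" where "w k = (if 2 \<le> k then 1 else 0)" for k
  have "(\<Sum>J\<in>{J \<in> Pow {..<n}. 2 \<le> card J}. pweight c J) = (\<Sum>J\<in>Pow {..<n}. w (card J) * pweight c J)"
    by (rule sum.mono_neutral_cong_left) (auto simp: w_def)
  also have "\<dots> \<le> (\<Sum>k\<le>card {..<n}. w k * (\<Sum>j<n. c j) ^ k)"
    by (intro sum_pweight_by_card) (auto simp: assms w_def)
  also have "\<dots> \<le> (\<Sum>k\<le>card {..<n}. w k * s ^ k)"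
    by (intro sum_mono mult_left_mono power_mono assms sum_nonneg) (auto simp: w_def)
  also have "\<dots> = (\<Sum>k\<in>{2..n}. s ^ k)"
    by (rule sum.mono_neutral_cong_right) (auto simp: w_def)
  also have "\<dots> = (\<Sum>k<n - 1. s\<^sup>2 * s ^ k)"
  proof (rule sum.reindex_bij_witness[where i = "\<lambda>k. k + 2" and j = "\<lambda>k. k - 2"])
    fix k assume "k \<in> {2..n}"
    then show "s\<^sup>2 * s ^ (k - 2) = s ^ k" 
      by (metis atLeastAtMost_iff le_add_diff_inverse power_add)
  qed auto
  also have "\<dots> = s\<^sup>2 * (\<Sum>k<n - 1. s ^ k)" by (simp add: sum_distrib_left)
  also have "\<dots> \<le> s\<^sup>2 * 2"
  proof (rule mult_left_mono)
    have "(\<Sum>k<n - 1. s ^ k) \<le> (\<Sum>k. s ^ k)"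
      using s0 assms(3) by (intro sum_le_suminf summable_geometric) auto
    also have "\<dots> = 1 / (1 - s)" using s0 assms(3) by (intro suminf_geometric) simp
    also have "\<dots> \<le> 2" using assms(3) by (simp add: field_simps)
    finally show "(\<Sum>k<n - 1. s ^ k) \<le> 2" .
  qed simp
  finally show ?thesis by simp
qed

text \<open>Splitting off finitely many indices reduces to the case that the sum of \<open>c\<close> is at most
  \<open>1/4\<close>, where the weight \<open>2^k\<close> lost in \<open>(i + k)! \<le> 2^(i + k) i! k!\<close> does no harm.\<close>

lemma sum_pweight_bounded:
  assumes c: "\<And>j. 0 \<le> c j" and "summable c"
  shows "\<exists>B. \<forall>n. (\<Sum>J\<in>Pow {..<n}. pweight c J) \<le> B"
proof -
  obtain m where m: "\<And>n. (\<Sum>j\<in>{m..<n}. c j) \<le> 1 / 4"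
  proof -
    have "\<exists>N. \<forall>m\<ge>N. \<forall>n. norm (sum c {m..<n}) < 1 / 4"
      using assms(2) unfolding summable_Cauchy by (metis less_divide_eq_1_pos zero_less_divide_1_iff zero_less_numeral)
    then show ?thesis by (metis abs_ge_self less_eq_real_def linorder_not_le order_refl order_trans real_norm_def that)
  qed
  define v :: "nat set \<Rightarrow> real" where "v J = 2 ^ card J * pweight c J" for J
  have v0: "0 \<le> v J" for J unfolding v_def by (simp add: pweight_nonneg c)
  have tail: "(\<Sum>J\<in>Pow {m..<n}. v J) \<le> 2" for n
  proof -
    have "(\<Sum>J\<in>Pow {m..<n}. v J) \<le> (\<Sum>k\<le>card {m..<n}. 2 ^ k * (\<Sum>j\<in>{m..<n}. c j) ^ k)"
      unfolding v_def by (rule sum_pweight_by_card) (auto simp: c)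
    also have "\<dots> \<le> (\<Sum>k\<le>card {m..<n}. (1 / 2) ^ k)"
    proof (rule sum_mono)
      fix k
      have "2 ^ k * (\<Sum>j\<in>{m..<n}. c j) ^ k \<le> 2 ^ k * (1 / 4) ^ k"
        by (intro mult_left_mono power_mono m sum_nonneg c) simp
      also have "\<dots> = (1 / 2 :: real) ^ k" by (simp flip: power_mult_distrib)
      finally show "2 ^ k * (\<Sum>j\<in>{m..<n}. c j) ^ k \<le> (1 / 2) ^ k" .
    qed
    also have "\<dots> \<le> (\<Sum>k. (1 / 2 :: real) ^ k)"
      by (intro sum_le_suminf summable_geometric) auto
    also have "\<dots> = 2" by (subst suminf_geometric) auto
    finally show ?thesis .
  qed
  have large: "(\<Sum>J\<in>Pow {..<n}. pweight c J) \<le> (\<Sum>J\<in>Pow {..<m}. v J) * 2" if "m \<le> n" for n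
  proof -
    have "(\<Sum>J\<in>Pow {..<n}. pweight c J)
      = (\<Sum>(J1, J2)\<in>Pow {..<m} \<times> Pow {m..<n}. pweight c (J1 \<union> J2))"
      using that
      by (intro sum.reindex_bij_witness[where i = "\<lambda>(J1, J2). J1 \<union> J2"
            and j = "\<lambda>J. (J \<inter> {..<m}, J \<inter> {m..<n})"]) (auto simp: Int_Un_distrib2 intro!: arg_cong[of _ _ "pweight c"])
    also have "\<dots> \<le> (\<Sum>(J1, J2)\<in>Pow {..<m} \<times> Pow {m..<n}. v J1 * v J2)"
    proof (rule sum_mono, clarify)
      fix J1 J2 assume J: "J1 \<subseteq> {..<m}" "J2 \<subseteq> {m..<n}"
      have fin: "finite J1" "finite J2" using J finite_subset by blast+
      have disj: "J1 \<inter> J2 = {}" using J by fastforce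
      define i k where "i = card J1" and "k = card J2"
      have "(fact (i + k) :: real) = real ((i + k) choose i) * fact i * fact k"
        by (simp add: binomial_fact)
      also have "\<dots> \<le> 2 ^ (i + k) * fact i * fact k"
      proof -
        have "real ((i + k) choose i) \<le> real (2 ^ (i + k))"
          using binomial_le_pow2[of "i + k" i] by (simp only: of_nat_le_iff)
        then show ?thesis by (intro mult_right_mono) auto
      qed
      finally have f: "(fact (i + k) :: real) \<le> 2 ^ i * fact i * (2 ^ k * fact k)"
        by (simp add: power_add mult_ac)
      have "pweight c (J1 \<union> J2) = fact (i + k) * ((\<Prod>j\<in>J1. c j) * (\<Prod>j\<in>J2. c j))"
        using fin disj by (simp add: pweight_def card_Un_disjoint prod.union_disjoint i_def k_def)
      also have "\<dots> \<le> 2 ^ i * fact i * (2 ^ k * fact k) * ((\<Prod>j\<in>J1. c j) * (\<Prod>j\<in>J2. c j))"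
        by (intro mult_right_mono f mult_nonneg_nonneg prod_nonneg c)
      finally show "pweight c (J1 \<union> J2) \<le> v J1 * v J2"
        by (simp add: v_def pweight_def i_def k_def mult_ac)
    qed
    also have "\<dots> = (\<Sum>J\<in>Pow {..<m}. v J) * (\<Sum>J\<in>Pow {m..<n}. v J)"
      by (simp add: sum_product sum.cartesian_product)
    also have "\<dots> \<le> (\<Sum>J\<in>Pow {..<m}. v J) * 2"
      by (intro mult_left_mono tail sum_nonneg v0)
    finally show ?thesis .
  qed
  have "(\<Sum>J\<in>Pow {..<n}. pweight c J) \<le> (\<Sum>J\<in>Pow {..<m}. v J) * 2" for n
  proof -
    have "(\<Sum>J\<in>Pow {..<n}. pweight c J) \<le> (\<Sum>J\<in>Pow {..<max m n}. pweight c J)"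
      by (intro sum_mono2 pweight_nonneg c) auto
    also have "\<dots> \<le> (\<Sum>J\<in>Pow {..<m}. v J) * 2" by (rule large) simp
    finally show ?thesis .
  qed
  then show ?thesis by blast
qed

lemma pweight_summable:
  assumes c: "\<And>j. 0 \<le> c j" and "summable c"
  shows "pweight c summable_on {J. finite J}"
proof -
  obtain B where B: "\<And>n. (\<Sum>J\<in>Pow {..<n}. pweight c J) \<le> B"
    using sum_pweight_bounded[OF assms] by blast
  show ?thesis
  proof (rule nonneg_bdd_above_summable_on)
    show "bdd_above (sum (pweight c) ` {F. F \<subseteq> {J. finite J} \<and> finite F})"
    proof (rule bdd_aboveI2)
      fix F :: "nat set set" assume F: "F \<in> {F. F \<subseteq> {J. finite J} \<and> finite F}"
      then have "finite (\<Union> F)" by auto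
      then obtain n where "\<Union> F \<subseteq> {..<n}" by (meson finite_nat_iff_bounded)
      then have "sum (pweight c) F \<le> (\<Sum>J\<in>Pow {..<n}. pweight c J)"
        by (intro sum_mono2 pweight_nonneg c) auto
      also have "\<dots> \<le> B" by (rule B)
      finally show "sum (pweight c) F \<le> B" .
    qed
  qed (simp add: pweight_nonneg c)
qed

section \<open>The infinite determinant as a limit and as a regrouped series\<close>

lemma bij_set_decode: "bij_betw set_decode UNIV {J. finite J}"
  by (rule bij_betw_byWitness[where f' = set_encode]) auto

lemma pweight_decode_summable:
  assumes "\<And>j. 0 \<le> c j" and "summable c"
  shows "summable (\<lambda>i. pweight c (set_decode i))"
  using pweight_summable[OF assms] summable_on_reindex_bij_betw[OF bij_set_decode, of "pweight c"]
  by (simp add: summable_on_imp_summable)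

text \<open>Dominated convergence for series. The matrix may change with \<open>n\<close>, because
  in the applications it contains products whose inner summation is cut off at
  \<open>n\<close>.\<close>

lemma tendsto_idet_fdet:
  fixes x :: "nat \<Rightarrow> nat \<Rightarrow> nat \<Rightarrow> complex"
  assumes bound: "\<And>n j k. cmod (x n j k) \<le> p j * q k"
    and "\<And>j. 0 \<le> p j" "\<And>k. 0 \<le> q k" and "summable (\<lambda>j. p j * q j)"
    and lim: "\<And>j k. (\<lambda>n. x n j k) \<longlonglongrightarrow> y j k"
  shows "(\<lambda>n. idet n (x n)) \<longlonglongrightarrow> fdet y"
proof -
  define c where "c j = p j * q j" for j
  \<comment> \<open>Minors that leave the first \<open>n\<close> indices are replaced by 0, so that
    each finite determinant becomes a series over the same index set.\<close>
  define a where "a i n = (if set_decode i \<subseteq> {..<n} then pminor (x n) (set_decode i) else 0)" for i n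
  have c0: "0 \<le> c j" for j by (simp add: c_def assms)
  have sc: "summable c" unfolding c_def by fact
  have idet: "idet n (x n) = (\<Sum>i. a i n)" for n
  proof -
    have inj: "inj_on set_encode (Pow {..<n})"
      by (rule inj_on_inverseI[where g = set_decode]) (simp add: finite_subset)
    have "(\<Sum>i. a i n) = (\<Sum>i\<in>set_encode ` Pow {..<n}. a i n)"
    proof (rule suminf_finite)
      fix i assume i: "i \<notin> set_encode ` Pow {..<n}"
      then have "\<not> set_decode i \<subseteq> {..<n}" by (metis PowI imageI set_decode_inverse)
      then show "a i n = 0" by (simp add: a_def)
    qed simp
    also have "\<dots> = (\<Sum>J\<in>Pow {..<n}. pminor (x n) J)"
      unfolding sum.reindex[OF inj] by (rule sum.cong) (auto simp: a_def finite_subset)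
    finally show ?thesis by (simp add: idet_eq_sum_pminor)
  qed
  have "((\<lambda>n. a i n) \<longlongrightarrow> pminor y (set_decode i)) sequentially" for i
  proof -
    obtain N where N: "set_decode i \<subseteq> {..<N}" using finite_nat_iff_bounded finite_set_decode by blast
    have "\<forall>\<^sub>F n in sequentially. pminor (x n) (set_decode i) = a i n"
      using eventually_ge_at_top[of N]
      by eventually_elim (use N in \<open>auto simp: a_def\<close>)
    moreover have "((\<lambda>n. pminor (x n) (set_decode i)) \<longlongrightarrow> pminor y (set_decode i)) sequentially"
      unfolding pminor_def by (intro tendsto_intros lim)
    ultimately show ?thesis by (rule Lim_transform_eventually[rotated])
  qed
  then have "((\<lambda>n. suminf (\<lambda>i. a i n)) \<longlongrightarrow> suminf (\<lambda>i. pminor y (set_decode i))) sequentially"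
  proof (rule tannerys_theorem[THEN conjunct2, THEN conjunct2])
    have "norm (a i n) \<le> pweight c (set_decode i)" for i n
      using cmod_pminor_le[OF finite_set_decode[of i], of "x n" p q] bound c0
      by (auto simp: a_def pweight_def c_def assms intro!: mult_nonneg_nonneg prod_nonneg)
    then show "\<forall>\<^sub>F (k, n) in sequentially \<times>\<^sub>F sequentially. norm (a k n) \<le> pweight c (set_decode k)"
      by (auto intro: always_eventually)
    show "summable (\<lambda>i. pweight c (set_decode i))" by (rule pweight_decode_summable[OF c0 sc])
  qed simp
  then show ?thesis by (simp add: idet fdet_def)
qed

text \<open>The domination makes the family of all minors absolutely summable, so it may be grouped
  by cardinality as in the Fredholm series or enumerated by binary codes.\<close>

lemma fredholm_det_eq_fdet:
  assumes bound: "\<And>j k. cmod (entry A j k) \<le> p j * q k"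
    and "\<And>j. 0 \<le> p j" "\<And>k. 0 \<le> q k" and "summable (\<lambda>j. p j * q j)"
  shows "fredholm_det (1 + A) = fdet (entry A)"
proof -
  define c where "c j = p j * q j" for j
  define f where "f = pminor (entry A)"
  have c0: "0 \<le> c j" for j by (simp add: c_def assms)
  have sc: "summable c" unfolding c_def by fact
  have le: "norm (f J) \<le> pweight c J" if "finite J" for J
    using cmod_pminor_le[OF that bound] by (simp add: pweight_def c_def f_def)
  have "(\<lambda>J. norm (f J)) summable_on {J. finite J}"
    by (rule summable_on_comparison_test[OF pweight_summable[OF c0 sc]]) (use le in auto)
  then have sum: "f summable_on {J. finite J}" by (rule abs_summable_summable)
  define D where "D k = {J :: nat set. finite J \<and> card J = k}" for k
  have bij: "bij_betw (\<lambda>J. (card J, J)) {J. finite J} (Sigma UNIV D)"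
    by (rule bij_betw_byWitness[where f' = snd]) (auto simp: D_def)
  have sumS: "(\<lambda>(k, J). f J) summable_on Sigma UNIV D"
    using sum by (subst summable_on_reindex_bij_betw[OF bij, symmetric]) simp
  have "infsum f {J. finite J} = infsum (\<lambda>(k, J). f J) (Sigma UNIV D)"
    by (subst infsum_reindex_bij_betw[OF bij, symmetric]) simp
  also have "\<dots> = infsum (\<lambda>k. infsum f (D k)) UNIV"
    using infsum_Sigma'_banach[OF sumS] by simp
  also have "\<dots> = (\<Sum>k. infsum f (D k))"
    using summable_on_Sigma_banach[OF sumS]
    by (metis (no_types, lifting) has_sum_imp_sums has_sum_infsum sums_unique)
  also have "\<dots> = fredholm_det (1 + A)"
    unfolding fredholm_det_def trace_exterior_power_def D_def f_def
    by (auto intro!: arg_cong[of _ _ suminf] infsum_cong simp: principal_minor_eq fun_eq_iff)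
  finally have 1: "infsum f {J. finite J} = fredholm_det (1 + A)" .
  have "infsum f {J. finite J} = infsum (\<lambda>i. f (set_decode i)) UNIV"
    by (rule infsum_reindex_bij_betw[OF bij_set_decode, symmetric])
  also have "\<dots> = fdet (entry A)"
    unfolding fdet_def f_def[symmetric]
    using sum summable_on_reindex_bij_betw[OF bij_set_decode, of f]
    by (metis (no_types, lifting) has_sum_imp_sums has_sum_infsum sums_unique)
  finally show ?thesis using 1 by simp
qed

text \<open>The empty set contributes 1 and the singletons the trace; all larger minors together are
  of second order by \<open>sum_pweight_ge2\<close>.\<close>

lemma idet_approx:
  assumes bound: "\<And>j k. cmod (x j k) \<le> p j * q k"
    and "\<And>j. 0 \<le> p j" "\<And>k. 0 \<le> q k" and "(\<Sum>j<n. p j * q j) \<le> s" "s \<le> 1 / 2"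
  shows "cmod (idet n x - 1 - (\<Sum>j<n. x j j)) \<le> 2 * s\<^sup>2"
proof -
  define c where "c j = p j * q j" for j
  have c0: "0 \<le> c j" for j by (simp add: c_def assms)
  let ?B = "{J \<in> Pow {..<n}. 2 \<le> card J}"
  have split: "Pow {..<n} = insert {} ((\<lambda>j. {j}) ` {..<n}) \<union> ?B"
  proof (intro equalityI subsetI)
    fix J assume J: "J \<in> Pow {..<n}"
    then have "finite J" using finite_subset by auto
    consider "card J = 0" | "card J = 1" | "2 \<le> card J" by linarith
    then show "J \<in> insert {} ((\<lambda>j. {j}) ` {..<n}) \<union> ?B"
    proof cases
      case 1 then show ?thesis using \<open>finite J\<close> by simp
    next
      case 2 then obtain a where "J = {a}" by (auto simp: card_1_singleton_iff)
      then show ?thesis using J by auto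
    qed (use J in auto)
  qed auto
  have one: "pminor x {} = 1" by (simp add: pminor_def)
  have sing: "pminor x {j} = x j j" for j
  proof -
    have "{\<pi>. \<pi> permutes {j}} = {id}" by (auto simp: permutes_sing)
    then show ?thesis by (simp add: pminor_def)
  qed
  have "idet n x = (\<Sum>J\<in>insert {} ((\<lambda>j. {j}) ` {..<n}). pminor x J) + (\<Sum>J\<in>?B. pminor x J)"
    unfolding idet_eq_sum_pminor by (subst split, rule sum.union_disjoint) auto
  also have "(\<Sum>J\<in>insert {} ((\<lambda>j. {j}) ` {..<n}). pminor x J) = 1 + (\<Sum>j<n. x j j)"
    by (subst sum.insert) (auto simp: one sing sum.reindex)
  finally have "idet n x - 1 - (\<Sum>j<n. x j j) = (\<Sum>J\<in>?B. pminor x J)" by simp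
  also have "cmod \<dots> \<le> (\<Sum>J\<in>?B. pweight c J)"
    using cmod_pminor_le[OF _ bound]
    by (intro sum_norm_le) (auto simp: pweight_def c_def finite_subset)
  also have "\<dots> \<le> 2 * s\<^sup>2"
    by (rule sum_pweight_ge2) (use assms c0 in \<open>auto simp: c_def\<close>)
  finally show ?thesis .
qed

section \<open>Algebra of finite determinants\<close>

lemma idet_mult:
  "idet n a * idet n b = idet n (\<lambda>j k. a j k + b j k + (\<Sum>l<n. a j l * b l k))"
proof -
  let ?d = "\<lambda>j k :: nat. (if j = k then 1 else 0 :: complex)"
  have "(\<Sum>l<n. (?d j l + a j l) * (?d l k + b l k)) = ?d j k + a j k + b j k + (\<Sum>l<n. a j l * b l k)"
    if "j < n" "k < n" for j k
  proof -
    have "(\<Sum>l<n. (?d j l + a j l) * (?d l k + b l k))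
      = (\<Sum>l<n. (if l = j then ?d l k + b l k else 0)) + (\<Sum>l<n. if l = k then a j l else 0) + (\<Sum>l<n. a j l * b l k)"
      unfolding sum.distrib[symmetric] by (rule sum.cong) (auto simp: algebra_simps)
    then show ?thesis using that by (simp add: algebra_simps)
  qed
  then have "mat n n (\<lambda>(j, k). ?d j k + a j k) * mat n n (\<lambda>(j, k). ?d j k + b j k)
    = mat n n (\<lambda>(j, k). ?d j k + (a j k + b j k + (\<Sum>l<n. a j l * b l k)))"
    by (intro eq_matI) (auto simp: scalar_prod_def atLeast0LessThan add.assoc)
  then show ?thesis
    unfolding idet_def by (subst det_mult[symmetric, where n = n]) auto
qed

text \<open>Both sides are the determinant of the block matrix with rows (1, -U) and (V, 1): one by
  the block formula, the other after the unipotent factor \<open>L\<close> has eliminated the lower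
  left block.\<close>

lemma idet_swap:
  "idet n (\<lambda>j k. \<Sum>l<n. u j l * v l k) = idet n (\<lambda>j k. \<Sum>l<n. v j l * u l k)"
proof -
  define U V where "U = mat n n (\<lambda>(j, k). u j k)" and "V = mat n n (\<lambda>(j, k). v j k)"
  have c: "U \<in> carrier_mat n n" "V \<in> carrier_mat n n" by (auto simp: U_def V_def)
  have e1: "mat n n (\<lambda>(j, k). (if j = k then 1 else 0) + (\<Sum>l<n. u j l * v l k)) = 1\<^sub>m n + U * V"
    by (intro eq_matI) (auto simp: U_def V_def scalar_prod_def atLeast0LessThan)
  have e2: "mat n n (\<lambda>(j, k). (if j = k then 1 else 0) + (\<Sum>l<n. v j l * u l k)) = 1\<^sub>m n + V * U"
    by (intro eq_matI) (auto simp: U_def V_def scalar_prod_def atLeast0LessThan)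
  define X where "X = four_block_mat (1\<^sub>m n) (- U) V (1\<^sub>m n)"
  have X: "X \<in> carrier_mat (n + n) (n + n)" unfolding X_def using c by simp
  define L where "L = four_block_mat (1\<^sub>m n) (0\<^sub>m n n) (- V) (1\<^sub>m n)"
  have L: "L \<in> carrier_mat (n + n) (n + n)" unfolding L_def using c by simp
  have "Determinant.det X = Determinant.det (1\<^sub>m n * 1\<^sub>m n - (- U) * V)"
    unfolding X_def by (rule det_four_block_mat) (use c in auto)
  also have "1\<^sub>m n * 1\<^sub>m n - (- U) * V = 1\<^sub>m n + U * V"
    using c by (intro eq_matI) auto
  finally have 1: "Determinant.det X = Determinant.det (1\<^sub>m n + U * V)" .
  have "L * X = four_block_mat (1\<^sub>m n) (- U) (0\<^sub>m n n) (1\<^sub>m n + V * U)"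
  proof -
    have "L * X = four_block_mat (1\<^sub>m n * 1\<^sub>m n + 0\<^sub>m n n * V) (1\<^sub>m n * (- U) + 0\<^sub>m n n * 1\<^sub>m n)
      ((- V) * 1\<^sub>m n + 1\<^sub>m n * V) ((- V) * (- U) + 1\<^sub>m n * 1\<^sub>m n)"
      unfolding L_def X_def using c by (intro mult_four_block_mat) auto
    also have "1\<^sub>m n * 1\<^sub>m n + 0\<^sub>m n n * V = 1\<^sub>m n" using c by auto
    also have "1\<^sub>m n * (- U) + 0\<^sub>m n n * 1\<^sub>m n = - U" using c by auto
    also have "(- V) * 1\<^sub>m n + 1\<^sub>m n * V = 0\<^sub>m n n" using c by (intro eq_matI) auto
    also have "(- V) * (- U) + 1\<^sub>m n * 1\<^sub>m n = 1\<^sub>m n + V * U" using c by (intro eq_matI) auto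
    finally show ?thesis .
  qed
  moreover have "Determinant.det (four_block_mat (1\<^sub>m n) (- U) (0\<^sub>m n n) (1\<^sub>m n + V * U))
    = Determinant.det (1\<^sub>m n) * Determinant.det (1\<^sub>m n + V * U)"
    by (rule det_four_block_mat_lower_left_zero) (use c in auto)
  moreover have "Determinant.det L = Determinant.det (1\<^sub>m n) * Determinant.det (1\<^sub>m n)"
    unfolding L_def by (rule det_four_block_mat_upper_right_zero) (use c in auto)
  moreover have "Determinant.det (L * X) = Determinant.det L * Determinant.det X"
    by (rule det_mult[OF L X])
  ultimately show ?thesis using 1 unfolding idet_def e1 e2 by simp
qed

section \<open>Matrices of operators\<close>

lemma op_apply_simps:
  "op_apply (A + B) x = op_apply A x + op_apply B x"
  "op_apply (A - B) x = op_apply A x - op_apply B x"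
  "op_apply (- A) x = - op_apply A x"
  "op_apply (A * B) x = op_apply A (op_apply B x)"
  "op_apply 1 x = x" "op_apply 0 x = 0"
  "op_apply (r *\<^sub>R A) x = r *\<^sub>R op_apply A x"
  "op_apply A (x + y) = op_apply A x + op_apply A y"
  "op_apply A (x - y) = op_apply A x - op_apply A y"
  "op_apply A (r *\<^sub>R x) = r *\<^sub>R op_apply A x"
  "op_apply A (c *\<^sub>C x) = c *\<^sub>C op_apply A x"
  "op_apply A 0 = 0"
  unfolding op_apply_def
  by (transfer; simp add: blinfun.bilinear_simps)+

lemma op_apply_scaleC: "op_apply (c *\<^sub>C A) x = c *\<^sub>C op_apply A x"
  unfolding op_apply_def
  by transfer (simp add: bounded_linear_scaleC bounded_linear_Blinfun_apply)

lemma norm_op_apply: "norm (op_apply A x) \<le> norm A * norm x"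
  unfolding op_apply_def by transfer (rule norm_blinfun)

lemma norm_op_le: "(\<And>x. norm (op_apply A x) \<le> C * norm x) \<Longrightarrow> 0 \<le> C \<Longrightarrow> norm A \<le> C"
  unfolding op_apply_def by transfer (auto intro: norm_blinfun_bound)

lemma op_eqI_apply: "(\<And>x. op_apply A x = op_apply B x) \<Longrightarrow> A = B"
  unfolding op_apply_def by transfer (simp add: blinfun_eqI)

lemma op_apply_sum: "op_apply A (\<Sum>i\<in>I. f i) = (\<Sum>i\<in>I. op_apply A (f i))"
  by (induction I rule: infinite_finite_induct) (simp_all add: op_apply_simps)

lemma coord_sum [simp]: "coord (\<Sum>i\<in>I. f i) n = (\<Sum>i\<in>I. coord (f i) n)"
  by (induction I rule: infinite_finite_induct) simp_all

definition fin_vec :: "nat \<Rightarrow> (nat \<Rightarrow> complex) \<Rightarrow> ell2"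
  where "fin_vec n f = (\<Sum>k<n. f k *\<^sub>C basis_ell2 k)"

lemma coord_fin_vec [simp]: "coord (fin_vec n f) k = (if k < n then f k else 0)"
proof -
  have "coord (fin_vec n f) k = (\<Sum>i<n. if i = k then f i else 0)"
    unfolding fin_vec_def by (simp add: if_distrib eq_commute cong: if_cong)
  then show ?thesis by simp
qed

lemma norm_fin_vec: "(norm (fin_vec n f))\<^sup>2 = (\<Sum>k<n. (cmod (f k))\<^sup>2)"
  unfolding norm_ell2_power2
  by (subst suminf_finite[where N = "{..<n}"]) auto

lemma fin_vec_coord: "fin_vec n (coord x) = cutoff n x"
  by (rule ell2_eqI) simp

lemma sum_coord_le: "(\<Sum>k<n. (cmod (coord x k))\<^sup>2) \<le> (norm x)\<^sup>2"
  unfolding norm_ell2_power2 by (rule sum_le_suminf[OF summable_coord]) auto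

lemma norm_le_of_sums:
  assumes "\<And>n. (\<Sum>k<n. (cmod (coord x k))\<^sup>2) \<le> C\<^sup>2" "0 \<le> C"
  shows "norm x \<le> C"
proof -
  have "(norm x)\<^sup>2 \<le> C\<^sup>2"
    unfolding norm_ell2_power2 by (rule suminf_le_const[OF summable_coord assms(1)])
  then show ?thesis using assms(2) by (simp add: power2_le_iff_abs_le)
qed

lemma cutoff_tendsto: "(\<lambda>n. cutoff n x) \<longlonglongrightarrow> x"
proof -
  have eq: "(norm (cutoff n x - x))\<^sup>2 = (\<Sum>k. (cmod (coord x k))\<^sup>2) - (\<Sum>k<n. (cmod (coord x k))\<^sup>2)" for n
  proof -
    let ?g = "\<lambda>k. if k \<in> {..<n} then (cmod (coord x k))\<^sup>2 else 0"
    have g: "?g sums (\<Sum>k<n. (cmod (coord x k))\<^sup>2)" by (rule sums_If_finite_set) simp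
    have "(\<lambda>k. (cmod (coord x k))\<^sup>2 - ?g k) sums ((\<Sum>k. (cmod (coord x k))\<^sup>2) - (\<Sum>k<n. (cmod (coord x k))\<^sup>2))"
      by (rule sums_diff[OF summable_sums[OF summable_coord] g])
    moreover have "(\<lambda>k. (cmod (coord x k))\<^sup>2 - ?g k) = (\<lambda>k. (cmod (coord (cutoff n x - x) k))\<^sup>2)"
      by auto
    ultimately show ?thesis unfolding norm_ell2_power2 by (simp only: sums_iff)
  qed
  have "(\<lambda>n. (norm (cutoff n x - x))\<^sup>2) \<longlonglongrightarrow> 0"
  proof -
    have "(\<lambda>n. (\<Sum>k. (cmod (coord x k))\<^sup>2) - (\<Sum>k<n. (cmod (coord x k))\<^sup>2))
      \<longlonglongrightarrow> (\<Sum>k. (cmod (coord x k))\<^sup>2) - (\<Sum>k. (cmod (coord x k))\<^sup>2)"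
      by (intro tendsto_diff tendsto_const summable_LIMSEQ summable_coord)
    then show ?thesis unfolding eq by simp
  qed
  then have "(\<lambda>n. sqrt ((norm (cutoff n x - x))\<^sup>2)) \<longlonglongrightarrow> sqrt 0"
    by (rule tendsto_real_sqrt)
  then show ?thesis by (simp add: tendsto_norm_zero_iff LIM_zero_iff)
qed

text \<open>Boundedness of \<open>A\<close> transfers the convergence of the truncations of
  \<open>x\<close> to the matrix series. This is what makes an operator determined by its matrix,
  and matrix products legitimate.\<close>

lemma sums_op_apply: "(\<lambda>k. entry A j k * coord x k) sums coord (op_apply A x) j"
proof -
  have eq: "(\<Sum>k<n. entry A j k * coord x k) = coord (op_apply A (cutoff n x)) j" for n
    unfolding fin_vec_coord[symmetric] fin_vec_def
    by (simp add: op_apply_sum op_apply_simps entry_def mult.commute)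
  have "(\<lambda>n. coord (op_apply A (cutoff n x)) j - coord (op_apply A x) j) \<longlonglongrightarrow> 0"
  proof (rule Lim_null_comparison)
    have "norm (coord (op_apply A (cutoff n x)) j - coord (op_apply A x) j) \<le> norm A * norm (cutoff n x - x)" for n
      using norm_coord_le[of "op_apply A (cutoff n x - x)" j] norm_op_apply[of A "cutoff n x - x"]
      by (simp add: op_apply_simps)
    then show "\<forall>\<^sub>F n in sequentially. norm (coord (op_apply A (cutoff n x)) j - coord (op_apply A x) j)
      \<le> norm A * norm (cutoff n x - x)" by simp
    have "(\<lambda>n. norm A * norm (cutoff n x - x)) \<longlonglongrightarrow> norm A * 0"
      using cutoff_tendsto[of x] by (intro tendsto_mult tendsto_const) (simp add: LIM_zero_iff tendsto_norm_zero_iff)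
    then show "(\<lambda>n. norm A * norm (cutoff n x - x)) \<longlonglongrightarrow> 0" by simp
  qed
  then show ?thesis unfolding sums_def eq by (simp add: LIM_zero_iff)
qed

lemma entry_simps:
  "entry (A + B) j k = entry A j k + entry B j k"
  "entry (A - B) j k = entry A j k - entry B j k"
  "entry (- A) j k = - entry A j k"
  "entry 1 j k = (if j = k then 1 else 0)" "entry 0 j k = 0"
  "entry (c *\<^sub>C A) j k = c * entry A j k"
  unfolding entry_def by (simp_all add: op_apply_simps op_apply_scaleC)

lemma entry_mult_sums: "(\<lambda>l. entry A j l * entry B l k) sums entry (A * B) j k"
  using sums_op_apply[of A j "op_apply B (basis_ell2 k)"]
  by (simp add: entry_def op_apply_simps)

lemma op_eqI:
  assumes "\<And>j k. entry A j k = entry B j k"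
  shows "A = B"
  using sums_op_apply[of A _ _] sums_op_apply[of B _ _] assms
  by (intro op_eqI_apply ell2_eqI) (metis (no_types, lifting) sums_cong sums_unique2)

lemma cmod_entry_le: "cmod (entry A j k) \<le> norm A"
proof -
  have "norm (basis_ell2 k) \<le> 1"
  proof (rule norm_le_of_sums)
    fix n
    have "(\<Sum>i<n. (cmod (coord (basis_ell2 k) i))\<^sup>2) = (\<Sum>i<n. if i = k then 1 else 0)"
      by (rule sum.cong) auto
    then show "(\<Sum>i<n. (cmod (coord (basis_ell2 k) i))\<^sup>2) \<le> 1\<^sup>2" by simp
  qed simp
  then have "norm A * norm (basis_ell2 k) \<le> norm A" using mult_left_le by fastforce
  then show ?thesis
    unfolding entry_def using norm_coord_le[of "op_apply A (basis_ell2 k)" j] norm_op_apply[of A "basis_ell2 k"]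
    by linarith
qed

lemma op_algebra_scaleC:
  "(c *\<^sub>C A) * B = c *\<^sub>C (A * B)" "A * (c *\<^sub>C B) = c *\<^sub>C (A * B)"
  "c *\<^sub>C (d *\<^sub>C A) = (c * d) *\<^sub>C (A :: ell2_op)"
  "c *\<^sub>C (A + B) = c *\<^sub>C A + c *\<^sub>C (B :: ell2_op)" "(c + d) *\<^sub>C A = c *\<^sub>C A + d *\<^sub>C (A :: ell2_op)"
  "1 *\<^sub>C A = A" "(- 1) *\<^sub>C A = - A"
  by (rule op_eqI_apply ell2_eqI, simp add: op_apply_simps op_apply_scaleC algebra_simps)+

lemma norm_scaleC_op: "norm (c *\<^sub>C (A :: ell2_op)) \<le> cmod c * norm A"
  by (rule norm_op_le)
    (simp_all add: op_apply_scaleC norm_scaleC mult.assoc mult_left_mono norm_op_apply)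

section \<open>Cauchy-Schwarz estimates and operators with given matrices\<close>

lemma Cauchy_Schwarz_sums:
  assumes "(\<lambda>l. a l * b l :: complex) sums s"
    and "\<And>n. (\<Sum>l<n. (cmod (a l))\<^sup>2) \<le> A" "\<And>n. (\<Sum>l<n. (cmod (b l))\<^sup>2) \<le> B"
  shows "(cmod s)\<^sup>2 \<le> A * B"
proof (rule LIMSEQ_le_const2)
  show "(\<lambda>n. (cmod (\<Sum>l<n. a l * b l))\<^sup>2) \<longlonglongrightarrow> (cmod s)\<^sup>2"
    using assms(1) unfolding sums_def by (intro tendsto_intros)
  have "(cmod (\<Sum>l<n. a l * b l))\<^sup>2 \<le> A * B" for n
  proof -
    have "cmod (\<Sum>l<n. a l * b l) \<le> (\<Sum>l<n. cmod (a l) * cmod (b l))"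
      by (rule order.trans[OF norm_sum]) (simp add: norm_mult)
    then have "(cmod (\<Sum>l<n. a l * b l))\<^sup>2 \<le> (\<Sum>l<n. cmod (a l) * cmod (b l))\<^sup>2"
      by (rule power_mono) simp
    also have "\<dots> \<le> (\<Sum>l<n. (cmod (a l))\<^sup>2) * (\<Sum>l<n. (cmod (b l))\<^sup>2)"
      by (rule Cauchy_Schwarz_ineq_sum)
    also have "\<dots> \<le> A * B"
      using assms(2)[of 0] by (intro mult_mono assms sum_nonneg) auto
    finally show ?thesis .
  qed
  then show "\<exists>N. \<forall>n\<ge>N. (cmod (\<Sum>l<n. a l * b l))\<^sup>2 \<le> A * B" by blast
qed

lemma Cauchy_Schwarz_summable:
  fixes a b :: "nat \<Rightarrow> complex"
  assumes "\<And>n. (\<Sum>l<n. (cmod (a l))\<^sup>2) \<le> A" "\<And>n. (\<Sum>l<n. (cmod (b l))\<^sup>2) \<le> B"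
  shows "summable (\<lambda>l. cmod (a l * b l))"
proof (rule summable_comparison_test')
  have "summable (\<lambda>l. (cmod (a l))\<^sup>2)" "summable (\<lambda>l. (cmod (b l))\<^sup>2)"
    by (rule summableI_nonneg_bounded[OF _ assms(1)] summableI_nonneg_bounded[OF _ assms(2)], simp)+
  then show "summable (\<lambda>l. (cmod (a l))\<^sup>2 + (cmod (b l))\<^sup>2)" by (rule summable_add)
  fix l
  have "2 * (cmod (a l) * cmod (b l)) \<le> (cmod (a l))\<^sup>2 + (cmod (b l))\<^sup>2"
    using sum_squares_bound[of "cmod (a l)" "cmod (b l)"] by (simp add: mult.assoc)
  moreover have "0 \<le> cmod (a l) * cmod (b l)" by simp
  ultimately show "norm (cmod (a l * b l)) \<le> (cmod (a l))\<^sup>2 + (cmod (b l))\<^sup>2"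
    unfolding norm_mult real_norm_def abs_norm_cancel abs_mult by linarith
qed

text \<open>The closing step of the duality arguments below: a row or functional is tested on its
  own conjugate coefficients, which bounds the square of the sum of squares \<open>s\<close> by a
  multiple of \<open>s\<close> itself.\<close>

lemma le_of_le_mult_sqrt:
  fixes s :: real
  assumes "s\<^sup>2 \<le> A * s" "0 \<le> s" "0 \<le> A"
  shows "s \<le> A"
  using assms by (cases "s = 0") (auto simp: power2_eq_square)

text \<open>\<open>op_of_matrix\<close> is a definite description and says something only once an
  operator with that matrix exists; a uniform bound on finite blocks provides one.\<close>

lemma op_of_bounded_matrix:
  assumes bound: "\<And>n f J. (\<Sum>j<J. (cmod (\<Sum>k<n. m j k * f k))\<^sup>2) \<le> C\<^sup>2 * (\<Sum>k<n. (cmod (f k))\<^sup>2)"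
    and C: "0 \<le> C"
  obtains A where "\<And>j k. entry A j k = m j k" "norm A \<le> C"
proof -
  \<comment> \<open>The assumed bound is applied to the conjugate of row \<open>j\<close> itself;
    the resulting square-summability makes the row series converge on all of
    \<open>ell2\<close>.\<close>
  have row: "(\<Sum>k<n. (cmod (m j k))\<^sup>2) \<le> C\<^sup>2" for j n
  proof (rule le_of_le_mult_sqrt)
    let ?s = "\<Sum>k<n. (cmod (m j k))\<^sup>2"
    have "(\<Sum>k<n. m j k * cnj (m j k)) = complex_of_real ?s"
      by (simp add: complex_norm_square[symmetric] del: of_real_power)
    then have "?s\<^sup>2 = (cmod (\<Sum>k<n. m j k * cnj (m j k)))\<^sup>2" by (simp only: norm_of_real power2_abs)
    also have "\<dots> \<le> (\<Sum>i<Suc j. (cmod (\<Sum>k<n. m i k * cnj (m j k)))\<^sup>2)"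
      by (rule member_le_sum[where f = "\<lambda>i. (cmod (\<Sum>k<n. m i k * cnj (m j k)))\<^sup>2"]) auto
    also have "\<dots> \<le> C\<^sup>2 * ?s" using bound[where n = n and f = "\<lambda>k. cnj (m j k)" and J = "Suc j"] by (simp only: complex_mod_cnj)
    finally show "?s\<^sup>2 \<le> C\<^sup>2 * ?s" .
  qed (auto intro: sum_nonneg)
  have summ: "summable (\<lambda>k. m j k * coord x k)" for j x
    by (rule summable_norm_cancel, rule Cauchy_Schwarz_summable[OF row sum_coord_le])
  define g where "g x j = (\<Sum>k. m j k * coord x k)" for x j
  have gb: "(\<Sum>j<J. (cmod (g x j))\<^sup>2) \<le> C\<^sup>2 * (norm x)\<^sup>2" for x J
  proof (rule LIMSEQ_le_const2)
    show "(\<lambda>n. \<Sum>j<J. (cmod (\<Sum>k<n. m j k * coord x k))\<^sup>2) \<longlonglongrightarrow> (\<Sum>j<J. (cmod (g x j))\<^sup>2)"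
      unfolding g_def by (intro tendsto_intros summable_LIMSEQ summ)
    have "(\<Sum>j<J. (cmod (\<Sum>k<n. m j k * coord x k))\<^sup>2) \<le> C\<^sup>2 * (norm x)\<^sup>2" for n
      by (rule order.trans[OF bound]) (simp add: mult_left_mono sum_coord_le)
    then show "\<exists>N. \<forall>n\<ge>N. (\<Sum>j<J. (cmod (\<Sum>k<n. m j k * coord x k))\<^sup>2) \<le> C\<^sup>2 * (norm x)\<^sup>2" by blast
  qed
  have sq: "summable (\<lambda>j. (cmod (g x j))\<^sup>2)" for x
    by (rule summableI_nonneg_bounded[OF _ gb]) simp
  define T where "T x = Abs_ell2 (g x)" for x
  have T: "coord (T x) j = g x j" for x j
    using sq[of x] by (simp add: T_def Abs_ell2_inverse)
  have lin: "T (x + y) = T x + T y" "T (r *\<^sub>R x) = r *\<^sub>R T x" "T (c *\<^sub>C x) = c *\<^sub>C T x" for x y r c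
    using summ[of _ x] summ[of _ y]
    by (intro ell2_eqI; simp add: T g_def distrib_left suminf_add suminf_mult[symmetric] mult_ac)+
  have nT: "norm (T x) \<le> C * norm x" for x
    using gb[of x] C by (intro norm_le_of_sums) (auto simp: T power_mult_distrib)
  have bl: "bounded_linear T"
    by (rule bounded_linear_intro[where K = C]) (simp_all add: lin nT mult.commute)
  define A where "A = Abs_ell2_op (Blinfun T)"
  have A: "op_apply A x = T x" for x
    unfolding op_apply_def A_def
    by (subst Abs_ell2_op_inverse) (simp_all add: bounded_linear_Blinfun_apply[OF bl] lin)
  have "entry A j k = m j k" for j k
  proof -
    have "g (basis_ell2 k) j = (\<Sum>i\<in>{k}. m j i * coord (basis_ell2 k) i)"
      unfolding g_def by (rule suminf_finite) auto
    then show ?thesis by (simp add: entry_def A T)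
  qed
  moreover have "norm A \<le> C" by (rule norm_op_le) (simp_all add: A nT C)
  ultimately show ?thesis by (rule that)
qed

lemma op_of_matrix_eqI: "(\<And>j k. entry A j k = m j k) \<Longrightarrow> op_of_matrix m = A"
  unfolding op_of_matrix_def by (rule the_equality) (auto intro: op_eqI)

section \<open>Hilbert-Schmidt operators\<close>

text \<open>\<open>t\<close> bounds the square of the Hilbert-Schmidt norm. Finite blocks in place
  of a double series keep summability out of the estimates.\<close>

definition hs_bound :: "ell2_op \<Rightarrow> real \<Rightarrow> bool"
  where "hs_bound A t \<longleftrightarrow> (\<forall>m n. (\<Sum>j<m. \<Sum>k<n. (cmod (entry A j k))\<^sup>2) \<le> t)"

lemma hs_boundD: "hs_bound A t \<Longrightarrow> (\<Sum>j<m. \<Sum>k<n. (cmod (entry A j k))\<^sup>2) \<le> t"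
  by (simp add: hs_bound_def)

lemma hs_bound_nonneg: "hs_bound A t \<Longrightarrow> 0 \<le> t"
  using hs_boundD[of A t 0 0] by simp

lemma hs_row:
  assumes "hs_bound A t"
  shows "(\<Sum>k<n. (cmod (entry A j k))\<^sup>2) \<le> t"
proof -
  have "(\<Sum>k<n. (cmod (entry A j k))\<^sup>2) \<le> (\<Sum>j<Suc j. \<Sum>k<n. (cmod (entry A j k))\<^sup>2)"
    by (rule member_le_sum[where f = "\<lambda>j. \<Sum>k<n. (cmod (entry A j k))\<^sup>2"]) (auto intro: sum_nonneg)
  then show ?thesis using hs_boundD[OF assms, where m = "Suc j" and n = n] by linarith
qed

lemma hs_col:
  assumes "hs_bound A t"
  shows "(\<Sum>j<n. (cmod (entry A j k))\<^sup>2) \<le> t"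
proof -
  have "(\<Sum>j<n. (cmod (entry A j k))\<^sup>2) \<le> (\<Sum>j<n. \<Sum>k<Suc k. (cmod (entry A j k))\<^sup>2)"
    by (intro sum_mono member_le_sum[where f = "\<lambda>k. (cmod (entry A _ k))\<^sup>2"]) auto
  then show ?thesis using hs_boundD[OF assms, where m = n and n = "Suc k"] by linarith
qed

definition row_norm :: "ell2_op \<Rightarrow> nat \<Rightarrow> real"
  where "row_norm A j = sqrt (\<Sum>k. (cmod (entry A j k))\<^sup>2)"

definition col_norm :: "ell2_op \<Rightarrow> nat \<Rightarrow> real"
  where "col_norm A k = sqrt (\<Sum>j. (cmod (entry A j k))\<^sup>2)"

lemma summable_row: "hs_bound A t \<Longrightarrow> summable (\<lambda>k. (cmod (entry A j k))\<^sup>2)"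
  by (rule summableI_nonneg_bounded[OF _ hs_row]) simp

lemma summable_col: "hs_bound A t \<Longrightarrow> summable (\<lambda>j. (cmod (entry A j k))\<^sup>2)"
  by (rule summableI_nonneg_bounded[OF _ hs_col]) simp

lemma norm_nonneg_row [simp]: "hs_bound A t \<Longrightarrow> 0 \<le> row_norm A j"
  unfolding row_norm_def by (intro real_sqrt_ge_zero suminf_nonneg summable_row) auto

lemma norm_nonneg_col [simp]: "hs_bound A t \<Longrightarrow> 0 \<le> col_norm A j"
  unfolding col_norm_def by (intro real_sqrt_ge_zero suminf_nonneg summable_col) auto

lemma row_norm_sq: "hs_bound A t \<Longrightarrow> (row_norm A j)\<^sup>2 = (\<Sum>k. (cmod (entry A j k))\<^sup>2)"
  unfolding row_norm_def by (intro real_sqrt_pow2 suminf_nonneg summable_row) auto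

lemma col_norm_sq: "hs_bound A t \<Longrightarrow> (col_norm A k)\<^sup>2 = (\<Sum>j. (cmod (entry A j k))\<^sup>2)"
  unfolding col_norm_def by (intro real_sqrt_pow2 suminf_nonneg summable_col) auto

lemma sum_row_le: "hs_bound A t \<Longrightarrow> (\<Sum>k<n. (cmod (entry A j k))\<^sup>2) \<le> (row_norm A j)\<^sup>2"
  unfolding row_norm_sq by (intro sum_le_suminf summable_row) auto

lemma sum_col_le: "hs_bound A t \<Longrightarrow> (\<Sum>j<n. (cmod (entry A j k))\<^sup>2) \<le> (col_norm A k)\<^sup>2"
  unfolding col_norm_sq by (intro sum_le_suminf summable_col) auto

lemma sum_row_norm_le:
  assumes "hs_bound A t"
  shows "(\<Sum>j<m. (row_norm A j)\<^sup>2) \<le> t"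
proof (rule LIMSEQ_le_const2)
  show "(\<lambda>n. \<Sum>j<m. \<Sum>k<n. (cmod (entry A j k))\<^sup>2) \<longlonglongrightarrow> (\<Sum>j<m. (row_norm A j)\<^sup>2)"
    unfolding row_norm_sq[OF assms]
    by (intro tendsto_intros summable_LIMSEQ summable_row[OF assms])
qed (use hs_boundD[OF assms] in blast)

lemma sum_col_norm_le:
  assumes "hs_bound A t"
  shows "(\<Sum>k<m. (col_norm A k)\<^sup>2) \<le> t"
proof (rule LIMSEQ_le_const2)
  show "(\<lambda>n. \<Sum>k<m. \<Sum>j<n. (cmod (entry A j k))\<^sup>2) \<longlonglongrightarrow> (\<Sum>k<m. (col_norm A k)\<^sup>2)"
    unfolding col_norm_sq[OF assms]
    by (intro tendsto_intros summable_LIMSEQ summable_col[OF assms])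
  have "(\<Sum>k<m. \<Sum>j<n. (cmod (entry A j k))\<^sup>2) \<le> t" for n
    using hs_boundD[OF assms, where m = n and n = m] by (subst sum.swap) simp
  then show "\<exists>N. \<forall>n\<ge>N. (\<Sum>k<m. \<Sum>j<n. (cmod (entry A j k))\<^sup>2) \<le> t" by blast
qed

text \<open>The columns of \<open>B * U\<close> are the images under \<open>B\<close> of the columns
  of \<open>U\<close>.\<close>

lemma hs_mult_left:
  assumes "hs_bound U t"
  shows "hs_bound (B * U) ((norm B)\<^sup>2 * t)"
  unfolding hs_bound_def
proof (intro allI)
  fix m n
  have "(\<Sum>j<m. (cmod (entry (B * U) j k))\<^sup>2) \<le> (norm B)\<^sup>2 * (col_norm U k)\<^sup>2" for k
  proof -
    let ?x = "op_apply U (basis_ell2 k)"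
    have "(\<Sum>j<m. (cmod (entry (B * U) j k))\<^sup>2) \<le> (norm (op_apply B ?x))\<^sup>2"
      using sum_coord_le[of "op_apply B ?x" m] by (simp add: entry_def op_apply_simps)
    also have "\<dots> \<le> (norm B * norm ?x)\<^sup>2" by (intro power_mono norm_op_apply) simp
    also have "(norm ?x)\<^sup>2 = (col_norm U k)\<^sup>2"
      unfolding norm_ell2_power2 col_norm_sq[OF assms] by (simp add: entry_def)
    then have "(norm B * norm ?x)\<^sup>2 = (norm B)\<^sup>2 * (col_norm U k)\<^sup>2" by (simp add: power_mult_distrib)
    finally show ?thesis .
  qed
  then have "(\<Sum>k<n. \<Sum>j<m. (cmod (entry (B * U) j k))\<^sup>2) \<le> (\<Sum>k<n. (norm B)\<^sup>2 * (col_norm U k)\<^sup>2)"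
    by (rule sum_mono)
  also have "\<dots> = (norm B)\<^sup>2 * (\<Sum>k<n. (col_norm U k)\<^sup>2)" by (simp add: sum_distrib_left)
  also have "\<dots> \<le> (norm B)\<^sup>2 * t" by (intro mult_left_mono sum_col_norm_le assms) simp
  finally show "(\<Sum>j<m. \<Sum>k<n. (cmod (entry (B * U) j k))\<^sup>2) \<le> (norm B)\<^sup>2 * t"
    by (subst sum.swap)
qed

text \<open>In place of an adjoint, each row of \<open>U * B\<close> is tested on its own truncated
  conjugate \<open>y\<close>; Cauchy-Schwarz then involves only the row of \<open>U\<close> and the
  vector \<open>B y\<close>.\<close>

lemma hs_mult_right:
  assumes "hs_bound U t"
  shows "hs_bound (U * B) ((norm B)\<^sup>2 * t)"
  unfolding hs_bound_def
proof (intro allI)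
  fix m n
  have "(\<Sum>k<n. (cmod (entry (U * B) j k))\<^sup>2) \<le> (row_norm U j)\<^sup>2 * (norm B)\<^sup>2" for j
  proof (rule le_of_le_mult_sqrt)
    let ?w = "\<lambda>k. entry (U * B) j k"
    let ?s = "\<Sum>k<n. (cmod (?w k))\<^sup>2"
    define y where "y = fin_vec n (\<lambda>k. cnj (?w k))"
    have ny: "(norm y)\<^sup>2 = ?s" unfolding y_def norm_fin_vec by simp
    have "coord (op_apply (U * B) y) j = (\<Sum>k<n. ?w k * cnj (?w k))"
      unfolding y_def fin_vec_def by (simp add: op_apply_sum op_apply_simps entry_def mult.commute)
    also have "\<dots> = complex_of_real ?s" by (simp add: complex_norm_square[symmetric] del: of_real_power)
    finally have 1: "?s\<^sup>2 = (cmod (coord (op_apply U (op_apply B y)) j))\<^sup>2"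
      by (simp only: op_apply_simps norm_of_real power2_abs)
    also have "\<dots> \<le> (row_norm U j)\<^sup>2 * (norm (op_apply B y))\<^sup>2"
      by (rule Cauchy_Schwarz_sums[OF sums_op_apply sum_row_le[OF assms] sum_coord_le])
    also have "\<dots> \<le> (row_norm U j)\<^sup>2 * (norm B * norm y)\<^sup>2"
      by (intro mult_left_mono power_mono norm_op_apply) auto
    finally show "?s\<^sup>2 \<le> (row_norm U j)\<^sup>2 * (norm B)\<^sup>2 * ?s" by (simp add: power_mult_distrib ny mult.assoc)
  qed (auto intro: sum_nonneg)
  then have "(\<Sum>j<m. \<Sum>k<n. (cmod (entry (U * B) j k))\<^sup>2) \<le> (\<Sum>j<m. (row_norm U j)\<^sup>2 * (norm B)\<^sup>2)"
    by (rule sum_mono)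
  also have "\<dots> = (norm B)\<^sup>2 * (\<Sum>j<m. (row_norm U j)\<^sup>2)" by (simp add: sum_distrib_left mult.commute)
  also have "\<dots> \<le> (norm B)\<^sup>2 * t" by (intro mult_left_mono sum_row_norm_le assms) simp
  finally show "(\<Sum>j<m. \<Sum>k<n. (cmod (entry (U * B) j k))\<^sup>2) \<le> (norm B)\<^sup>2 * t" .
qed

lemma hs_op_exists:
  assumes m: "\<And>J n. (\<Sum>j<J. \<Sum>k<n. (cmod (m j k))\<^sup>2) \<le> t"
  obtains A where "\<And>j k. entry A j k = m j k" "hs_bound A t"
proof -
  have t: "0 \<le> t" using m[of 0 0] by simp
  have "(\<Sum>j<J. (cmod (\<Sum>k<n. m j k * f k))\<^sup>2) \<le> (sqrt t)\<^sup>2 * (\<Sum>k<n. (cmod (f k))\<^sup>2)" for J n f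
  proof -
    have "(cmod (\<Sum>k<n. m j k * f k))\<^sup>2 \<le> (\<Sum>k<n. (cmod (m j k))\<^sup>2) * (\<Sum>k<n. (cmod (f k))\<^sup>2)" for j
    proof -
      have "cmod (\<Sum>k<n. m j k * f k) \<le> (\<Sum>k<n. cmod (m j k) * cmod (f k))"
        by (rule order.trans[OF norm_sum]) (simp add: norm_mult)
      then have "(cmod (\<Sum>k<n. m j k * f k))\<^sup>2 \<le> (\<Sum>k<n. cmod (m j k) * cmod (f k))\<^sup>2"
        by (rule power_mono) simp
      also have "\<dots> \<le> (\<Sum>k<n. (cmod (m j k))\<^sup>2) * (\<Sum>k<n. (cmod (f k))\<^sup>2)"
        by (rule Cauchy_Schwarz_ineq_sum)
      finally show ?thesis .
    qed
    then have "(\<Sum>j<J. (cmod (\<Sum>k<n. m j k * f k))\<^sup>2)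
      \<le> (\<Sum>j<J. \<Sum>k<n. (cmod (m j k))\<^sup>2) * (\<Sum>k<n. (cmod (f k))\<^sup>2)"
      unfolding sum_distrib_right by (rule sum_mono)
    also have "\<dots> \<le> t * (\<Sum>k<n. (cmod (f k))\<^sup>2)" by (intro mult_right_mono m sum_nonneg) simp
    finally show ?thesis using t by simp
  qed
  then obtain A where "\<And>j k. entry A j k = m j k"
    using op_of_bounded_matrix[of m "sqrt t"] t by (metis real_sqrt_ge_zero)
  then show ?thesis using that[of A] m by (simp add: hs_bound_def)
qed

section \<open>Singular values and the ideal of trace class operators\<close>

lemma rank_le_mono:
  assumes "rank_le m F" "m \<le> n"
  shows "rank_le n F"
proof -
  obtain v where v: "\<And>x. \<exists>c. op_apply F x = (\<Sum>i<m. c i *\<^sub>C v i)"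
    using assms(1) unfolding rank_le_def by blast
  have "\<exists>c. op_apply F x = (\<Sum>i<n. c i *\<^sub>C v i)" for x
  proof -
    obtain c where c: "op_apply F x = (\<Sum>i<m. c i *\<^sub>C v i)" using v by blast
    have "(\<Sum>i<n. (if i < m then c i else 0) *\<^sub>C v i) = (\<Sum>i<m. c i *\<^sub>C v i)"
      using assms(2) by (intro sum.mono_neutral_cong_right) (auto intro: ell2_eqI)
    then show ?thesis using c by metis
  qed
  then show ?thesis unfolding rank_le_def by blast
qed

lemma rank_le_add:
  assumes "rank_le m F" "rank_le n G"
  shows "rank_le (m + n) (F + G)"
proof -
  obtain v where v: "\<And>x. \<exists>c. op_apply F x = (\<Sum>i<m. c i *\<^sub>C v i)"
    using assms(1) unfolding rank_le_def by blast
  obtain w where w: "\<And>x. \<exists>c. op_apply G x = (\<Sum>i<n. c i *\<^sub>C w i)"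
    using assms(2) unfolding rank_le_def by blast
  define u where "u i = (if i < m then v i else w (i - m))" for i
  have "\<exists>c. op_apply (F + G) x = (\<Sum>i<m + n. c i *\<^sub>C u i)" for x
  proof -
    obtain c where c: "op_apply F x = (\<Sum>i<m. c i *\<^sub>C v i)" using v by blast
    obtain d where d: "op_apply G x = (\<Sum>i<n. d i *\<^sub>C w i)" using w by blast
    have "(\<Sum>i<m + n. (if i < m then c i else d (i - m)) *\<^sub>C u i)
      = (\<Sum>i<m. c i *\<^sub>C v i) + (\<Sum>i<n. d i *\<^sub>C w i)"
    proof -
      have "(\<Sum>i<m + n. (if i < m then c i else d (i - m)) *\<^sub>C u i)
        = (\<Sum>i<m. c i *\<^sub>C v i) + (\<Sum>i\<in>{m..<m + n}. d (i - m) *\<^sub>C w (i - m))"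
        by (simp add: lessThan_atLeast0 sum.atLeastLessThan_concat[of 0 m "m + n", symmetric] u_def)
      also have "(\<Sum>i\<in>{m..<m + n}. d (i - m) *\<^sub>C w (i - m)) = (\<Sum>i<n. d i *\<^sub>C w i)"
        by (rule sum.reindex_bij_witness[where i = "\<lambda>i. i + m" and j = "\<lambda>i. i - m"]) auto
      finally show ?thesis .
    qed
    then show ?thesis using c d by (metis op_apply_simps(1))
  qed
  then show ?thesis unfolding rank_le_def by blast
qed

lemma rank_le_mult_right: "rank_le n F \<Longrightarrow> rank_le n (F * B)"
  unfolding rank_le_def op_apply_simps by blast

lemma rank_le_mult_left:
  assumes "rank_le n F"
  shows "rank_le n (B * F)"
proof -
  obtain v where v: "\<And>x. \<exists>c. op_apply F x = (\<Sum>i<n. c i *\<^sub>C v i)"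
    using assms(1) unfolding rank_le_def by blast
  have "\<exists>c. op_apply (B * F) x = (\<Sum>i<n. c i *\<^sub>C op_apply B (v i))" for x
    using v[of x] by (auto simp: op_apply_simps op_apply_sum)
  then show ?thesis unfolding rank_le_def by (intro exI[of _ "\<lambda>i. op_apply B (v i)"]) simp
qed

lemma rank_le_scaleC:
  assumes "rank_le n F"
  shows "rank_le n (z *\<^sub>C F)"
proof -
  have "z *\<^sub>C F = (z *\<^sub>C 1) * F" by (simp add: op_algebra_scaleC)
  then show ?thesis using rank_le_mult_left[OF assms] by simp
qed

lemma rank_le_0: "rank_le n 0"
proof -
  have "\<exists>c. op_apply 0 x = (\<Sum>i<n. c i *\<^sub>C (0 :: ell2))" for x
    by (simp add: op_apply_simps scaleC_simps)
  then show ?thesis unfolding rank_le_def by (intro exI[of _ "\<lambda>i. 0"]) simp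
qed

lemma rank_le_0D: "rank_le 0 F \<Longrightarrow> F = 0"
  unfolding rank_le_def by (auto intro!: op_eqI_apply simp: op_apply_simps)

section \<open>Approximation numbers\<close>

lemma bdd_below_sv: "bdd_below {norm (A - F) |F. rank_le n F}"
  by (rule bdd_belowI[of _ 0]) auto

lemma singular_value_le: "rank_le n F \<Longrightarrow> singular_value n A \<le> norm (A - F)"
  unfolding singular_value_def by (rule cInf_lower[OF _ bdd_below_sv]) auto

lemma singular_value_ge: "(\<And>F. rank_le n F \<Longrightarrow> c \<le> norm (A - F)) \<Longrightarrow> c \<le> singular_value n A"
  unfolding singular_value_def using rank_le_0 by (intro cInf_greatest) auto

lemma singular_value_nonneg: "0 \<le> singular_value n A"
  by (rule singular_value_ge) simp

lemma singular_value_0: "singular_value 0 A = norm A"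
proof (rule antisym)
  show "singular_value 0 A \<le> norm A" using singular_value_le[OF rank_le_0, of 0 A] by simp
  show "norm A \<le> singular_value 0 A" by (rule singular_value_ge) (auto dest: rank_le_0D)
qed

lemma singular_value_antimono: "m \<le> n \<Longrightarrow> singular_value n A \<le> singular_value m A"
  by (rule singular_value_ge) (blast intro: singular_value_le rank_le_mono)

lemma singular_value_approx:
  assumes "0 < e"
  obtains F where "rank_le n F" "norm (A - F) < singular_value n A + e"
proof -
  have "\<exists>x\<in>{norm (A - F) |F. rank_le n F}. x < singular_value n A + e"
    unfolding singular_value_def using rank_le_0 assms bdd_below_sv[of A n]
    by (subst cInf_less_iff[symmetric]) auto
  then show ?thesis using that by auto
qed

lemma singular_value_mult_left: "singular_value n (B * A) \<le> norm B * singular_value n A"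
proof (rule field_le_epsilon)
  fix e :: real assume e: "0 < e"
  \<comment> \<open>The shift by 1 in the denominator covers the case
    \<open>norm B = 0\<close>.\<close>
  define d where "d = e / (norm B + 1)"
  have nb: "0 < norm B + 1" by (rule add_nonneg_pos) auto
  have d: "0 < d" "norm B * d \<le> e" using e nb by (auto simp: d_def field_simps)
  obtain F where F: "rank_le n F" "norm (A - F) < singular_value n A + d"
    using singular_value_approx[OF d(1)] .
  have "singular_value n (B * A) \<le> norm (B * A - B * F)"
    by (rule singular_value_le[OF rank_le_mult_left[OF F(1)]])
  also have "\<dots> \<le> norm B * norm (A - F)" by (metis norm_mult_ineq right_diff_distrib)
  also have "\<dots> \<le> norm B * (singular_value n A + d)" using F by (intro mult_left_mono) auto
  also have "\<dots> \<le> norm B * singular_value n A + e" using d by (simp add: distrib_left)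
  finally show "singular_value n (B * A) \<le> norm B * singular_value n A + e" .
qed

lemma singular_value_mult_right: "singular_value n (A * B) \<le> norm B * singular_value n A"
proof (rule field_le_epsilon)
  fix e :: real assume e: "0 < e"
  define d where "d = e / (norm B + 1)"
  have nb: "0 < norm B + 1" by (rule add_nonneg_pos) auto
  have d: "0 < d" "norm B * d \<le> e" using e nb by (auto simp: d_def field_simps)
  obtain F where F: "rank_le n F" "norm (A - F) < singular_value n A + d"
    using singular_value_approx[OF d(1)] .
  have "singular_value n (A * B) \<le> norm (A * B - F * B)"
    by (rule singular_value_le[OF rank_le_mult_right[OF F(1)]])
  also have "\<dots> \<le> norm (A - F) * norm B" by (metis norm_mult_ineq left_diff_distrib)
  also have "\<dots> \<le> (singular_value n A + d) * norm B" using F by (intro mult_right_mono) auto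
  also have "\<dots> \<le> norm B * singular_value n A + e" using d by (simp add: distrib_left mult.commute)
  finally show "singular_value n (A * B) \<le> norm B * singular_value n A + e" .
qed

lemma singular_value_add: "singular_value (m + n) (A + B) \<le> singular_value m A + singular_value n B"
proof (rule field_le_epsilon)
  fix e :: real assume "0 < e"
  then have e: "0 < e / 2" by simp
  obtain F where F: "rank_le m F" "norm (A - F) < singular_value m A + e / 2"
    using singular_value_approx[OF e] .
  obtain G where G: "rank_le n G" "norm (B - G) < singular_value n B + e / 2"
    using singular_value_approx[OF e] .
  have "singular_value (m + n) (A + B) \<le> norm (A + B - (F + G))"
    by (rule singular_value_le[OF rank_le_add[OF F(1) G(1)]])
  also have "\<dots> = norm ((A - F) + (B - G))" by (simp add: algebra_simps)
  also have "\<dots> \<le> norm (A - F) + norm (B - G)" by (rule norm_triangle_ineq)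
  also have "\<dots> \<le> singular_value m A + singular_value n B + e" using F G by simp
  finally show "singular_value (m + n) (A + B) \<le> singular_value m A + singular_value n B + e" .
qed

lemma singular_value_zero: "singular_value n 0 = 0"
  using singular_value_le[OF rank_le_0, of n 0] singular_value_nonneg[of n 0] by simp

section \<open>The trace class as an ideal\<close>

lemma trace_class_zero [simp]: "trace_class 0" "trace_norm 0 = 0"
  by (simp_all add: trace_class_def trace_norm_def singular_value_zero)

lemma trace_norm_nonneg: "trace_class A \<Longrightarrow> 0 \<le> trace_norm A"
  unfolding trace_class_def trace_norm_def by (rule suminf_nonneg) (auto simp: singular_value_nonneg)

lemma sum_singular_value_le:
  assumes "trace_class A"
  shows "finite I \<Longrightarrow> (\<Sum>n\<in>I. singular_value n A) \<le> trace_norm A"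
  using assms unfolding trace_class_def trace_norm_def
  by (rule sum_le_suminf) (auto simp: singular_value_nonneg)

lemma singular_value_le_trace_norm: "trace_class A \<Longrightarrow> singular_value n A \<le> trace_norm A"
  using sum_singular_value_le[of A "{n}"] by simp

lemma trace_class_comparison:
  assumes "summable f" "\<And>n. singular_value n A \<le> f n"
  shows "trace_class A" "trace_norm A \<le> suminf f"
proof -
  show 1: "trace_class A"
    unfolding trace_class_def
    by (rule summable_comparison_test'[OF assms(1)]) (simp add: singular_value_nonneg assms)
  show "trace_norm A \<le> suminf f"
    using 1 unfolding trace_class_def trace_norm_def by (intro suminf_le assms)
qed

lemma trace_class_mult_left:
  assumes "trace_class A"
  shows "trace_class (B * A)" "trace_norm (B * A) \<le> norm B * trace_norm A"
  using assms trace_class_comparison[OF summable_mult singular_value_mult_left, of A B]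
  by (simp_all add: trace_class_def trace_norm_def suminf_mult)

lemma trace_class_mult_right:
  assumes "trace_class A"
  shows "trace_class (A * B)" "trace_norm (A * B) \<le> norm B * trace_norm A"
  using assms trace_class_comparison[OF summable_mult singular_value_mult_right, of A B]
  by (simp_all add: trace_class_def trace_norm_def suminf_mult)

lemma trace_class_scaleC:
  assumes "trace_class A"
  shows "trace_class (z *\<^sub>C A)" "trace_norm (z *\<^sub>C A) \<le> cmod z * trace_norm A"
proof -
  have e: "z *\<^sub>C A = (z *\<^sub>C 1) * A" by (simp add: op_algebra_scaleC)
  show "trace_class (z *\<^sub>C A)" unfolding e by (rule trace_class_mult_left[OF assms])
  have "trace_norm (z *\<^sub>C A) \<le> norm (z *\<^sub>C (1 :: ell2_op)) * trace_norm A"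
    unfolding e by (rule trace_class_mult_left[OF assms])
  also have "\<dots> \<le> cmod z * trace_norm A"
    using norm_scaleC_op[of z 1] by (intro mult_right_mono trace_norm_nonneg assms) simp
  finally show "trace_norm (z *\<^sub>C A) \<le> cmod z * trace_norm A" .
qed

lemma trace_class_uminus:
  assumes "trace_class A"
  shows "trace_class (- A)" "trace_norm (- A) \<le> trace_norm A"
  using trace_class_scaleC[OF assms, of "-1"] by (simp_all add: op_algebra_scaleC)

text \<open>The factor 2 in the triangle inequality is lost because the singular values are added in
  pairs; since the trace norm only serves to control error terms, it does no harm.\<close>

lemma trace_class_add:
  assumes "trace_class A" "trace_class B"
  shows "trace_class (A + B)" "trace_norm (A + B) \<le> 2 * (trace_norm A + trace_norm B)"
proof -
  define f where "f n = singular_value n A + singular_value n B" for n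
  have sf: "summable f" "suminf f = trace_norm A + trace_norm B"
    using assms unfolding f_def trace_class_def trace_norm_def by (simp_all add: summable_add suminf_add)
  have f0: "0 \<le> f n" for n by (simp add: f_def singular_value_nonneg)
  \<comment> \<open>Halving the index loses at most one for odd \<open>n\<close>, which monotonicity
    of the singular values absorbs.\<close>
  have le: "singular_value n (A + B) \<le> f (n div 2)" for n
  proof -
    have "singular_value n (A + B) \<le> singular_value (n div 2 + n div 2) (A + B)"
      by (rule singular_value_antimono) simp
    then show ?thesis using singular_value_add[of "n div 2" "n div 2" A B] by (simp add: f_def)
  qed
  have partial: "(\<Sum>n<N. f (n div 2)) \<le> 2 * suminf f" for N
  proof -
    have "(\<Sum>n<N. f (n div 2)) \<le> (\<Sum>n<2 * N. f (n div 2))"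
      by (intro sum_mono2) (auto simp: f0)
    also have "\<dots> = 2 * (\<Sum>n<N. f n)"
      by (induction N) (simp_all add: algebra_simps)
    also have "\<dots> \<le> 2 * suminf f" using sum_le_suminf[OF sf(1), of "{..<N}"] f0 by simp
    finally show ?thesis .
  qed
  have sd: "summable (\<lambda>n. f (n div 2))"
    by (rule summableI_nonneg_bounded[OF _ partial]) (simp add: f0)
  show "trace_class (A + B)" by (rule trace_class_comparison[OF sd le])
  have "trace_norm (A + B) \<le> (\<Sum>n. f (n div 2))" by (rule trace_class_comparison[OF sd le])
  also have "\<dots> \<le> 2 * suminf f" by (rule suminf_le_const[OF sd partial])
  finally show "trace_norm (A + B) \<le> 2 * (trace_norm A + trace_norm B)" by (simp add: sf)
qed

lemma trace_class_diff:
  assumes "trace_class A" "trace_class B"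
  shows "trace_class (A - B)" "trace_norm (A - B) \<le> 2 * (trace_norm A + trace_norm B)"
  using trace_class_add[OF assms(1) trace_class_uminus(1)[OF assms(2)]] trace_class_uminus(2)[OF assms(2)]
  by simp_all

text \<open>Cauchy condensation: the dyadic block from 2^M + 1 to 2^(M+1) has 2^M members, each at
  least as large as the last. It prepares the approximation by operators of rank 2^n.\<close>

lemma condensed_singular_values:
  assumes "trace_class A"
  shows "(\<Sum>m\<le>M. 2 ^ m * singular_value (2 ^ m) A) \<le> 2 * trace_norm A"
proof -
  let ?s = "\<lambda>k. singular_value k A"
  have "(\<Sum>m\<le>M. 2 ^ m * ?s (2 ^ m)) \<le> 2 * (\<Sum>k\<in>{1..2 ^ M}. ?s k)"
  proof (induction M)
    case 0
    show ?case using singular_value_nonneg[of 1 A] by simp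
  next
    case (Suc M)
    have "(\<Sum>k\<in>{1..2 ^ Suc M}. ?s k) = (\<Sum>k\<in>{1..2 ^ M}. ?s k) + (\<Sum>k\<in>{2 ^ M + 1..2 ^ Suc M}. ?s k)"
      by (subst sum.union_disjoint[symmetric]) (auto intro!: sum.cong)
    moreover have "(\<Sum>k::nat\<in>{2 ^ M + 1..2 ^ Suc M}. ?s (2 ^ Suc M)) \<le> (\<Sum>k\<in>{2 ^ M + 1..2 ^ Suc M}. ?s k)"
      by (intro sum_mono singular_value_antimono) auto
    ultimately show ?case using Suc.IH by simp
  qed
  also have "\<dots> \<le> 2 * trace_norm A" using sum_singular_value_le[OF assms] by simp
  finally show ?thesis .
qed

section \<open>Factorization of trace class operators\<close>

text \<open>The real Gram-Schmidt process yields an orthonormal system spanning the range of \<open>D\<close> over the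
  reals; averaging the coefficient functionals over multiplication by \<open>\<i>\<close> makes them
  complex linear.\<close>

lemma finite_rank_decomposition:
  assumes "rank_le r D"
  obtains x y :: "nat \<Rightarrow> nat \<Rightarrow> complex"
  where "\<And>i n. (\<Sum>j<n. (cmod (x i j))\<^sup>2) \<le> norm D" "\<And>i n. (\<Sum>k<n. (cmod (y i k))\<^sup>2) \<le> norm D"
    "\<And>j k. entry D j k = (\<Sum>i<2 * r. x i j * y i k)" "\<And>i j. 2 * r \<le> i \<Longrightarrow> x i j = 0"
proof -
  obtain v where v: "\<And>x. \<exists>c. op_apply D x = (\<Sum>i<r. c i *\<^sub>C v i)"
    using assms unfolding rank_le_def by blast
  \<comment> \<open>\<open>span\<close> is taken over the reals, so both \<open>v i\<close> and its
    multiple by the imaginary unit are included. This is the origin of the 2 in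
    \<open>2 * r\<close>.\<close>
  define B where "B = v ` {..<r} \<union> (\<lambda>i. \<i> *\<^sub>C v i) ` {..<r}"
  have finB: "finite B" by (simp add: B_def)
  have "card B \<le> card (v ` {..<r}) + card ((\<lambda>i. \<i> *\<^sub>C v i) ` {..<r})" unfolding B_def by (rule card_Un_le)
  also have "\<dots> \<le> r + r" by (intro add_mono) (use card_image_le[of "{..<r}" v] card_image_le[of "{..<r}" "\<lambda>i. \<i> *\<^sub>C v i"] in auto)
  finally have cardB: "card B \<le> 2 * r" by simp
  have range: "op_apply D x \<in> span B" for x
  proof -
    obtain c where c: "op_apply D x = (\<Sum>i<r. c i *\<^sub>C v i)" using v by blast
    have "c i *\<^sub>C v i \<in> span B" if "i < r" for i
    proof -
      have "c i *\<^sub>C v i = Re (c i) *\<^sub>R v i + Im (c i) *\<^sub>R (\<i> *\<^sub>C v i)"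
        by (rule ell2_eqI) (auto simp: complex_eq_iff)
      moreover have "v i \<in> B" "\<i> *\<^sub>C v i \<in> B" using that by (auto simp: B_def)
      ultimately show ?thesis by (simp add: span_add span_scale span_base)
    qed
    then show ?thesis unfolding c by (intro span_sum) auto
  qed
  obtain C where C: "finite C" "card C \<le> card B" "span C = span B" "pairwise Linear_Algebra.orthogonal C"
    using basis_orthogonal[OF finB] by blast
  have expand: "z = (\<Sum>e\<in>C. inner z (sgn e) *\<^sub>R sgn e)" if "z \<in> span B" for z
  proof -
    have "z \<in> (\<lambda>u. \<Sum>b\<in>C. u b *\<^sub>R b) ` UNIV"
      using that C(3) span_finite[OF C(1)] by simp
    then obtain u where u: "z = (\<Sum>b\<in>C. u b *\<^sub>R b)" by (elim imageE)
    have "inner z (sgn e) *\<^sub>R sgn e = u e *\<^sub>R e" if e: "e \<in> C" for e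
    proof -
      have "inner z e = (\<Sum>b\<in>C. u b * inner b e)" unfolding u by (simp add: inner_sum_left)
      also have "\<dots> = (\<Sum>b\<in>C. if b = e then u e * inner e e else 0)"
        using C(4) e by (intro sum.cong) (auto simp: pairwise_def Linear_Algebra.orthogonal_def)
      also have "\<dots> = u e * (norm e)\<^sup>2" using C(1) e by (simp add: power2_norm_eq_inner)
      finally have ze: "inner z e = u e * (norm e)\<^sup>2" .
      show ?thesis by (cases "e = 0") (auto simp: sgn_div_norm ze power2_eq_square)
    qed
    then show ?thesis unfolding u by simp
  qed
  have nsgn: "norm (sgn e) \<le> 1" for e :: ell2 by (simp add: norm_sgn)
  define \<psi> where "\<psi> e x = (1/2) * (complex_of_real (inner (op_apply D x) (sgn e))
    - \<i> * complex_of_real (inner (op_apply D (\<i> *\<^sub>C x)) (sgn e)))" for e x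
  \<comment> \<open>Complex linearity gives - i D (i x) = D x, so the average of the two real
    expansions is again D x.\<close>
  have Dx: "op_apply D x = (\<Sum>e\<in>C. \<psi> e x *\<^sub>C sgn e)" for x
  proof -
    have "(\<Sum>e\<in>C. \<psi> e x *\<^sub>C sgn e)
      = (1/2) *\<^sub>C (\<Sum>e\<in>C. inner (op_apply D x) (sgn e) *\<^sub>R sgn e)
        - (\<i>/2) *\<^sub>C (\<Sum>e\<in>C. inner (op_apply D (\<i> *\<^sub>C x)) (sgn e) *\<^sub>R sgn e)"
      by (rule ell2_eqI)
        (simp add: sum_distrib_left \<psi>_def sum_subtractf[symmetric] algebra_simps)
    also have "\<dots> = (1/2) *\<^sub>C op_apply D x - (\<i>/2) *\<^sub>C op_apply D (\<i> *\<^sub>C x)"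
      using expand[OF range] by simp
    also have "\<dots> = op_apply D x"
      by (rule ell2_eqI) (simp add: op_apply_simps)
    finally show ?thesis ..
  qed
  have psi_add: "\<psi> e (x + y) = \<psi> e x + \<psi> e y" for e x y
    by (simp add: \<psi>_def op_apply_simps scaleC_simps inner_add_left algebra_simps)
  have psi_scale: "\<psi> e (c *\<^sub>C x) = c * \<psi> e x" for e c x
  proof -
    have e1: "c *\<^sub>C x = Re c *\<^sub>R x + Im c *\<^sub>R (\<i> *\<^sub>C x)"
      by (rule ell2_eqI) (auto simp: complex_eq_iff)
    have e2: "\<i> *\<^sub>C (c *\<^sub>C x) = Re c *\<^sub>R (\<i> *\<^sub>C x) - Im c *\<^sub>R x"
      by (rule ell2_eqI) (auto simp: complex_eq_iff)
    show ?thesis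
      unfolding \<psi>_def e2 unfolding e1 op_apply_simps(7,8,9,10) inner_add_left inner_diff_left inner_scaleR_left
      by (auto simp: complex_eq_iff algebra_simps)
  qed
  have psi_0: "\<psi> e 0 = 0" for e by (simp add: \<psi>_def op_apply_simps scaleC_simps)
  have psi_sum: "\<psi> e (\<Sum>i\<in>I. f i) = (\<Sum>i\<in>I. \<psi> e (f i))" for e I and f :: "nat \<Rightarrow> ell2"
    by (induction I rule: infinite_finite_induct) (simp_all add: psi_add psi_0)
  have psi_bound: "cmod (\<psi> e x) \<le> norm D * norm x" for e x
  proof -
    have 1: "\<bar>inner (op_apply D y) (sgn e)\<bar> \<le> norm D * norm y" for y
    proof -
      have "\<bar>inner (op_apply D y) (sgn e)\<bar> \<le> norm (op_apply D y) * norm (sgn e)" by (rule Cauchy_Schwarz_ineq2)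
      also have "\<dots> \<le> norm (op_apply D y) * 1" by (intro mult_left_mono nsgn) simp
      also have "\<dots> \<le> norm D * norm y" using norm_op_apply by simp
      finally show ?thesis .
    qed
    have "cmod (\<psi> e x) \<le> (1/2) * (cmod (complex_of_real (inner (op_apply D x) (sgn e)))
      + cmod (\<i> * complex_of_real (inner (op_apply D (\<i> *\<^sub>C x)) (sgn e))))"
      unfolding \<psi>_def norm_mult by (intro mult_mono norm_triangle_ineq4[THEN order.trans]) (auto simp: norm_mult)
    also have "\<dots> \<le> (1/2) * (norm D * norm x + norm D * norm x)"
      using 1[of x] 1[of "\<i> *\<^sub>C x"] by (intro mult_left_mono add_mono) (auto simp: norm_mult norm_scaleC)
    finally show ?thesis by (simp add: mult.commute)
  qed
  \<comment> \<open>The functional is tested on the finite vector of its own conjugate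
    coefficients.\<close>
  have psi_sq: "(\<Sum>k<n. (cmod (\<psi> e (basis_ell2 k)))\<^sup>2) \<le> (norm D)\<^sup>2" for e n
  proof (rule le_of_le_mult_sqrt)
    let ?w = "\<lambda>k. \<psi> e (basis_ell2 k)"
    let ?s = "\<Sum>k<n. (cmod (?w k))\<^sup>2"
    define y where "y = fin_vec n (\<lambda>k. cnj (?w k))"
    have ny: "(norm y)\<^sup>2 = ?s" unfolding y_def norm_fin_vec by simp
    have "\<psi> e y = (\<Sum>k<n. ?w k * cnj (?w k))"
      unfolding y_def fin_vec_def psi_sum psi_scale by (simp add: mult.commute)
    also have "\<dots> = complex_of_real ?s" by (simp add: complex_norm_square[symmetric] del: of_real_power)
    finally have "?s\<^sup>2 = (cmod (\<psi> e y))\<^sup>2" by (simp only: norm_of_real power2_abs)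
    also have "\<dots> \<le> (norm D * norm y)\<^sup>2" by (intro power_mono psi_bound) simp
    finally show "?s\<^sup>2 \<le> (norm D)\<^sup>2 * ?s" by (simp add: power_mult_distrib ny)
  qed (auto intro: sum_nonneg)
  obtain h where h: "bij_betw h {..<card C} C"
    using ex_bij_betw_nat_finite[OF C(1)] by (auto simp: atLeast0LessThan)
  \<comment> \<open>The norm is split evenly: \<open>x\<close> receives a unit vector times the
    square root of \<open>norm D\<close>, \<open>y\<close> the functional divided by it. For D = 0
    the division by zero gives 0, which is the correct value.\<close>
  define d where "d = sqrt (norm D)"
  have dd: "d * d = norm D" by (simp add: d_def)
  define x where "x i j = (if i < card C then of_real d * coord (sgn (h i)) j else 0)" for i j
  define y where "y i k = (if i < card C then \<psi> (h i) (basis_ell2 k) / of_real d else 0)" for i k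
  show ?thesis
  proof (rule that)
    show "(\<Sum>j<n. (cmod (x i j))\<^sup>2) \<le> norm D" for i n
    proof (cases "i < card C")
      case True
      have "(\<Sum>j<n. (cmod (x i j))\<^sup>2) = norm D * (\<Sum>j<n. (cmod (coord (sgn (h i)) j))\<^sup>2)"
        using True by (simp add: x_def norm_mult power_mult_distrib sum_distrib_left power2_eq_square[of d] dd)
      also have "\<dots> \<le> norm D * (norm (sgn (h i)))\<^sup>2" by (intro mult_left_mono sum_coord_le) simp
      also have "\<dots> \<le> norm D * 1\<^sup>2" by (intro mult_left_mono power_mono nsgn) auto
      finally show ?thesis by simp
    qed (simp add: x_def)
    show "(\<Sum>k<n. (cmod (y i k))\<^sup>2) \<le> norm D" for i n
    proof (cases "i < card C")
      case True
      have "(\<Sum>k<n. (cmod (y i k))\<^sup>2) = (\<Sum>k<n. (cmod (\<psi> (h i) (basis_ell2 k)))\<^sup>2) / norm D"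
        using True by (simp add: y_def norm_divide power_divide sum_divide_distrib power2_eq_square[of d] dd)
      also have "\<dots> \<le> (norm D)\<^sup>2 / norm D" by (intro divide_right_mono psi_sq) simp
      also have "\<dots> = norm D" by (simp add: power2_eq_square)
      finally show ?thesis .
    qed (simp add: y_def)
    show "x i j = 0" if "2 * r \<le> i" for i j
      using that C(2) cardB by (simp add: x_def)
    show "entry D j k = (\<Sum>i<2 * r. x i j * y i k)" for j k
    proof -
      have xy: "x i j * y i k = \<psi> (h i) (basis_ell2 k) * coord (sgn (h i)) j" if i: "i < card C" for i
      proof (cases "d = 0")
        case True
        then have "norm D = 0" using dd by simp
        then have "\<psi> (h i) (basis_ell2 k) = 0" using psi_bound[of "h i" "basis_ell2 k"] by simp
        then show ?thesis using i by (simp add: x_def y_def)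
      qed (use i in \<open>simp add: x_def y_def\<close>)
      have "entry D j k = (\<Sum>e\<in>C. \<psi> e (basis_ell2 k) * coord (sgn e) j)"
        unfolding entry_def Dx by simp
      also have "\<dots> = (\<Sum>i<card C. x i j * y i k)"
        by (subst sum.reindex_bij_betw[OF h, symmetric]) (simp add: xy)
      also have "\<dots> = (\<Sum>i<2 * r. x i j * y i k)"
        using C(2) cardB by (intro sum.mono_neutral_left) (auto simp: x_def)
      finally show ?thesis .
    qed
  qed
qed

definition factors :: "ell2_op \<Rightarrow> real \<Rightarrow> bool"
  where "factors A t \<longleftrightarrow> (\<exists>U V. A = U * V \<and> hs_bound U t \<and> hs_bound V t)"

text \<open>The pairs (n, i) are strung along one index by the pairing function; any initial segment
  of codes meets only finitely many blocks \<open>n\<close>.\<close>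

lemma sum_prod_decode_le:
  fixes f :: "nat \<Rightarrow> nat \<Rightarrow> real"
  assumes f0: "\<And>n i. 0 \<le> f n i" and fin: "\<And>n i. R n \<le> i \<Longrightarrow> f n i = 0"
    and bound: "\<And>N. (\<Sum>n<N. \<Sum>i<R n. f n i) \<le> t"
  shows "(\<Sum>l<L. f (fst (prod_decode l)) (snd (prod_decode l))) \<le> t"
proof -
  have inj: "inj_on prod_decode {..<L}" using bij_prod_decode by (metis bij_betw_imp_inj_on inj_on_subset subset_UNIV)
  define F where "F = prod_decode ` {..<L}"
  have finF: "finite F" by (simp add: F_def)
  obtain N where N: "fst ` F \<subseteq> {..<N}" using finF by (meson finite_imageI finite_nat_iff_bounded)
  have "(\<Sum>l<L. f (fst (prod_decode l)) (snd (prod_decode l))) = (\<Sum>(n, i)\<in>F. f n i)"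
    unfolding F_def sum.reindex[OF inj] by (simp add: case_prod_unfold)
  also have "\<dots> \<le> (\<Sum>(n, i)\<in>F \<union> Sigma {..<N} (\<lambda>n. {..<R n}). f n i)"
    using finF by (intro sum_mono2) (auto simp: f0)
  also have "\<dots> = (\<Sum>(n, i)\<in>Sigma {..<N} (\<lambda>n. {..<R n}). f n i)"
    using finF N by (intro sum.mono_neutral_right) (force simp: fin not_less)+
  also have "\<dots> = (\<Sum>n<N. \<Sum>i<R n. f n i)" by (simp add: sum.Sigma)
  also have "\<dots> \<le> t" by (rule bound)
  finally show ?thesis .
qed

text \<open>The rank-one terms of all \<open>D n\<close>, placed side by side, form the columns of
  \<open>U\<close> and the rows of \<open>V\<close>. Each of the \<open>2 * r n\<close> terms costs
  \<open>norm (D n)\<close> in either factor, whence the sum in the hypothesis.\<close>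

lemma factors_of_finite_rank_series:
  assumes D: "\<And>n. rank_le (r n) (D n)"
    and bound: "\<And>N. (\<Sum>n<N. 2 * real (r n) * norm (D n)) \<le> t"
    and sums: "\<And>j k. (\<lambda>n. entry (D n) j k) sums entry A j k"
  shows "factors A t"
proof -
  define P where "P n x y \<longleftrightarrow> (\<forall>i m. (\<Sum>j<m. (cmod (x i j))\<^sup>2) \<le> norm (D n)) \<and>
    (\<forall>i m. (\<Sum>k<m. (cmod (y i k))\<^sup>2) \<le> norm (D n)) \<and>
    (\<forall>j k. entry (D n) j k = (\<Sum>i<2 * r n. x i j * y i k)) \<and>
    (\<forall>i j. 2 * r n \<le> i \<longrightarrow> x i j = 0)" for n and x y :: "nat \<Rightarrow> nat \<Rightarrow> complex"
  have "\<exists>x y. P n x y" for n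
    by (rule finite_rank_decomposition[OF D[of n]]) (unfold P_def, blast)
  then obtain x where "\<And>n. \<exists>y. P n (x n) y" by metis
  then obtain y where P: "\<And>n. P n (x n) (y n)" by metis
  \<comment> \<open>The decomposition makes only \<open>x\<close> vanish beyond
    \<open>2 * r n\<close>; cutting \<open>y\<close> there as well leaves the products unchanged and
    gives \<open>V\<close> a finite bound.\<close>
  define y' where "y' n i k = (if i < 2 * r n then y n i k else 0)" for n i k
  have x0: "x n i j = 0" if "2 * r n \<le> i" for n i j using P[of n] that unfolding P_def by blast
  have nx: "(\<Sum>j<m. (cmod (x n i j))\<^sup>2) \<le> norm (D n)" for n i m using P[of n] unfolding P_def by blast
  have ny: "(\<Sum>j<m. (cmod (y' n i j))\<^sup>2) \<le> norm (D n)" for n i m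
    using P[of n] unfolding P_def y'_def by (cases "i < 2 * r n") auto
  have e: "entry (D n) j k = (\<Sum>i<2 * r n. x n i j * y' n i k)" for n j k
    using P[of n] unfolding P_def y'_def by simp
  define p q where "p = fst \<circ> prod_decode" and "q = snd \<circ> prod_decode"
  have hs: "(\<Sum>l<L. \<Sum>j<m. (cmod (z (p l) (q l) j))\<^sup>2) \<le> t"
    if z: "\<And>n i m. (\<Sum>j<m. (cmod (z n i j))\<^sup>2) \<le> norm (D n)" and z0: "\<And>n i j. 2 * r n \<le> i \<Longrightarrow> z n i j = 0"
    for z :: "nat \<Rightarrow> nat \<Rightarrow> nat \<Rightarrow> complex" and L m
    unfolding p_def q_def o_def
  proof (rule sum_prod_decode_le[where R = "\<lambda>n. 2 * r n"])
    fix N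
    have "(\<Sum>n<N. \<Sum>i<2 * r n. \<Sum>j<m. (cmod (z n i j))\<^sup>2) \<le> (\<Sum>n<N. \<Sum>i<2 * r n. norm (D n))"
      by (intro sum_mono z)
    also have "\<dots> \<le> t" using bound[of N] by simp
    finally show "(\<Sum>n<N. \<Sum>i<2 * r n. \<Sum>j<m. (cmod (z n i j))\<^sup>2) \<le> t" .
  qed (auto simp: z0 sum_nonneg)
  have hx: "(\<Sum>j<m. \<Sum>l<L. (cmod (x (p l) (q l) j))\<^sup>2) \<le> t" for m L
    by (subst sum.swap) (rule hs[OF nx x0])
  have hy: "(\<Sum>l<L. \<Sum>k<m. (cmod (y' (p l) (q l) k))\<^sup>2) \<le> t" for m L
    by (rule hs[OF ny]) (simp add: y'_def)
  obtain U where U: "\<And>j l. entry U j l = x (p l) (q l) j" "hs_bound U t"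
    using hs_op_exists[of "\<lambda>j l. x (p l) (q l) j", OF hx] by metis
  obtain V where V: "\<And>l k. entry V l k = y' (p l) (q l) k" "hs_bound V t"
    using hs_op_exists[of "\<lambda>l k. y' (p l) (q l) k", OF hy] by metis
  have "entry A j k = entry (U * V) j k" for j k
  proof -
    define g where "g = (\<lambda>(n, i). x n i j * y' n i k)"
    have gl: "g (prod_decode l) = entry U j l * entry V l k" for l
      by (simp add: g_def U V p_def q_def case_prod_unfold)
    have "(\<lambda>l. g (prod_decode l)) sums entry (U * V) j k"
      unfolding gl by (rule entry_mult_sums)
    \<comment> \<open>Absolute convergence, from Cauchy-Schwarz, is what allows the series over
      codes to be regrouped into blocks.\<close>
    moreover have "summable (\<lambda>l. norm (g (prod_decode l)))"
      unfolding gl by (rule Cauchy_Schwarz_summable[OF hs_row[OF U(2)] hs_col[OF V(2)]])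
    ultimately have "((\<lambda>l. g (prod_decode l)) has_sum entry (U * V) j k) UNIV"
      by (rule norm_summable_imp_has_sum[rotated])
    then have "(g has_sum entry (U * V) j k) (UNIV \<times> UNIV)"
      using has_sum_reindex_bij_betw[OF bij_prod_decode, of g] by simp
    moreover have "((\<lambda>i. g (n, i)) has_sum entry (D n) j k) UNIV" for n
    proof -
      have "((\<lambda>i. g (n, i)) has_sum (\<Sum>i<2 * r n. g (n, i))) {..<2 * r n}" by (rule has_sum_finite) simp
      then have "((\<lambda>i. g (n, i)) has_sum (\<Sum>i<2 * r n. g (n, i))) UNIV"
        by (rule has_sum_cong_neutral[THEN iffD1, rotated -1]) (auto simp: g_def x0)
      then show ?thesis by (simp add: g_def e)
    qed
    ultimately have "((\<lambda>n. entry (D n) j k) has_sum entry (U * V) j k) UNIV"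
      by (rule has_sum_SigmaD[where B = "\<lambda>_. UNIV"])
    then show ?thesis using has_sum_imp_sums sums_unique2[OF sums] by blast
  qed
  then have "A = U * V" by (rule op_eqI)
  then show ?thesis using U V unfolding factors_def by blast
qed

lemma hs_bound_zero: "0 \<le> t \<Longrightarrow> hs_bound 0 t"
  by (simp add: hs_bound_def entry_simps)

text \<open>Dyadic telescoping: near-optimal approximants of rank 2^n have differences of rank at
  most 2 * 2^n whose norms are controlled by singular values at powers of 2, exactly the weights
  summed in \<open>condensed_singular_values\<close>.\<close>

theorem trace_class_factors:
  assumes "trace_class A"
  shows "factors A (64 * trace_norm A)"
proof -
  define t where "t = trace_norm A"
  have t0: "0 \<le> t" unfolding t_def by (rule trace_norm_nonneg[OF assms])
  have sv: "singular_value n A \<le> t" for n unfolding t_def by (rule singular_value_le_trace_norm[OF assms])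
  show ?thesis
  proof (cases "t = 0")
    case True
    then have "A = 0" using sv[of 0] by (simp add: singular_value_0)
    then show ?thesis
      unfolding factors_def using hs_bound_zero[of "64 * t"] True by (intro exI[of _ 0]) (simp add: t_def)
  next
    case False
    then have t: "0 < t" using t0 by simp
    \<comment> \<open>Best approximants need not be attained, so a positive slack is allowed; this
      is why t = 0 is split off. The power 4^n keeps it summable after multiplication by the rank
      2^n.\<close>
    have "\<exists>F. rank_le (2 ^ n) F \<and> norm (A - F) < singular_value (2 ^ n) A + t / 4 ^ n" for n
      using singular_value_approx[of "t / 4 ^ n" "2 ^ n" A] t by (metis divide_pos_pos zero_less_numeral zero_less_power)
    then obtain F where F: "\<And>n. rank_le (2 ^ n) (F n)" "\<And>n. norm (A - F n) < singular_value (2 ^ n) A + t / 4 ^ n"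
      by metis
    \<comment> \<open>The shift puts 0 in front, so that the differences telescope from zero and
      \<open>D 0 = F 0\<close>.\<close>
    define G where "G n = (case n of 0 \<Rightarrow> 0 | Suc m \<Rightarrow> F m)" for n
    define D where "D n = G (Suc n) - G n" for n
    have G0: "G 0 = 0" and GS: "G (Suc n) = F n" for n by (simp_all add: G_def)
    have rD: "rank_le (2 * 2 ^ n) (D n)" for n
    proof (cases n)
      case 0
      show ?thesis using F(1)[of 0] by (auto simp: 0 D_def G0 GS intro: rank_le_mono)
    next
      case (Suc m)
      have "rank_le (2 ^ m) (- F m)" using rank_le_scaleC[OF F(1)[of m], of "-1"] by (simp add: op_algebra_scaleC)
      then have "rank_le (2 ^ n + 2 ^ m) (D n)"
        using rank_le_add[OF F(1)[of n], of "2 ^ m" "- F m"] by (simp add: D_def GS Suc)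
      then show ?thesis by (rule rank_le_mono) (simp add: Suc)
    qed
    have D0: "norm (D 0) \<le> 3 * t"
    proof -
      have "norm (D 0) \<le> norm A + norm (A - F 0)"
        using norm_triangle_ineq4[of A "A - F 0"] by (simp add: D_def G0 GS)
      then show ?thesis using F(2)[of 0] sv[of 1] sv[of 0] by (simp add: singular_value_0)
    qed
    have DS: "norm (D (Suc m)) \<le> 2 * singular_value (2 ^ m) A + 5 * t / 4 ^ Suc m" for m
    proof -
      have "norm (D (Suc m)) \<le> norm (A - F m) + norm (A - F (Suc m))"
        using norm_triangle_ineq4[of "A - F m" "A - F (Suc m)"] by (simp add: D_def GS)
      moreover have "singular_value (2 ^ Suc m) A \<le> singular_value (2 ^ m) A"
        by (rule singular_value_antimono) simp
      moreover have "t / 4 ^ m = 4 * (t / 4 ^ Suc m)" "5 * t / 4 ^ Suc m = 5 * (t / 4 ^ Suc m)" by simp_all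
      ultimately show ?thesis using F(2)[of m] F(2)[of "Suc m"] by linarith
    qed
    have "factors A (64 * t)"
    proof (rule factors_of_finite_rank_series[OF rD])
      fix N
      \<comment> \<open>The constant is 64 = 12 + 32 + 20: the first difference, the condensed
        singular values, and the accumulated slack.\<close>
      have "(\<Sum>n<N. 2 * real (2 * 2 ^ n) * norm (D n)) \<le> (\<Sum>n\<le>Suc N. 4 * 2 ^ n * norm (D n))"
        by (rule order.trans[OF _ sum_mono2[of _ "{..<N}"]]) auto
      also have "\<dots> = 4 * norm (D 0) + (\<Sum>m\<le>N. 4 * 2 ^ Suc m * norm (D (Suc m)))"
        by (subst sum.atMost_Suc_shift) simp
      also have "\<dots> \<le> 12 * t + (\<Sum>m\<le>N. 16 * (2 ^ m * singular_value (2 ^ m) A) + 10 * t * (1 / 2) ^ m)"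
      proof (intro add_mono sum_mono)
        fix m
        have "4 * 2 ^ Suc m * norm (D (Suc m)) \<le> 4 * 2 ^ Suc m * (2 * singular_value (2 ^ m) A + 5 * t / 4 ^ Suc m)"
          by (intro mult_left_mono DS) simp
        also have "(4 :: real) ^ Suc m = 4 * 2 ^ m * 2 ^ m" by (simp flip: power_mult_distrib)
        also have "4 * 2 ^ Suc m * (2 * singular_value (2 ^ m) A + 5 * t / (4 * 2 ^ m * 2 ^ m))
          = 16 * (2 ^ m * singular_value (2 ^ m) A) + 10 * t * (1 / 2) ^ m"
          by (simp add: field_simps)
        finally show "4 * 2 ^ Suc m * norm (D (Suc m)) \<le> \<dots>" .
      qed (use D0 in simp)
      also have "\<dots> = 12 * t + 16 * (\<Sum>m\<le>N. 2 ^ m * singular_value (2 ^ m) A) + 10 * t * (\<Sum>m\<le>N. (1 / 2) ^ m)"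
        by (simp add: sum.distrib sum_distrib_left)
      also have "\<dots> \<le> 12 * t + 16 * (2 * t) + 10 * t * 2"
      proof (intro add_mono mult_left_mono order_refl)
        show "(\<Sum>m\<le>N. 2 ^ m * singular_value (2 ^ m) A) \<le> 2 * t"
          unfolding t_def by (rule condensed_singular_values[OF assms])
        have "(\<Sum>m\<le>N. (1 / 2 :: real) ^ m) \<le> (\<Sum>m. (1 / 2) ^ m)"
          by (intro sum_le_suminf summable_geometric) auto
        then show "(\<Sum>m\<le>N. (1 / 2 :: real) ^ m) \<le> 2" by (subst (asm) suminf_geometric) auto
      qed (use t in auto)
      finally show "(\<Sum>n<N. 2 * real (2 * 2 ^ n) * norm (D n)) \<le> 64 * t" by simp
    next
      fix j k
      have tel: "(\<Sum>n<N. entry (D n) j k) = entry (G N) j k" for N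
        by (induction N) (simp_all add: D_def G0 entry_simps)
      have sum: "summable (\<lambda>n. singular_value n A)" using assms by (simp add: trace_class_def)
      have "strict_mono (\<lambda>n. 2 ^ n :: nat)" by (simp add: strict_mono_def)
      then have "(\<lambda>n. singular_value (2 ^ n) A) \<longlonglongrightarrow> 0"
        using LIMSEQ_subseq_LIMSEQ[OF summable_LIMSEQ_zero[OF sum]] by (simp add: o_def)
      moreover have "(\<lambda>n. t / 4 ^ n) \<longlonglongrightarrow> 0"
        using tendsto_mult[OF tendsto_const[of t] LIMSEQ_realpow_zero[of "1/4"]] by (simp add: power_divide)
      ultimately have lim: "(\<lambda>n. singular_value (2 ^ n) A + t / 4 ^ n) \<longlonglongrightarrow> 0"
        using tendsto_add by fastforce
      have le: "norm (entry (F n) j k - entry A j k) \<le> singular_value (2 ^ n) A + t / 4 ^ n" for n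
      proof -
        have "norm (entry (F n) j k - entry A j k) \<le> norm (A - F n)"
          using cmod_entry_le[of "A - F n" j k] by (simp add: entry_simps norm_minus_commute)
        then show ?thesis using F(2)[of n] by simp
      qed
      have "(\<lambda>n. entry (F n) j k - entry A j k) \<longlonglongrightarrow> 0"
        by (rule Lim_null_comparison[OF always_eventually lim]) (intro allI le)
      then have "(\<lambda>n. entry (G (Suc n)) j k) \<longlonglongrightarrow> entry A j k" by (simp add: GS LIM_zero_iff)
      then have "(\<lambda>n. entry (G n) j k) \<longlonglongrightarrow> entry A j k" by (rule LIMSEQ_imp_Suc)
      then show "(\<lambda>n. entry (D n) j k) sums entry A j k" by (simp add: sums_def tel)
    qed
    then show ?thesis by (simp add: t_def)
  qed
qed

section \<open>The Fredholm determinant and the trace\<close>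

definition l2seq :: "(nat \<Rightarrow> real) \<Rightarrow> bool"
  where "l2seq p \<longleftrightarrow> (\<forall>j. 0 \<le> p j) \<and> summable (\<lambda>j. (p j)\<^sup>2)"

lemma l2seq_nonneg: "l2seq p \<Longrightarrow> 0 \<le> p j" by (simp add: l2seq_def)

lemma l2seq_add:
  assumes "l2seq p" "l2seq q"
  shows "l2seq (\<lambda>j. p j + q j)"
proof -
  have "summable (\<lambda>j. (p j + q j)\<^sup>2)"
  proof (rule summable_comparison_test')
    show "summable (\<lambda>j. 2 * (p j)\<^sup>2 + 2 * (q j)\<^sup>2)"
      using assms by (intro summable_add summable_mult) (auto simp: l2seq_def)
    show "norm ((p j + q j)\<^sup>2) \<le> 2 * (p j)\<^sup>2 + 2 * (q j)\<^sup>2" for j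
    proof -
      have "(p j + q j)\<^sup>2 \<le> 2 * (p j)\<^sup>2 + 2 * (q j)\<^sup>2"
        using sum_squares_bound[of "p j" "q j"] unfolding power2_sum by linarith
      then show ?thesis by simp
    qed
  qed
  then show ?thesis using assms by (simp add: l2seq_def)
qed

lemma l2seq_scale: "l2seq p \<Longrightarrow> 0 \<le> c \<Longrightarrow> l2seq (\<lambda>j. c * p j)"
  by (auto simp: l2seq_def power_mult_distrib intro!: summable_mult)

lemma l2seq_mult:
  assumes "l2seq p" "l2seq q"
  shows "summable (\<lambda>j. p j * q j)"
proof (rule summable_comparison_test')
  show "summable (\<lambda>j. (p j)\<^sup>2 + (q j)\<^sup>2)" using assms by (intro summable_add) (auto simp: l2seq_def)
  fix j
  have "0 \<le> p j * q j" using assms by (simp add: l2seq_def)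
  then show "norm (p j * q j) \<le> (p j)\<^sup>2 + (q j)\<^sup>2"
    using sum_squares_bound[of "p j" "q j"] by (simp add: mult.assoc)
qed

lemma l2seq_row_norm: "hs_bound U t \<Longrightarrow> l2seq (row_norm U)"
  unfolding l2seq_def by (auto intro: summableI_nonneg_bounded[OF _ sum_row_norm_le])

lemma l2seq_col_norm: "hs_bound U t \<Longrightarrow> l2seq (col_norm U)"
  unfolding l2seq_def by (auto intro: summableI_nonneg_bounded[OF _ sum_col_norm_le])

lemma power2_le_imp_cmod_le: "(cmod z)\<^sup>2 \<le> a\<^sup>2 * b\<^sup>2 \<Longrightarrow> 0 \<le> a \<Longrightarrow> 0 \<le> b \<Longrightarrow> cmod z \<le> a * b"
  by (rule power2_le_imp_le) (simp_all add: power_mult_distrib)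

text \<open>The majorant is the same for every cut-off \<open>n\<close>, as dominated convergence of
  the determinants requires.\<close>

lemma cmod_partial_product_le:
  assumes "hs_bound U s" "hs_bound V t"
  shows "cmod (\<Sum>l<n. entry U j l * entry V l k) \<le> row_norm U j * col_norm V k"
proof (rule power2_le_imp_cmod_le)
  have "cmod (\<Sum>l<n. entry U j l * entry V l k) \<le> (\<Sum>l<n. cmod (entry U j l) * cmod (entry V l k))"
    by (rule order.trans[OF norm_sum]) (simp add: norm_mult)
  then have "(cmod (\<Sum>l<n. entry U j l * entry V l k))\<^sup>2 \<le> (\<Sum>l<n. cmod (entry U j l) * cmod (entry V l k))\<^sup>2"
    by (rule power_mono) simp
  also have "\<dots> \<le> (\<Sum>l<n. (cmod (entry U j l))\<^sup>2) * (\<Sum>l<n. (cmod (entry V l k))\<^sup>2)"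
    by (rule Cauchy_Schwarz_ineq_sum)
  also have "\<dots> \<le> (row_norm U j)\<^sup>2 * (col_norm V k)\<^sup>2"
    using assms by (intro mult_mono sum_row_le sum_col_le sum_nonneg) auto
  finally show "(cmod (\<Sum>l<n. entry U j l * entry V l k))\<^sup>2 \<le> (row_norm U j)\<^sup>2 * (col_norm V k)\<^sup>2" .
qed (use assms in auto)

lemma cmod_product_le:
  assumes "hs_bound U s" "hs_bound V t"
  shows "cmod (entry (U * V) j k) \<le> row_norm U j * col_norm V k"
proof (rule LIMSEQ_le_const2)
  show "(\<lambda>n. cmod (\<Sum>l<n. entry U j l * entry V l k)) \<longlonglongrightarrow> cmod (entry (U * V) j k)"
    using entry_mult_sums[of U j V k] unfolding sums_def by (rule tendsto_norm)
qed (use cmod_partial_product_le[OF assms] in blast)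

lemma tendsto_fredholm_det:
  assumes "l2seq p" "l2seq q" and bound: "\<And>n j k. cmod (x n j k) \<le> p j * q k"
    and lim: "\<And>j k. (\<lambda>n. x n j k) \<longlonglongrightarrow> entry A j k"
  shows "(\<lambda>n. idet n (x n)) \<longlonglongrightarrow> fredholm_det (1 + A)"
proof -
  have bA: "cmod (entry A j k) \<le> p j * q k" for j k
    by (rule LIMSEQ_le_const2[OF tendsto_norm[OF lim]]) (use bound in blast)
  have "fredholm_det (1 + A) = fdet (entry A)"
    by (intro fredholm_det_eq_fdet[of A p q] l2seq_mult l2seq_nonneg assms(1,2) bA)
  moreover have "(\<lambda>n. idet n (x n)) \<longlonglongrightarrow> fdet (entry A)"
    by (intro tendsto_idet_fdet[OF bound _ _ _ lim] l2seq_mult l2seq_nonneg assms(1,2))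
  ultimately show ?thesis by simp
qed

text \<open>For a factorization A = U V, the row norms of \<open>U\<close> and the column norms of
  \<open>V\<close> serve as \<open>p\<close> and \<open>q\<close>; 64 is the constant of the
  factorization.\<close>

lemma trace_class_dominated:
  assumes "trace_class A"
  obtains p q where "l2seq p" "l2seq q" "\<And>j k. cmod (entry A j k) \<le> p j * q k"
    "\<And>n. (\<Sum>j<n. p j * q j) \<le> 64 * trace_norm A"
proof -
  obtain U V where A: "A = U * V" and U: "hs_bound U (64 * trace_norm A)" and V: "hs_bound V (64 * trace_norm A)"
    using trace_class_factors[OF assms] unfolding factors_def by blast
  show ?thesis
  proof (rule that[OF l2seq_row_norm[OF U] l2seq_col_norm[OF V]])
    show "cmod (entry A j k) \<le> row_norm U j * col_norm V k" for j k
      unfolding A by (rule cmod_product_le[OF U V])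
    fix n
    let ?t = "64 * trace_norm A"
    have "(\<Sum>j<n. row_norm U j * col_norm V j)\<^sup>2 \<le> (\<Sum>j<n. (row_norm U j)\<^sup>2) * (\<Sum>j<n. (col_norm V j)\<^sup>2)"
      by (rule Cauchy_Schwarz_ineq_sum)
    also have "\<dots> \<le> ?t * ?t"
      using U V hs_bound_nonneg[OF U] by (intro mult_mono sum_row_norm_le sum_col_norm_le sum_nonneg) auto
    finally have "(\<Sum>j<n. row_norm U j * col_norm V j)\<^sup>2 \<le> ?t\<^sup>2" by (simp only: power2_eq_square)
    then show "(\<Sum>j<n. row_norm U j * col_norm V j) \<le> ?t"
      by (rule power2_le_imp_le) (rule hs_bound_nonneg[OF U])
  qed
qed

text \<open>The product of two finite sections is not the section of the product: its inner sum
  stops at \<open>n\<close>. Both nevertheless have the same entrywise limit and a common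
  majorant.\<close>

lemma fredholm_det_mult:
  assumes "trace_class (X - 1)" "trace_class (Y - 1)"
  shows "trace_class (X * Y - 1)" "fredholm_det (X * Y) = fredholm_det X * fredholm_det Y"
proof -
  define A B where "A = X - 1" and "B = Y - 1"
  have XY: "X * Y = 1 + (A + B + A * B)" "X = 1 + A" "Y = 1 + B"
    by (simp_all add: A_def B_def algebra_simps)
  have tc: "trace_class A" "trace_class B" using assms by (simp_all add: A_def B_def)
  then have "trace_class (A + B + A * B)" by (intro trace_class_add(1) trace_class_mult_left)
  then show "trace_class (X * Y - 1)" unfolding XY(1) by simp
  obtain p q where pq: "l2seq p" "l2seq q" "\<And>j k. cmod (entry A j k) \<le> p j * q k"
    using trace_class_dominated[OF tc(1)] by metis
  obtain p' q' where pq': "l2seq p'" "l2seq q'" "\<And>j k. cmod (entry B j k) \<le> p' j * q' k"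
    using trace_class_dominated[OF tc(2)] by metis
  define S where "S = (\<Sum>l. q l * p' l)"
  have S: "(\<Sum>l<n. q l * p' l) \<le> S" for n
    unfolding S_def using pq pq' by (intro sum_le_suminf l2seq_mult) (auto simp: l2seq_def)
  have S0: "0 \<le> S" using S[of 0] by simp
  define x where "x n j k = entry A j k + entry B j k + (\<Sum>l<n. entry A j l * entry B l k)" for n j k
  have "(\<lambda>n. idet n (x n)) \<longlonglongrightarrow> fredholm_det (1 + (A + B + A * B))"
  proof (rule tendsto_fredholm_det)
    \<comment> \<open>Multiplied out, these two sequences dominate p q' S, the bound for the
      truncated product, along with p q and p' q'.\<close>
    show "l2seq (\<lambda>j. p j + p' j + S * p j)" "l2seq (\<lambda>k. q k + q' k)"
      using pq pq' S0 by (intro l2seq_add l2seq_scale; simp)+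
    show "(\<lambda>n. x n j k) \<longlonglongrightarrow> entry (A + B + A * B) j k" for j k
      using entry_mult_sums[of A j B k] unfolding sums_def x_def entry_simps by (intro tendsto_intros)
    show "cmod (x n j k) \<le> (p j + p' j + S * p j) * (q k + q' k)" for n j k
    proof -
      have n0: "0 \<le> p j" "0 \<le> p' j" "0 \<le> q k" "0 \<le> q' k" using pq pq' by (simp_all add: l2seq_def)
      have "cmod (\<Sum>l<n. entry A j l * entry B l k) \<le> (\<Sum>l<n. (p j * q l) * (p' l * q' k))"
        unfolding norm_mult[symmetric]
        by (rule sum_norm_le) (use pq pq' in \<open>auto simp: norm_mult l2seq_def intro!: mult_mono\<close>)
      also have "\<dots> = p j * q' k * (\<Sum>l<n. q l * p' l)" by (simp add: sum_distrib_left mult_ac)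
      also have "\<dots> \<le> p j * q' k * S" by (intro mult_left_mono S mult_nonneg_nonneg n0)
      finally have "cmod (x n j k) \<le> p j * q k + p' j * q' k + p j * q' k * S"
        unfolding x_def using pq(3)[of j k] pq'(3)[of j k] by (intro norm_triangle_le add_mono) auto
      also have "\<dots> \<le> (p j + p' j + S * p j) * (q k + q' k)"
        using n0 S0 by (simp add: algebra_simps)
      finally show ?thesis .
    qed
  qed
  moreover have "(\<lambda>n. idet n (entry A) * idet n (entry B)) \<longlonglongrightarrow> fredholm_det (1 + A) * fredholm_det (1 + B)"
    by (intro tendsto_mult tendsto_fredholm_det[OF pq] tendsto_fredholm_det[OF pq'] tendsto_const)
  ultimately have "fredholm_det (1 + (A + B + A * B)) = fredholm_det (1 + A) * fredholm_det (1 + B)"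
    unfolding x_def idet_mult[symmetric] by (rule LIMSEQ_unique)
  then show "fredholm_det (X * Y) = fredholm_det X * fredholm_det Y"
    unfolding XY(1) XY(2,3)[symmetric] .
qed

lemma fredholm_det_one_plus_swap_hs:
  assumes "hs_bound U s" "hs_bound V t"
  shows "fredholm_det (1 + U * V) = fredholm_det (1 + V * U)"
proof -
  have "(\<lambda>n. idet n (\<lambda>j k. \<Sum>l<n. entry U j l * entry V l k)) \<longlonglongrightarrow> fredholm_det (1 + U * V)"
    by (rule tendsto_fredholm_det[OF l2seq_row_norm[OF assms(1)] l2seq_col_norm[OF assms(2)] cmod_partial_product_le[OF assms]])
      (use entry_mult_sums in \<open>auto simp: sums_def\<close>)
  moreover have "(\<lambda>n. idet n (\<lambda>j k. \<Sum>l<n. entry V j l * entry U l k)) \<longlonglongrightarrow> fredholm_det (1 + V * U)"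
    by (rule tendsto_fredholm_det[OF l2seq_row_norm[OF assms(2)] l2seq_col_norm[OF assms(1)] cmod_partial_product_le[OF assms(2,1)]])
      (use entry_mult_sums in \<open>auto simp: sums_def\<close>)
  ultimately show ?thesis unfolding idet_swap[of _ "entry U"] by (rule LIMSEQ_unique)
qed

text \<open>\<open>B\<close> is merely bounded, so it is absorbed into a Hilbert-Schmidt factor: for
  A = U V, first \<open>V * B\<close> is moved past \<open>U\<close>, then \<open>B * U\<close> past
  \<open>V\<close>.\<close>

lemma fredholm_det_one_plus_swap:
  assumes "trace_class A"
  shows "fredholm_det (1 + A * B) = fredholm_det (1 + B * A)"
proof -
  obtain U V where A: "A = U * V" and U: "hs_bound U (64 * trace_norm A)" and V: "hs_bound V (64 * trace_norm A)"
    using trace_class_factors[OF assms] unfolding factors_def by blast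
  have "fredholm_det (1 + U * (V * B)) = fredholm_det (1 + (V * B) * U)"
    by (rule fredholm_det_one_plus_swap_hs[OF U hs_mult_right[OF V]])
  moreover have "fredholm_det (1 + (B * U) * V) = fredholm_det (1 + V * (B * U))"
    by (rule fredholm_det_one_plus_swap_hs[OF hs_mult_left[OF U] V])
  ultimately show ?thesis by (simp add: A mult.assoc)
qed

lemma fredholm_det_conj:
  assumes "trace_class (X - 1)" "S * S' = 1" "S' * S = 1"
  shows "trace_class (S * X * S' - 1)" "fredholm_det (S * X * S') = fredholm_det X"
proof -
  have 1: "S * X * S' = 1 + S * (X - 1) * S'" using assms by (simp add: algebra_simps)
  show "trace_class (S * X * S' - 1)"
    unfolding 1 using assms by (simp add: trace_class_mult_left trace_class_mult_right)
  have "fredholm_det (1 + S * (X - 1) * S') = fredholm_det (1 + S' * (S * (X - 1)))"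
    by (rule fredholm_det_one_plus_swap[OF trace_class_mult_left(1)[OF assms(1)]])
  also have "1 + S' * (S * (X - 1)) = X" using assms by (simp add: mult.assoc[symmetric])
  finally show "fredholm_det (S * X * S') = fredholm_det X" by (simp add: 1)
qed

section \<open>The trace\<close>

lemma trace_sums:
  assumes "trace_class A"
  shows "(\<lambda>n. entry A n n) sums op_trace A" "cmod (op_trace A) \<le> 64 * trace_norm A"
proof -
  obtain p q where pq: "l2seq p" "l2seq q" "\<And>j k. cmod (entry A j k) \<le> p j * q k"
    "\<And>n. (\<Sum>j<n. p j * q j) \<le> 64 * trace_norm A"
    using trace_class_dominated[OF assms] by metis
  have s: "summable (\<lambda>n. cmod (entry A n n))"
    by (rule summable_comparison_test'[OF l2seq_mult[OF pq(1,2)]]) (simp add: pq)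
  show "(\<lambda>n. entry A n n) sums op_trace A"
    unfolding op_trace_def by (rule summable_sums[OF summable_norm_cancel[OF s]])
  have "cmod (op_trace A) \<le> (\<Sum>n. cmod (entry A n n))" unfolding op_trace_def by (rule summable_norm[OF s])
  also have "\<dots> \<le> 64 * trace_norm A"
  proof (rule suminf_le_const[OF s])
    fix n
    have "(\<Sum>i<n. cmod (entry A i i)) \<le> (\<Sum>i<n. p i * q i)" by (intro sum_mono pq)
    then show "(\<Sum>i<n. cmod (entry A i i)) \<le> 64 * trace_norm A" using pq(4)[of n] by simp
  qed
  finally show "cmod (op_trace A) \<le> 64 * trace_norm A" .
qed

lemma op_trace_add: "trace_class A \<Longrightarrow> trace_class B \<Longrightarrow> op_trace (A + B) = op_trace A + op_trace B"
  using sums_add[OF trace_sums(1) trace_sums(1)] unfolding op_trace_def[of "A + B"] entry_simps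
  by (simp add: sums_iff)

lemma op_trace_scaleC: "trace_class A \<Longrightarrow> op_trace (z *\<^sub>C A) = z * op_trace A"
  using sums_mult[OF trace_sums(1)] unfolding op_trace_def[of "z *\<^sub>C A"] entry_simps
  by (simp add: sums_iff)

lemma op_trace_diff: "trace_class A \<Longrightarrow> trace_class B \<Longrightarrow> op_trace (A - B) = op_trace A - op_trace B"
  using sums_diff[OF trace_sums(1) trace_sums(1)] unfolding op_trace_def[of "A - B"] entry_simps
  by (simp add: sums_iff)

lemma op_trace_uminus: "trace_class A \<Longrightarrow> op_trace (- A) = - op_trace A"
  using sums_minus[OF trace_sums(1)] unfolding op_trace_def[of "- A"] entry_simps
  by (simp add: sums_iff)

lemma hs_summable_on:
  assumes "hs_bound U t"
  shows "(\<lambda>(j, l). (cmod (entry U j l))\<^sup>2) summable_on UNIV \<times> UNIV"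
proof (rule nonneg_bdd_above_summable_on)
  show "bdd_above (sum (\<lambda>(j, l). (cmod (entry U j l))\<^sup>2) ` {F. F \<subseteq> UNIV \<times> UNIV \<and> finite F})"
  proof (rule bdd_aboveI2)
    fix F :: "(nat \<times> nat) set" assume F: "F \<in> {F. F \<subseteq> UNIV \<times> UNIV \<and> finite F}"
    obtain m where m: "fst ` F \<subseteq> {..<m}" using F by (metis (no_types) finite_imageI finite_nat_iff_bounded mem_Collect_eq)
    obtain n where n: "snd ` F \<subseteq> {..<n}" using F by (metis (no_types) finite_imageI finite_nat_iff_bounded mem_Collect_eq)
    have "sum (\<lambda>(j, l). (cmod (entry U j l))\<^sup>2) F \<le> (\<Sum>(j, l)\<in>{..<m} \<times> {..<n}. (cmod (entry U j l))\<^sup>2)"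
      using m n by (intro sum_mono2) (auto simp: subset_iff image_iff)
    also have "\<dots> = (\<Sum>j<m. \<Sum>l<n. (cmod (entry U j l))\<^sup>2)" by (simp add: sum.cartesian_product)
    also have "\<dots> \<le> t" by (rule hs_boundD[OF assms])
    finally show "sum (\<lambda>(j, l). (cmod (entry U j l))\<^sup>2) F \<le> t" .
  qed
qed auto

text \<open>Both traces are iterated sums of one double family, absolutely summable because a
  product is bounded by the sum of the squares.\<close>

lemma op_trace_swap_hs:
  assumes "hs_bound U s" "hs_bound V t"
  shows "op_trace (U * V) = op_trace (V * U)"
proof -
  define f where "f j l = entry U j l * entry V l j" for j l
  have s1: "(\<lambda>(j, l). (cmod (entry U j l))\<^sup>2) summable_on UNIV \<times> UNIV" by (rule hs_summable_on[OF assms(1)])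
  have s2: "(\<lambda>(j, l). (cmod (entry V l j))\<^sup>2) summable_on UNIV \<times> UNIV"
    using hs_summable_on[OF assms(2)] summable_on_reindex_bij_betw[of prod.swap "UNIV \<times> UNIV" "UNIV \<times> UNIV" "\<lambda>(l, j). (cmod (entry V l j))\<^sup>2"]
    by (simp add: case_prod_unfold bij_swap)
  have "(\<lambda>z. norm (case z of (j, l) \<Rightarrow> f j l)) summable_on UNIV \<times> UNIV"
  proof (rule summable_on_comparison_test[OF summable_on_add[OF s1 s2]])
    fix z :: "nat \<times> nat"
    obtain j l where z: "z = (j, l)" by (cases z)
    have "2 * (cmod (entry U j l) * cmod (entry V l j)) \<le> (cmod (entry U j l))\<^sup>2 + (cmod (entry V l j))\<^sup>2"
      using sum_squares_bound[of "cmod (entry U j l)" "cmod (entry V l j)"] by (simp add: mult.assoc)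
    moreover have "0 \<le> cmod (entry U j l) * cmod (entry V l j)" by simp
    ultimately show "norm (case z of (j, l) \<Rightarrow> f j l)
      \<le> (case z of (j, l) \<Rightarrow> (cmod (entry U j l))\<^sup>2) + (case z of (j, l) \<Rightarrow> (cmod (entry V l j))\<^sup>2)"
      unfolding z f_def norm_mult prod.case by linarith
  qed simp
  then have sf: "(\<lambda>(j, l). f j l) summable_on UNIV \<times> UNIV" by (rule abs_summable_summable)
  have sf': "(\<lambda>(l, j). f j l) summable_on UNIV \<times> UNIV"
    using sf summable_on_reindex_bij_betw[of prod.swap "UNIV \<times> UNIV" "UNIV \<times> UNIV" "\<lambda>(l, j). f j l"]
    by (simp add: case_prod_unfold bij_swap)
  have row: "infsum (f j) UNIV = entry (U * V) j j" for j
  proof -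
    have "(f j has_sum entry (U * V) j j) UNIV"
      unfolding f_def by (rule norm_summable_imp_has_sum[OF Cauchy_Schwarz_summable[OF hs_row[OF assms(1)] hs_col[OF assms(2)]] entry_mult_sums])
    then show ?thesis by (rule infsumI)
  qed
  have col: "infsum (\<lambda>j. f j l) UNIV = entry (V * U) l l" for l
  proof -
    have "((\<lambda>j. entry V l j * entry U j l) has_sum entry (V * U) l l) UNIV"
      by (rule norm_summable_imp_has_sum[OF Cauchy_Schwarz_summable[OF hs_row[OF assms(2)] hs_col[OF assms(1)]] entry_mult_sums])
    then show ?thesis unfolding f_def by (simp add: infsumI mult.commute)
  qed
  have "infsum (\<lambda>j. entry (U * V) j j) UNIV = infsum (\<lambda>l. entry (V * U) l l) UNIV"
    using infsum_swap_banach[OF sf] by (simp add: row col)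
  moreover have "infsum (\<lambda>j. entry (U * V) j j) UNIV = op_trace (U * V)"
    using summable_on_Sigma_banach[OF sf] unfolding row op_trace_def
    by (metis (no_types, lifting) has_sum_imp_sums has_sum_infsum sums_unique)
  moreover have "infsum (\<lambda>j. entry (V * U) j j) UNIV = op_trace (V * U)"
    using summable_on_Sigma_banach[OF sf'] unfolding col op_trace_def
    by (metis (no_types, lifting) has_sum_imp_sums has_sum_infsum sums_unique)
  ultimately show ?thesis by simp
qed

lemma op_trace_swap:
  assumes "trace_class A"
  shows "op_trace (A * B) = op_trace (B * A)"
proof -
  obtain U V where A: "A = U * V" and U: "hs_bound U (64 * trace_norm A)" and V: "hs_bound V (64 * trace_norm A)"
    using trace_class_factors[OF assms] unfolding factors_def by blast
  have "op_trace (U * (V * B)) = op_trace ((V * B) * U)"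
    by (rule op_trace_swap_hs[OF U hs_mult_right[OF V]])
  moreover have "op_trace ((B * U) * V) = op_trace (V * (B * U))"
    by (rule op_trace_swap_hs[OF hs_mult_left[OF U] V])
  ultimately show ?thesis by (simp add: A mult.assoc)
qed

text \<open>The quadratic error matters: for operators of size 1/s, a power of order s sees only the
  trace in the limit.\<close>

lemma fredholm_det_approx:
  assumes "trace_class A" "64 * trace_norm A \<le> 1 / 2"
  shows "cmod (fredholm_det (1 + A) - 1 - op_trace A) \<le> 2 * (64 * trace_norm A)\<^sup>2"
proof -
  obtain p q where pq: "l2seq p" "l2seq q" "\<And>j k. cmod (entry A j k) \<le> p j * q k"
    "\<And>n. (\<Sum>j<n. p j * q j) \<le> 64 * trace_norm A"
    using trace_class_dominated[OF assms(1)] by metis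
  have "(\<lambda>n. idet n (entry A)) \<longlonglongrightarrow> fredholm_det (1 + A)"
    by (rule tendsto_fredholm_det[OF pq(1-3)]) simp
  then have lim: "(\<lambda>n. cmod (idet n (entry A) - 1 - (\<Sum>j<n. entry A j j)))
    \<longlonglongrightarrow> cmod (fredholm_det (1 + A) - 1 - op_trace A)"
    using trace_sums(1)[OF assms(1)] unfolding sums_def by (intro tendsto_intros)
  have le: "cmod (idet n (entry A) - 1 - (\<Sum>j<n. entry A j j)) \<le> 2 * (64 * trace_norm A)\<^sup>2" for n
    by (intro idet_approx[of _ p q] pq l2seq_nonneg assms(2))
  show ?thesis by (rule LIMSEQ_le_const2[OF lim]) (use le in blast)
qed

section \<open>Finite sections\<close>

lemma op_apply_P: "op_apply (op_P N) x = cutoff N x"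
  unfolding op_apply_def by transfer (simp add: bounded_linear_cutoff bounded_linear_Blinfun_apply)

lemma entry_P_left: "entry (op_P N * A) j k = (if j < N then entry A j k else 0)"
  by (simp add: entry_def op_apply_simps op_apply_P)

lemma entry_P_right: "entry (A * op_P N) j k = (if k < N then entry A j k else 0)"
proof -
  have "cutoff N (basis_ell2 k) = (if k < N then basis_ell2 k else 0)"
    by (rule ell2_eqI) auto
  then show ?thesis by (simp add: entry_def op_apply_simps op_apply_P)
qed

lemma P_idem: "op_P N * op_P N = op_P N"
proof (rule op_eqI)
  fix j k show "entry (op_P N * op_P N) j k = entry (op_P N) j k"
    using entry_P_left[of N 1 j k] by (simp add: entry_P_left)
qed

lemma rank_le_P: "rank_le N (op_P N)"
proof -
  have "op_apply (op_P N) x = (\<Sum>i<N. coord x i *\<^sub>C basis_ell2 i)" for x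
    unfolding op_apply_P fin_vec_coord[symmetric] fin_vec_def ..
  then show ?thesis unfolding rank_le_def by blast
qed

lemma trace_class_finite_rank:
  assumes "rank_le N F"
  shows "trace_class F"
  unfolding trace_class_def
proof (rule summable_finite[of "{..<N}"])
  fix n assume "n \<notin> {..<N}"
  then have "singular_value n F \<le> norm (F - F)" by (intro singular_value_le rank_le_mono[OF assms]) simp
  then show "singular_value n F = 0" using singular_value_nonneg[of n F] by simp
qed simp

text \<open>The compressed operator differs from 1 only in the upper-left block. A minor whose index
  set leaves that block has a zero row, so the Fredholm series is the finite determinant.\<close>

lemma section_det_eq_fredholm_det:
  "section_det N X = fredholm_det (op_P N * X * op_P N + op_Q N)"
proof -
  define A where "A = op_P N * (X - 1) * op_P N"
  have eA: "entry A j k = (if j < N \<and> k < N then entry (X - 1) j k else 0)" for j k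
    by (simp add: A_def entry_P_left entry_P_right)
  have tA: "trace_class A"
    unfolding A_def by (intro trace_class_finite_rank[OF rank_le_mult_left[OF rank_le_P]])
  obtain p q where pq: "l2seq p" "l2seq q" "\<And>j k. cmod (entry A j k) \<le> p j * q k"
    using trace_class_dominated[OF tA] by metis
  have "fredholm_det (1 + A) = fdet (entry A)"
    by (intro fredholm_det_eq_fdet[of A p q] l2seq_mult l2seq_nonneg pq)
  also have "\<dots> = (\<Sum>i\<in>set_encode ` Pow {..<N}. pminor (entry A) (set_decode i))"
    unfolding fdet_def
  proof (rule suminf_finite)
    fix i assume i: "i \<notin> set_encode ` Pow {..<N}"
    then have "\<not> set_decode i \<subseteq> {..<N}" by (metis PowI imageI set_decode_inverse)
    then obtain j where j: "j \<in> set_decode i" "\<not> j < N" by auto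
    show "pminor (entry A) (set_decode i) = 0"
      unfolding pminor_def
    proof (rule sum.neutral, rule ballI)
      fix \<pi>
      have "(\<Prod>j\<in>set_decode i. entry A j (\<pi> j)) = 0" using j by (intro prod_zero) (auto simp: eA)
      then show "of_int (sign \<pi>) * (\<Prod>j\<in>set_decode i. entry A j (\<pi> j)) = 0" by simp
    qed
  qed simp
  also have "\<dots> = (\<Sum>J\<in>Pow {..<N}. pminor (entry A) J)"
    by (subst sum.reindex) (auto intro!: inj_on_inverseI[where g = set_decode] sum.cong simp: finite_subset)
  also have "\<dots> = idet N (entry A)" by (simp add: idet_eq_sum_pminor)
  also have "\<dots> = section_det N X"
    unfolding idet_def section_det_def
    by (intro arg_cong[of _ _ Determinant.det] eq_matI) (auto simp: eA entry_simps)
  also have "1 + A = op_P N * X * op_P N + op_Q N"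
    by (simp add: A_def op_Q_def algebra_simps P_idem)
  finally show ?thesis ..
qed

lemma fredholm_det_1 [simp]: "fredholm_det 1 = 1"
proof -
  have "op_trace 0 = 0" using trace_sums(2)[of 0] by simp
  then show ?thesis using fredholm_det_approx[of 0] by simp
qed

text \<open>Moving \<open>B\<close> to the other side turns \<open>A = A * B\<close> into
  \<open>B * A = 0\<close>. In the application \<open>B\<close> is the projection on the source side
  of a triangular block.\<close>

lemma fredholm_det_one_plus_nilpotent:
  assumes "trace_class A" "A * B = A" "B * A = 0"
  shows "fredholm_det (1 + A) = 1"
  using fredholm_det_one_plus_swap[OF assms(1), of B] assms by simp

text \<open>Jacobi's identity for complementary minors. With \<open>P\<close> and \<open>Q\<close> the complementary projections,
  \<open>X (P + Y Q) = X P + Q\<close>, and both factors differ from their compressions \<open>P + Q Y Q\<close> and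
  \<open>P X P + Q\<close> by unipotent triangular factors of determinant 1.\<close>

theorem section_det_eq_complementary:
  assumes X: "trace_class (X - 1)" and XY: "X * Y = 1" "Y * X = 1"
  shows "trace_class (op_Q N * (Y - 1) * op_Q N)"
    "section_det N X = fredholm_det X * fredholm_det (1 + op_Q N * (Y - 1) * op_Q N)"
proof -
  define P Q where "P = op_P N" and "Q = op_Q N"
  have Q: "Q = 1 - P" by (simp add: P_def Q_def op_Q_def)
  have PP: "P * P = P" by (simp add: P_def P_idem)
  have r: "P * P = P" "Q * Q = Q" "P * Q = 0" "Q * P = 0"
    by (simp_all add: Q algebra_simps PP)
  have r': "P * (P * A) = P * A" "Q * (Q * A) = Q * A" "P * (Q * A) = 0" "Q * (P * A) = 0" for A
    unfolding mult.assoc[symmetric] r by simp_all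
  have PQ1: "P + Q = 1" by (simp add: Q)
  have "Y - 1 = - (Y * (X - 1))" using XY by (simp add: algebra_simps)
  then have Y: "trace_class (Y - 1)" using trace_class_uminus(1)[OF trace_class_mult_left(1)[OF X]] by simp
  have tcQ: "trace_class (Q * (Y - 1) * Q)" by (intro trace_class_mult_left trace_class_mult_right Y)
  then show "trace_class (op_Q N * (Y - 1) * op_Q N)" by (simp add: Q_def)
  have P: "trace_class P" unfolding P_def by (rule trace_class_finite_rank[OF rank_le_P])
  define Z W where "Z = Q * X * P" and "W = P * Y * Q"
  have tcZ: "trace_class Z" "trace_class W"
    unfolding Z_def W_def by (intro trace_class_mult_left P trace_class_mult_right)+
  have Z: "fredholm_det (1 + Z) = 1"
    by (rule fredholm_det_one_plus_nilpotent[OF tcZ(1), of P]) (simp_all add: Z_def mult.assoc r r')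
  have W: "fredholm_det (1 + W) = 1"
    by (rule fredholm_det_one_plus_nilpotent[OF tcZ(2), of Q]) (simp_all add: W_def mult.assoc r r')
  have split: "A = P * A + Q * A" for A using PQ1 by (metis distrib_right mult_1_left)
  \<comment> \<open>Right multiplication by \<open>1 + Z\<close> restores the lower-left block Q X P
    that the compression drops.\<close>
  have e1: "X * P + Q = (P * X * P + Q) * (1 + Z)"
    using split[of "X * P"] by (simp add: Z_def algebra_simps r r')
  have e2: "P + Y * Q = (P + Q * Y * Q) * (1 + W)"
    using split[of "Y * Q"] by (simp add: W_def algebra_simps r r')
  have e3: "1 + Q * (Y - 1) * Q = P + Q * Y * Q"
    using PQ1 by (simp add: algebra_simps r)
  have "P * X * P + Q - 1 = P * (X * P) - P" using PQ1 by (simp add: algebra_simps)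
  then have tc1: "trace_class (P * X * P + Q - 1)"
    using P by (simp add: trace_class_diff trace_class_mult_right)
  have tc2: "trace_class (P + Q * Y * Q - 1)" using tcQ by (simp add: e3[symmetric])
  have tcZ': "trace_class (1 + Z - 1)" "trace_class (1 + W - 1)" using tcZ by simp_all
  have "fredholm_det (X * P + Q) = fredholm_det (P * X * P + Q)"
    unfolding e1 fredholm_det_mult(2)[OF tc1 tcZ'(1)] Z by simp
  moreover have "fredholm_det (P + Y * Q) = fredholm_det (1 + Q * (Y - 1) * Q)"
    unfolding e2 fredholm_det_mult(2)[OF tc2 tcZ'(2)] W e3 by simp
  moreover have "fredholm_det (X * P + Q) = fredholm_det X * fredholm_det (P + Y * Q)"
  proof -
    have "X * P + Q = X * (P + Y * Q)" using XY by (simp add: distrib_left mult.assoc[symmetric])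
    moreover have "trace_class (P + Y * Q - 1)"
      unfolding e2 by (rule fredholm_det_mult(1)[OF tc2 tcZ'(2)])
    ultimately show ?thesis using fredholm_det_mult(2)[OF X] by simp
  qed
  ultimately show "section_det N X = fredholm_det X * fredholm_det (1 + op_Q N * (Y - 1) * op_Q N)"
    unfolding section_det_eq_fredholm_det P_def Q_def by simp
qed

section \<open>Determinants of commutators and of products of powers\<close>

lemma power_mult_inverse: "a * b = 1 \<Longrightarrow> a ^ m * b ^ m = (1 :: ell2_op)"
  by (rule left_right_inverse_power)

text \<open>The multiplicative commutator is multiplicative in each argument up to conjugation.\<close>

lemma det_commutator_power_left:
  assumes a: "a * a' = 1" "a' * a = 1" and b: "b * b' = 1" "b' * b = 1"
    and tc: "trace_class (a' * b' * a * b - 1)"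
  shows "trace_class (a' ^ m * b' * a ^ m * b - 1) \<and>
    fredholm_det (a' ^ m * b' * a ^ m * b) = fredholm_det (a' * b' * a * b) ^ m"
proof (induction m)
  case 0
  show ?case by (simp add: b)
next
  case (Suc m)
  define X where "X = a' ^ m * b' * a ^ m * b"
  have "a' ^ Suc m * b' * a ^ Suc m * b = (a' * X * a) * (a' * b' * a * b)"
  proof -
    have "(a' * X * a) * (a' * b' * a * b) = a' * X * (a * a') * b' * a * b" by (simp add: mult.assoc)
    also have "\<dots> = a' * a' ^ m * b' * a ^ m * (b * b') * a * b" by (simp add: a X_def mult.assoc)
    also have "\<dots> = a' ^ Suc m * b' * a ^ Suc m * b" by (simp add: b mult.assoc power_commutes)
    finally show ?thesis ..
  qed
  moreover have X: "trace_class (X - 1)" "fredholm_det X = fredholm_det (a' * b' * a * b) ^ m"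
    using Suc.IH by (simp_all add: X_def)
  ultimately show ?case
    using fredholm_det_mult[OF fredholm_det_conj(1)[OF X(1) a(2,1)] tc] fredholm_det_conj(2)[OF X(1) a(2,1)] X(2)
    by (simp add: mult.commute)
qed

lemma det_commutator_power_right:
  assumes a: "a * a' = 1" "a' * a = 1" and b: "b * b' = 1" "b' * b = 1"
    and tc: "trace_class (a' * b' * a * b - 1)"
  shows "trace_class (a' * b' ^ m * a * b ^ m - 1) \<and>
    fredholm_det (a' * b' ^ m * a * b ^ m) = fredholm_det (a' * b' * a * b) ^ m"
proof (induction m)
  case 0
  show ?case by (simp add: a)
next
  case (Suc m)
  define X where "X = a' * b' ^ m * a * b ^ m"
  have "a' * b' ^ Suc m * a * b ^ Suc m = (a' * b' * a * b) * (b' * X * b)"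
  proof -
    have "(a' * b' * a * b) * (b' * X * b) = a' * b' * a * (b * b') * X * b" by (simp add: mult.assoc)
    also have "\<dots> = a' * b' * (a * a') * b' ^ m * a * b ^ m * b" by (simp add: b X_def mult.assoc)
    also have "\<dots> = a' * b' ^ Suc m * a * b ^ Suc m" by (simp add: a mult.assoc power_commutes)
    finally show ?thesis ..
  qed
  moreover have X: "trace_class (X - 1)" "fredholm_det X = fredholm_det (a' * b' * a * b) ^ m"
    using Suc.IH by (simp_all add: X_def)
  ultimately show ?case
    using fredholm_det_mult[OF tc fredholm_det_conj(1)[OF X(1) b(2,1)]] fredholm_det_conj(2)[OF X(1) b(2,1)] X(2)
    by simp
qed

text \<open>One exponent \<open>m\<close> comes from each argument. The resulting
  \<open>m * m\<close> matches the size 1/m^2 of a commutator of group elements at parameter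
  1/m.\<close>

lemma det_commutator_power:
  assumes a: "a * a' = 1" "a' * a = 1" and b: "b * b' = 1" "b' * b = 1"
    and tc: "trace_class (a' * b' * a * b - 1)"
  shows "fredholm_det (a' ^ m * b' ^ m * a ^ m * b ^ m) = fredholm_det (a' * b' * a * b) ^ (m * m)"
proof -
  have 1: "trace_class (a' ^ m * b' * a ^ m * b - 1)"
    "fredholm_det (a' ^ m * b' * a ^ m * b) = fredholm_det (a' * b' * a * b) ^ m"
    using det_commutator_power_left[OF assms] by simp_all
  have "fredholm_det (a' ^ m * b' ^ m * a ^ m * b ^ m) = fredholm_det (a' ^ m * b' * a ^ m * b) ^ m"
    using det_commutator_power_right[OF power_mult_inverse[OF a(1)] power_mult_inverse[OF a(2)] b 1(1)] by simp
  then show ?thesis by (simp add: 1(2) power_mult)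
qed

text \<open>For commuting factors the left product would be the \<open>m\<close>-th power of
  \<open>p' * q' * r\<close>. Passing from i to i + 1 costs a commutator of \<open>p\<close> with
  \<open>r ^ i\<close>, whose determinant is the i-th power of the basic one; hence the exponent 0 +
  1 + ... + (m-1).\<close>

lemma det_power_product:
  assumes p: "p * p' = 1" "p' * p = 1" and r: "r * r' = 1" "r' * r = 1"
    and tc: "trace_class (p' * q' * r - 1)" and tc': "trace_class (p' * r' * p * r - 1)"
  shows "trace_class (p' ^ m * q' ^ m * r ^ m - 1) \<and>
    fredholm_det (p' ^ m * q' ^ m * r ^ m) =
      fredholm_det (p' * q' * r) ^ m * fredholm_det (p' * r' * p * r) ^ (\<Sum>i<m. i)"
proof (induction m)
  case (Suc m)
  define G K where "G = p' ^ m * q' ^ m * r ^ m" and "K = p' * r' ^ m * p * r ^ m"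
  have rm: "r ^ m * r' ^ m = 1" "r' ^ m * r ^ m = 1" using power_mult_inverse[of r r' m] power_mult_inverse[of r' r m] r by auto
  have K: "trace_class (K - 1)" "fredholm_det K = fredholm_det (p' * r' * p * r) ^ m"
    using det_commutator_power_right[OF p r tc'] by (simp_all add: K_def)
  have G: "trace_class (G - 1)"
    "fredholm_det G = fredholm_det (p' * q' * r) ^ m * fredholm_det (p' * r' * p * r) ^ (\<Sum>i<m. i)"
    using Suc.IH by (simp_all add: G_def)
  \<comment> \<open>The three factors are a conjugate of the product for \<open>m\<close>, the
    commutator \<open>K\<close>, and a conjugate of the basic product; conjugation preserves
    determinants.\<close>
  have "p' ^ Suc m * q' ^ Suc m * r ^ Suc m = (p' * G * p) * K * (r' ^ m * (p' * q' * r) * r ^ m)"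
  proof -
    have "(p' * G * p) * K * (r' ^ m * (p' * q' * r) * r ^ m)
      = p' * G * (p * p') * r' ^ m * p * (r ^ m * r' ^ m) * p' * q' * r * r ^ m"
      by (simp add: K_def mult.assoc)
    also have "\<dots> = p' * G * r' ^ m * (p * p') * q' * r * r ^ m" by (simp add: p rm mult.assoc)
    also have "\<dots> = p' * p' ^ m * q' ^ m * (r ^ m * r' ^ m) * q' * r * r ^ m" by (simp add: p G_def mult.assoc)
    also have "\<dots> = p' ^ Suc m * q' ^ Suc m * r ^ Suc m" by (simp add: rm mult.assoc power_commutes)
    finally show ?thesis ..
  qed
  moreover note 1 = fredholm_det_mult[OF fredholm_det_conj(1)[OF G(1) p(2,1)] K(1)]
  moreover note 2 = fredholm_det_mult[OF 1(1) fredholm_det_conj(1)[OF tc rm(2,1)]]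
  ultimately show ?case
    using fredholm_det_conj(2)[OF G(1) p(2,1)] fredholm_det_conj(2)[OF tc rm(2,1)] K(2) G(2)
    by (simp add: power_add mult_ac)
qed simp

section \<open>Convergence in trace norm\<close>

definition tends_tc :: "(nat \<Rightarrow> ell2_op) \<Rightarrow> ell2_op \<Rightarrow> bool"
  where "tends_tc X L \<longleftrightarrow> (\<forall>n. trace_class (X n)) \<and> trace_class L \<and> (\<lambda>n. trace_norm (X n - L)) \<longlonglongrightarrow> 0"

lemma trace_norm_le_imp_tendsto:
  assumes "\<And>n. trace_class (X n)" "\<And>n. trace_norm (X n) \<le> f n" "f \<longlonglongrightarrow> 0"
  shows "(\<lambda>n. trace_norm (X n)) \<longlonglongrightarrow> 0"
  by (rule Lim_null_comparison[OF always_eventually assms(3)]) (use assms trace_norm_nonneg in auto)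

lemma tends_tc_add:
  assumes "tends_tc X L" "tends_tc Y K"
  shows "tends_tc (\<lambda>n. X n + Y n) (L + K)"
proof -
  have tc: "trace_class (X n)" "trace_class (Y n)" "trace_class L" "trace_class K" for n
    using assms by (simp_all add: tends_tc_def)
  have "(\<lambda>n. trace_norm ((X n - L) + (Y n - K))) \<longlonglongrightarrow> 0"
  proof (rule trace_norm_le_imp_tendsto)
    show "trace_norm ((X n - L) + (Y n - K)) \<le> 2 * (trace_norm (X n - L) + trace_norm (Y n - K))" for n
      by (intro trace_class_add trace_class_diff tc)
    have "(\<lambda>n. 2 * (trace_norm (X n - L) + trace_norm (Y n - K))) \<longlonglongrightarrow> 2 * (0 + 0)"
      using assms unfolding tends_tc_def by (intro tendsto_intros) auto
    then show "(\<lambda>n. 2 * (trace_norm (X n - L) + trace_norm (Y n - K))) \<longlonglongrightarrow> 0" by simp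
  qed (intro trace_class_add trace_class_diff tc)
  then show ?thesis using tc by (simp add: tends_tc_def trace_class_add add_diff_add)
qed

lemma tends_tc_mult_left:
  assumes "B \<longlonglongrightarrow> B0" "tends_tc X L"
  shows "tends_tc (\<lambda>n. B n * X n) (B0 * L)"
proof -
  have tc: "trace_class (X n)" "trace_class L" for n using assms by (simp_all add: tends_tc_def)
  have eq: "B n * X n - B0 * L = B n * (X n - L) + (B n - B0) * L" for n by (simp add: algebra_simps)
  have "(\<lambda>n. trace_norm (B n * (X n - L) + (B n - B0) * L)) \<longlonglongrightarrow> 0"
  proof (rule trace_norm_le_imp_tendsto)
    show "trace_norm (B n * (X n - L) + (B n - B0) * L)
      \<le> 2 * (norm (B n) * trace_norm (X n - L) + norm (B n - B0) * trace_norm L)" for n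
      by (rule order.trans[OF trace_class_add(2)])
        (use tc in \<open>auto intro!: add_mono trace_class_mult_left trace_class_diff\<close>)
    have "(\<lambda>n. 2 * (norm (B n) * trace_norm (X n - L) + norm (B n - B0) * trace_norm L))
      \<longlonglongrightarrow> 2 * (norm B0 * 0 + norm (B0 - B0) * trace_norm L)"
      using assms unfolding tends_tc_def by (intro tendsto_intros) auto
    then show "(\<lambda>n. 2 * (norm (B n) * trace_norm (X n - L) + norm (B n - B0) * trace_norm L)) \<longlonglongrightarrow> 0" by simp
  qed (intro trace_class_add trace_class_mult_left trace_class_diff tc)
  then show ?thesis using tc by (simp add: tends_tc_def trace_class_mult_left eq)
qed

lemma tends_tc_mult_right:
  assumes "B \<longlonglongrightarrow> B0" "tends_tc X L"
  shows "tends_tc (\<lambda>n. X n * B n) (L * B0)"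
proof -
  have tc: "trace_class (X n)" "trace_class L" for n using assms by (simp_all add: tends_tc_def)
  have eq: "X n * B n - L * B0 = (X n - L) * B n + L * (B n - B0)" for n by (simp add: algebra_simps)
  have "(\<lambda>n. trace_norm ((X n - L) * B n + L * (B n - B0))) \<longlonglongrightarrow> 0"
  proof (rule trace_norm_le_imp_tendsto)
    show "trace_norm ((X n - L) * B n + L * (B n - B0))
      \<le> 2 * (norm (B n) * trace_norm (X n - L) + norm (B n - B0) * trace_norm L)" for n
      by (rule order.trans[OF trace_class_add(2)])
        (use tc in \<open>auto intro!: add_mono trace_class_mult_right trace_class_diff\<close>)
    have "(\<lambda>n. 2 * (norm (B n) * trace_norm (X n - L) + norm (B n - B0) * trace_norm L))
      \<longlonglongrightarrow> 2 * (norm B0 * 0 + norm (B0 - B0) * trace_norm L)"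
      using assms unfolding tends_tc_def by (intro tendsto_intros) auto
    then show "(\<lambda>n. 2 * (norm (B n) * trace_norm (X n - L) + norm (B n - B0) * trace_norm L)) \<longlonglongrightarrow> 0" by simp
  qed (intro trace_class_add trace_class_mult_right trace_class_diff tc)
  then show ?thesis using tc by (simp add: tends_tc_def trace_class_mult_right eq)
qed

lemma tends_tc_uminus: "tends_tc X L \<Longrightarrow> tends_tc (\<lambda>n. - X n) (- L)"
  using tends_tc_mult_left[OF tendsto_const[of "- 1"], of X L] by simp

lemma tends_tc_diff: "tends_tc X L \<Longrightarrow> tends_tc Y K \<Longrightarrow> tends_tc (\<lambda>n. X n - Y n) (L - K)"
  using tends_tc_add[OF _ tends_tc_uminus, of X L Y K] by simp

lemma op_trace_tendsto:
  assumes "tends_tc X L"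
  shows "(\<lambda>n. op_trace (X n)) \<longlonglongrightarrow> op_trace L"
proof -
  have tc: "trace_class (X n)" "trace_class L" for n using assms by (simp_all add: tends_tc_def)
  have "(\<lambda>n. op_trace (X n) - op_trace L) \<longlonglongrightarrow> 0"
  proof (rule Lim_null_comparison[OF always_eventually])
    show "\<forall>n. norm (op_trace (X n) - op_trace L) \<le> 64 * trace_norm (X n - L)"
      using trace_sums(2)[OF trace_class_diff(1)[OF tc]] by (simp add: op_trace_diff tc)
    show "(\<lambda>n. 64 * trace_norm (X n - L)) \<longlonglongrightarrow> 0"
      using assms tendsto_mult_right_zero by (auto simp: tends_tc_def)
  qed
  then show ?thesis by (simp add: LIM_zero_iff)
qed

text \<open>z^m = exp (m Ln z) for z near 1, and Ln z / (z - 1) tends to 1. The function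
  \<open>\<phi>\<close> is this quotient with the removable singularity filled, so that z = 1 needs
  no case distinction.\<close>

lemma tendsto_power_exp:
  fixes z :: "nat \<Rightarrow> complex"
  assumes "z \<longlonglongrightarrow> 1" and lim: "(\<lambda>n. of_nat (m n) * (z n - 1)) \<longlonglongrightarrow> w"
  shows "(\<lambda>n. z n ^ m n) \<longlonglongrightarrow> exp w"
proof -
  define \<phi> where "\<phi> u = (if u = 0 then 1 else Ln (1 + u) / u)" for u :: complex
  have "(Ln has_field_derivative inverse 1) (at 1)" by (rule has_field_derivative_Ln) simp
  then have "((\<lambda>h. (Ln (1 + h) - Ln 1) / h) \<longlongrightarrow> 1) (at 0)" unfolding DERIV_def by simp
  then have "(\<phi> \<longlongrightarrow> 1) (at 0)"
    by (rule Lim_transform_eventually) (auto simp: \<phi>_def eventually_at_filter)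
  then have "isCont \<phi> 0" by (simp add: isCont_def \<phi>_def)
  moreover have "(\<lambda>n. z n - 1) \<longlonglongrightarrow> 0" using assms(1) by (simp add: LIM_zero_iff)
  ultimately have "(\<lambda>n. \<phi> (z n - 1)) \<longlonglongrightarrow> \<phi> 0" by (rule isCont_tendsto_compose)
  then have "(\<lambda>n. of_nat (m n) * (z n - 1) * \<phi> (z n - 1)) \<longlonglongrightarrow> w * 1"
    by (intro tendsto_mult lim) (simp add: \<phi>_def)
  then have e: "(\<lambda>n. exp (of_nat (m n) * (z n - 1) * \<phi> (z n - 1))) \<longlonglongrightarrow> exp w"
    by (intro tendsto_exp) simp
  have "\<forall>\<^sub>F n in sequentially. z n \<in> - {0}"
    using topological_tendstoD[OF assms(1), of "- {0}"] by auto
  then have "\<forall>\<^sub>F n in sequentially. exp (of_nat (m n) * (z n - 1) * \<phi> (z n - 1)) = z n ^ m n"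
  proof eventually_elim
    case (elim n)
    have "(z n - 1) * \<phi> (z n - 1) = Ln (z n)" by (simp add: \<phi>_def)
    then have "exp (of_nat (m n) * (z n - 1) * \<phi> (z n - 1)) = exp (of_nat (m n) * Ln (z n))" by (simp add: mult.assoc)
    also have "\<dots> = exp (Ln (z n)) ^ m n" by (simp add: exp_of_nat_mult)
    finally show ?case using elim by simp
  qed
  then show ?thesis by (rule Lim_transform_eventually[OF e])
qed

text \<open>With \<open>A n\<close> of size 1/s, the determinant is 1 + tr A + O(1/s^2). The power
  \<open>m\<close>, of order s, keeps the trace and suppresses the error.\<close>

lemma tendsto_fredholm_det_power:
  assumes conv: "tends_tc (\<lambda>n. complex_of_real (s n) *\<^sub>C A n) T"
    and s: "\<And>n. 0 < s n" "filterlim s at_top sequentially"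
    and m: "(\<lambda>n. real (m n) / s n) \<longlonglongrightarrow> c"
  shows "(\<lambda>n. fredholm_det (1 + A n) ^ m n) \<longlonglongrightarrow> exp (complex_of_real c * op_trace T)"
proof -
  define B where "B n = complex_of_real (s n) *\<^sub>C A n" for n
  have tcB: "trace_class (B n)" "trace_class T" for n using conv by (simp_all add: tends_tc_def B_def)
  have AB: "A n = complex_of_real (1 / s n) *\<^sub>C B n" for n
    using s(1)[of n] by (simp add: B_def op_algebra_scaleC)
  have tcA: "trace_class (A n)" for n unfolding AB by (intro trace_class_scaleC tcB)
  \<comment> \<open>A bounded majorant of the trace norm of \<open>B n\<close>; its factor 2 is that
    of \<open>trace_class_add\<close>.\<close>
  define \<tau> where "\<tau> n = 2 * (trace_norm (B n - T) + trace_norm T)" for n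
  have "\<tau> \<longlonglongrightarrow> 2 * (0 + trace_norm T)"
    using conv unfolding tends_tc_def \<tau>_def B_def by (intro tendsto_intros) auto
  then have \<tau>: "\<tau> \<longlonglongrightarrow> 2 * trace_norm T" by simp
  have tn: "trace_norm (A n) \<le> \<tau> n / s n" for n
  proof -
    have "trace_norm (A n) \<le> cmod (complex_of_real (1 / s n)) * trace_norm (B n)"
      unfolding AB by (rule trace_class_scaleC[OF tcB(1)])
    also have "trace_norm (B n) \<le> \<tau> n"
      using trace_class_add(2)[OF trace_class_diff(1)[OF tcB] tcB(2), of n] by (simp add: \<tau>_def)
    finally show ?thesis using s(1)[of n] by (simp add: norm_divide divide_right_mono)
  qed
  have inv: "(\<lambda>n. 1 / s n) \<longlonglongrightarrow> 0"
    using tendsto_inverse_0_at_top[OF s(2)] by (simp add: inverse_eq_divide)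
  define r where "r n = fredholm_det (1 + A n) - 1 - op_trace (A n)" for n
  have "\<forall>\<^sub>F n in sequentially. norm (of_real (s n) * r n) \<le> s n * (2 * (64 * (\<tau> n / s n))\<^sup>2)"
  proof -
    have "(\<lambda>n. 64 * (\<tau> n * (1 / s n))) \<longlonglongrightarrow> 64 * (2 * trace_norm T * 0)"
      by (intro tendsto_intros \<tau> inv)
    then have "\<forall>\<^sub>F n in sequentially. 64 * (\<tau> n * (1 / s n)) < 1 / 2"
      by (intro order_tendstoD(2)) auto
    then show ?thesis
    proof eventually_elim
      case (elim n)
      have "64 * trace_norm (A n) \<le> 1 / 2" using elim tn[of n] by simp
      then have "norm (r n) \<le> 2 * (64 * trace_norm (A n))\<^sup>2"
        unfolding r_def by (rule fredholm_det_approx[OF tcA])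
      also have "\<dots> \<le> 2 * (64 * (\<tau> n / s n))\<^sup>2"
        by (intro mult_left_mono power_mono tn mult_nonneg_nonneg trace_norm_nonneg[OF tcA]) auto
      finally show ?case using s(1)[of n] by (simp add: norm_mult mult_left_mono)
    qed
  qed
  moreover have "(\<lambda>n. s n * (2 * (64 * (\<tau> n / s n))\<^sup>2)) \<longlonglongrightarrow> 0"
  proof -
    \<comment> \<open>8192 is 2 * 64^2.\<close>
    have "s n * (2 * (64 * (\<tau> n / s n))\<^sup>2) = 8192 * (\<tau> n)\<^sup>2 * (1 / s n)" for n
      using s(1)[of n] by (simp add: power2_eq_square field_simps)
    moreover have "(\<lambda>n. 8192 * (\<tau> n)\<^sup>2 * (1 / s n)) \<longlonglongrightarrow> 8192 * (2 * trace_norm T)\<^sup>2 * 0"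
      by (intro tendsto_intros \<tau> inv)
    ultimately show ?thesis by simp
  qed
  ultimately have R: "(\<lambda>n. of_real (s n) * r n) \<longlonglongrightarrow> 0" by (rule Lim_null_comparison)
  have tr: "(\<lambda>n. of_real (s n) * op_trace (A n)) \<longlonglongrightarrow> op_trace T"
    using op_trace_tendsto[OF conv] by (simp add: op_trace_scaleC[OF tcA])
  have S: "(\<lambda>n. of_real (s n) * (fredholm_det (1 + A n) - 1)) \<longlonglongrightarrow> op_trace T"
    using tendsto_add[OF R tr] by (simp add: r_def algebra_simps)
  show ?thesis
  proof (rule tendsto_power_exp)
    have "(\<lambda>n. of_real (real (m n) / s n) * (of_real (s n) * (fredholm_det (1 + A n) - 1)))
      \<longlonglongrightarrow> of_real c * op_trace T"
      by (intro tendsto_mult tendsto_of_real m S)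
    moreover have "of_real (real (m n) / s n) * (of_real (s n) * (fredholm_det (1 + A n) - 1))
      = of_nat (m n) * (fredholm_det (1 + A n) - 1)" for n
      using s(1)[of n] by (simp add: field_simps)
    ultimately show "(\<lambda>n. of_nat (m n) * (fredholm_det (1 + A n) - 1)) \<longlonglongrightarrow> of_real c * op_trace T" by simp
    have "(\<lambda>n. of_real (1 / s n) * (of_real (s n) * (fredholm_det (1 + A n) - 1))) \<longlonglongrightarrow> of_real 0 * op_trace T"
      by (intro tendsto_mult tendsto_of_real inv S)
    moreover have "of_real (1 / s n) * (of_real (s n) * (fredholm_det (1 + A n) - 1)) = fredholm_det (1 + A n) - 1" for n
      using s(1)[of n] by simp
    ultimately show "(\<lambda>n. fredholm_det (1 + A n)) \<longlonglongrightarrow> 1" by (simp add: LIM_zero_iff)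
  qed
qed

section \<open>Fourier coefficients of bounded functions\<close>

abbreviation circle_measure :: "real measure"
  where "circle_measure \<equiv> lebesgue_on {-pi..pi}"

lemma finite_circle_measure: "finite_measure circle_measure"
proof (rule finite_measureI)
  have "emeasure circle_measure (space circle_measure) = emeasure lborel {-pi..pi}"
    by (simp add: space_restrict_space emeasure_restrict_space)
  then show "emeasure circle_measure (space circle_measure) \<noteq> \<infinity>" by simp
qed

interpretation circle: finite_measure circle_measure
  by (rule finite_circle_measure)

lemma measure_circle: "measure circle_measure (space circle_measure) = 2 * pi"
  by (simp add: space_restrict_space measure_restrict_space)

lemma continuous_circle_measurable:
  fixes f :: "real \<Rightarrow> 'a::euclidean_space"
  assumes "continuous_on UNIV f"
  shows "f \<in> borel_measurable circle_measure"
  by (rule continuous_imp_measurable_on_sets_lebesgue) (auto intro: continuous_on_subset[OF assms])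

definition ess_bdd :: "(real \<Rightarrow> complex) \<Rightarrow> real \<Rightarrow> bool"
  where "ess_bdd f C \<longleftrightarrow> f \<in> borel_measurable circle_measure \<and> 0 \<le> C \<and> (AE \<theta> in circle_measure. cmod (f \<theta>) \<le> C)"

definition mean :: "(real \<Rightarrow> complex) \<Rightarrow> complex"
  where "mean f = complex_of_real (1 / (2 * pi)) * (LINT \<theta>|circle_measure. f \<theta>)"

lemma ess_bdd_integrable: "ess_bdd f C \<Longrightarrow> integrable circle_measure f"
  unfolding ess_bdd_def by (rule circle.integrable_const_bound[of _ C]) auto

lemma ess_bdd_add: "ess_bdd f C \<Longrightarrow> ess_bdd g D \<Longrightarrow> ess_bdd (\<lambda>\<theta>. f \<theta> + g \<theta>) (C + D)"
proof -
  assume 1: "ess_bdd f C" "ess_bdd g D"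
  then have "AE \<theta> in circle_measure. cmod (f \<theta>) \<le> C" "AE \<theta> in circle_measure. cmod (g \<theta>) \<le> D"
    by (simp_all add: ess_bdd_def)
  then have "AE \<theta> in circle_measure. cmod (f \<theta> + g \<theta>) \<le> C + D"
    by eventually_elim (rule norm_triangle_mono)
  then show ?thesis using 1 by (auto simp: ess_bdd_def)
qed

lemma ess_bdd_mult: "ess_bdd f C \<Longrightarrow> ess_bdd g D \<Longrightarrow> ess_bdd (\<lambda>\<theta>. f \<theta> * g \<theta>) (C * D)"
proof -
  assume 1: "ess_bdd f C" "ess_bdd g D"
  then have "AE \<theta> in circle_measure. cmod (f \<theta>) \<le> C" "AE \<theta> in circle_measure. cmod (g \<theta>) \<le> D"
    by (simp_all add: ess_bdd_def)
  then have "AE \<theta> in circle_measure. cmod (f \<theta> * g \<theta>) \<le> C * D"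
    by eventually_elim (use 1 in \<open>simp add: norm_mult mult_mono ess_bdd_def\<close>)
  then show ?thesis using 1 by (auto simp: ess_bdd_def)
qed

lemma ess_bdd_cis: "ess_bdd (\<lambda>\<theta>. cis (of_int n * \<theta>)) 1"
  unfolding ess_bdd_def by (auto intro!: continuous_circle_measurable continuous_intros)

lemma ess_bdd_const: "ess_bdd (\<lambda>\<theta>. c) (cmod c)"
  unfolding ess_bdd_def by auto

lemma ess_bdd_cmult: "ess_bdd f C \<Longrightarrow> ess_bdd (\<lambda>\<theta>. c * f \<theta>) (cmod c * C)"
  by (rule ess_bdd_mult[OF ess_bdd_const])

lemma ess_bdd_cnj: "ess_bdd f C \<Longrightarrow> ess_bdd (\<lambda>\<theta>. cnj (f \<theta>)) C"
proof -
  have "cnj \<in> borel_measurable borel" by (intro borel_measurable_continuous_onI continuous_intros)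
  then show "ess_bdd f C \<Longrightarrow> ess_bdd (\<lambda>\<theta>. cnj (f \<theta>)) C"
    unfolding ess_bdd_def by (auto intro: measurable_compose[of f _ borel cnj])
qed

lemma ess_bdd_diff: "ess_bdd f C \<Longrightarrow> ess_bdd g D \<Longrightarrow> ess_bdd (\<lambda>\<theta>. f \<theta> - g \<theta>) (C + D)"
  using ess_bdd_add[OF _ ess_bdd_cmult[of g D "-1"], of f C] by simp

lemma mean_add: "ess_bdd f C \<Longrightarrow> ess_bdd g D \<Longrightarrow> mean (\<lambda>\<theta>. f \<theta> + g \<theta>) = mean f + mean g"
  by (simp add: mean_def ess_bdd_integrable Bochner_Integration.integral_add algebra_simps)

lemma mean_diff: "ess_bdd f C \<Longrightarrow> ess_bdd g D \<Longrightarrow> mean (\<lambda>\<theta>. f \<theta> - g \<theta>) = mean f - mean g"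
  by (simp add: mean_def ess_bdd_integrable Bochner_Integration.integral_diff algebra_simps)

lemma mean_cmult: "mean (\<lambda>\<theta>. c * f \<theta>) = c * mean f"
  by (simp add: mean_def)

lemma ess_bdd_sum: "(\<And>i. i \<in> I \<Longrightarrow> \<exists>C. ess_bdd (f i) C) \<Longrightarrow> \<exists>C. ess_bdd (\<lambda>\<theta>. \<Sum>i\<in>I. f i \<theta>) C"
proof (induction I rule: infinite_finite_induct)
  case (insert x I)
  then obtain C D where "ess_bdd (f x) C" "ess_bdd (\<lambda>\<theta>. \<Sum>i\<in>I. f i \<theta>) D" by blast
  then show ?case using ess_bdd_add insert.hyps by (auto intro!: exI[of _ "C + D"])
qed (auto intro!: exI[of _ "cmod 0"] ess_bdd_const[of 0, simplified])

lemma mean_sum: "(\<And>i. i \<in> I \<Longrightarrow> \<exists>C. ess_bdd (f i) C) \<Longrightarrow> mean (\<lambda>\<theta>. \<Sum>i\<in>I. f i \<theta>) = (\<Sum>i\<in>I. mean (f i))"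
proof (induction I rule: infinite_finite_induct)
  case (insert x I)
  obtain C where "ess_bdd (f x) C" using insert.prems by blast
  moreover obtain D where "ess_bdd (\<lambda>\<theta>. \<Sum>i\<in>I. f i \<theta>) D" using ess_bdd_sum[of I f] insert.prems by auto
  ultimately show ?case using insert by (simp add: mean_add)
qed (auto simp: mean_def)

section \<open>Quadratic means and Bessel's inequality\<close>

definition mean_sq :: "(real \<Rightarrow> complex) \<Rightarrow> real"
  where "mean_sq f = (LINT \<theta>|circle_measure. (cmod (f \<theta>))\<^sup>2) / (2 * pi)"

lemma mean_sq_nonneg: "0 \<le> mean_sq f"
  by (simp add: mean_sq_def)

lemma ess_bdd_sq_integrable:
  assumes "ess_bdd f C"
  shows "integrable circle_measure (\<lambda>\<theta>. (cmod (f \<theta>))\<^sup>2)"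
proof (rule circle.integrable_const_bound[of _ "C\<^sup>2"])
  show "AE \<theta> in circle_measure. norm ((cmod (f \<theta>))\<^sup>2) \<le> C\<^sup>2"
  proof -
    have "AE \<theta> in circle_measure. cmod (f \<theta>) \<le> C" using assms by (simp add: ess_bdd_def)
    then show ?thesis by eventually_elim (simp add: power_mono)
  qed
qed (use assms in \<open>auto simp: ess_bdd_def\<close>)

lemma of_real_mean_sq: "complex_of_real (mean_sq f) = mean (\<lambda>\<theta>. f \<theta> * cnj (f \<theta>))"
  unfolding mean_sq_def mean_def complex_norm_square[symmetric] by (simp del: of_real_power)

lemma mean_sq_le_AE:
  assumes "ess_bdd f C" "ess_bdd g D" "AE \<theta> in circle_measure. cmod (f \<theta>) \<le> c * cmod (g \<theta>)"
  shows "mean_sq f \<le> c\<^sup>2 * mean_sq g"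
proof -
  have "(LINT \<theta>|circle_measure. (cmod (f \<theta>))\<^sup>2) \<le> (LINT \<theta>|circle_measure. c\<^sup>2 * (cmod (g \<theta>))\<^sup>2)"
  proof (rule integral_mono_AE)
    show "AE \<theta> in circle_measure. (cmod (f \<theta>))\<^sup>2 \<le> c\<^sup>2 * (cmod (g \<theta>))\<^sup>2"
      using assms(3) by eventually_elim (simp add: power_mult_distrib[symmetric] power_mono)
  qed (use assms ess_bdd_sq_integrable in auto)
  then show ?thesis by (simp add: mean_sq_def divide_right_mono)
qed

text \<open>A weighted form of 2 x y <= x^2 + y^2. The parameter \<open>t\<close> lets one factor be
  made negligible first and the other afterwards, see \<open>fcoeff_mult_has_sum\<close>.\<close>

lemma cmod_mean_mult_le:
  assumes "ess_bdd f C" "ess_bdd g D" "0 < t"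
  shows "cmod (mean (\<lambda>\<theta>. f \<theta> * g \<theta>)) \<le> t\<^sup>2 * mean_sq f + mean_sq g / t\<^sup>2"
proof -
  have "cmod (LINT \<theta>|circle_measure. f \<theta> * g \<theta>) \<le> (LINT \<theta>|circle_measure. cmod (f \<theta> * g \<theta>))"
    by (rule integral_norm_bound)
  also have "\<dots> \<le> (LINT \<theta>|circle_measure. t\<^sup>2 * (cmod (f \<theta>))\<^sup>2 + (cmod (g \<theta>))\<^sup>2 / t\<^sup>2)"
  proof (rule integral_mono)
    fix \<theta>
    have "2 * (t * cmod (f \<theta>)) * (cmod (g \<theta>) / t) \<le> (t * cmod (f \<theta>))\<^sup>2 + (cmod (g \<theta>) / t)\<^sup>2"
      by (rule sum_squares_bound)
    moreover have "0 \<le> cmod (f \<theta>) * cmod (g \<theta>)" by simp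
    moreover have "2 * (t * cmod (f \<theta>)) * (cmod (g \<theta>) / t) = 2 * (cmod (f \<theta>) * cmod (g \<theta>))" using assms(3) by simp
    ultimately show "cmod (f \<theta> * g \<theta>) \<le> t\<^sup>2 * (cmod (f \<theta>))\<^sup>2 + (cmod (g \<theta>))\<^sup>2 / t\<^sup>2"
      unfolding norm_mult power_mult_distrib power_divide by linarith
  qed (use assms ess_bdd_sq_integrable ess_bdd_integrable[OF ess_bdd_mult] in \<open>auto intro!: integrable_norm\<close>)
  also have "\<dots> = t\<^sup>2 * (LINT \<theta>|circle_measure. (cmod (f \<theta>))\<^sup>2) + (LINT \<theta>|circle_measure. (cmod (g \<theta>))\<^sup>2) / t\<^sup>2"
    using assms ess_bdd_sq_integrable by (subst Bochner_Integration.integral_add) auto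
  finally have "cmod (LINT \<theta>|circle_measure. f \<theta> * g \<theta>) / (2 * pi)
    \<le> (t\<^sup>2 * (LINT \<theta>|circle_measure. (cmod (f \<theta>))\<^sup>2) + (LINT \<theta>|circle_measure. (cmod (g \<theta>))\<^sup>2) / t\<^sup>2) / (2 * pi)"
    by (rule divide_right_mono) simp
  then show ?thesis by (simp add: mean_def mean_sq_def norm_mult norm_divide add_divide_distrib mult.commute)
qed

lemma mean_const: "mean (\<lambda>\<theta>. c) = c"
proof -
  have "mean (\<lambda>\<theta>. c) = complex_of_real (1 / (2 * pi)) * ((2 * pi) *\<^sub>R c)"
    using measure_circle unfolding mean_def by simp
  then show ?thesis by (simp add: scaleR_conv_of_real)
qed

lemma mean_cis: "mean (\<lambda>\<theta>. cis (of_int k * \<theta>)) = (if k = 0 then 1 else 0)"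
proof (cases "k = 0")
  case True
  then show ?thesis
    by (simp add: mean_const)
next
  case False
  define F where "F \<theta> = cis (of_int k * \<theta>) / (\<i> * of_int k)" for \<theta> :: real
  have "(F has_vector_derivative cis (of_int k * \<theta>)) (at \<theta> within {-pi..pi})" for \<theta>
  proof -
    have "((\<lambda>\<theta>. exp (\<i> * of_real (of_int k * \<theta>)) / (\<i> * of_int k)) has_vector_derivative
      exp (\<i> * of_real (of_int k * \<theta>)) * (\<i> * of_int k) / (\<i> * of_int k)) (at \<theta> within {-pi..pi})"
    proof -
      have "((\<lambda>z. exp (\<i> * (of_int k * z)) / (\<i> * of_int k)) has_field_derivative
        exp (\<i> * (of_int k * of_real \<theta>)) * (\<i> * of_int k) / (\<i> * of_int k)) (at (of_real \<theta>))"
        by (auto intro!: derivative_eq_intros simp: False mult_ac)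
      from has_vector_derivative_real_field[OF this] show ?thesis by simp
    qed
    then show ?thesis using False by (simp add: F_def[abs_def] cis_conv_exp)
  qed
  then have "((\<lambda>\<theta>. cis (of_int k * \<theta>)) has_integral F pi - F (-pi)) {-pi..pi}"
    by (intro fundamental_theorem_of_calculus) auto
  moreover have "F pi = F (-pi)"
  proof -
    have "sin (real_of_int k * pi) = 0" by (simp add: sin_times_pi_eq_0)
    then have "cis (real_of_int k * pi) = cis (- (real_of_int k * pi))" by (simp add: complex_eq_iff)
    then show ?thesis by (simp add: F_def)
  qed
  ultimately have "integral {-pi..pi} (\<lambda>\<theta>. cis (of_int k * \<theta>)) = 0" by (simp add: integral_unique)
  then have "(LINT \<theta>|circle_measure. cis (of_int k * \<theta>)) = 0"
    by (subst lebesgue_integral_eq_integral[OF ess_bdd_integrable[OF ess_bdd_cis]]) auto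
  then show ?thesis by (simp add: mean_def False)
qed

definition fcoeff :: "(real \<Rightarrow> complex) \<Rightarrow> int \<Rightarrow> complex"
  where "fcoeff f n = mean (\<lambda>\<theta>. f \<theta> * cis (- (of_int n * \<theta>)))"

lemma ess_bdd_cis_minus: "ess_bdd (\<lambda>\<theta>. cis (- (of_int n * \<theta>))) 1"
  using ess_bdd_cis[of "- n"] by simp

lemma ess_bdd_fcoeff: "ess_bdd f C \<Longrightarrow> ess_bdd (\<lambda>\<theta>. f \<theta> * cis (- (of_int n * \<theta>))) C"
  using ess_bdd_mult[OF _ ess_bdd_cis_minus] by fastforce

lemma fcoeff_add: "ess_bdd f C \<Longrightarrow> ess_bdd g D \<Longrightarrow> fcoeff (\<lambda>\<theta>. f \<theta> + g \<theta>) n = fcoeff f n + fcoeff g n"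
  unfolding fcoeff_def by (simp add: distrib_right mean_add[OF ess_bdd_fcoeff ess_bdd_fcoeff])

lemma fcoeff_diff: "ess_bdd f C \<Longrightarrow> ess_bdd g D \<Longrightarrow> fcoeff (\<lambda>\<theta>. f \<theta> - g \<theta>) n = fcoeff f n - fcoeff g n"
  unfolding fcoeff_def by (simp add: left_diff_distrib mean_diff[OF ess_bdd_fcoeff ess_bdd_fcoeff])

lemma fcoeff_cmult: "fcoeff (\<lambda>\<theta>. c * f \<theta>) n = c * fcoeff f n"
  unfolding fcoeff_def by (simp add: mult.assoc mean_cmult)

lemma fcoeff_cis: "fcoeff (\<lambda>\<theta>. cis (of_int k * \<theta>)) n = (if k = n then 1 else 0)"
proof -
  have "cis (of_int k * \<theta>) * cis (- (of_int n * \<theta>)) = cis (of_int (k - n) * \<theta>)" for \<theta>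
    by (simp add: cis_mult algebra_simps)
  then show ?thesis unfolding fcoeff_def by (simp only: mean_cis) simp
qed

lemma fcoeff_cis_mult: "fcoeff (\<lambda>\<theta>. cis (of_int k * \<theta>) * g \<theta>) n = fcoeff g (n - k)"
proof -
  have "cis (of_int k * \<theta>) * g \<theta> * cis (- (of_int n * \<theta>)) = g \<theta> * (cis (of_int k * \<theta>) * cis (- (of_int n * \<theta>)))" for \<theta>
    by (simp add: mult_ac)
  moreover have "cis (of_int k * \<theta>) * cis (- (of_int n * \<theta>)) = cis (- (of_int (n - k) * \<theta>))" for \<theta>
    unfolding cis_mult by (simp add: algebra_simps)
  ultimately show ?thesis unfolding fcoeff_def by (simp only:)
qed

lemma mean_sq_trig:
  assumes "finite I" "inj_on \<phi> I"
  shows "mean_sq (\<lambda>\<theta>. \<Sum>k\<in>I. d k * cis (of_int (\<phi> k) * \<theta>)) = (\<Sum>k\<in>I. (cmod (d k))\<^sup>2)"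
proof -
  have "complex_of_real (mean_sq (\<lambda>\<theta>. \<Sum>k\<in>I. d k * cis (of_int (\<phi> k) * \<theta>)))
    = mean (\<lambda>\<theta>. \<Sum>k\<in>I. \<Sum>l\<in>I. (d k * cnj (d l)) * cis (of_int (\<phi> k - \<phi> l) * \<theta>))"
    unfolding of_real_mean_sq
  proof (rule arg_cong[of _ _ mean], rule ext)
    fix \<theta>
    have "cis (of_int (\<phi> k) * \<theta>) * cnj (cis (of_int (\<phi> l) * \<theta>)) = cis (of_int (\<phi> k - \<phi> l) * \<theta>)" for k l
      by (simp add: cis_cnj cis_mult algebra_simps)
    then have e: "d k * cis (of_int (\<phi> k) * \<theta>) * (cnj (d l) * cnj (cis (of_int (\<phi> l) * \<theta>)))
      = (d k * cnj (d l)) * cis (of_int (\<phi> k - \<phi> l) * \<theta>)" for k l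
      by (metis (no_types, lifting) mult.assoc mult.left_commute)
    show "(\<Sum>k\<in>I. d k * cis (of_int (\<phi> k) * \<theta>)) * cnj (\<Sum>k\<in>I. d k * cis (of_int (\<phi> k) * \<theta>))
      = (\<Sum>k\<in>I. \<Sum>l\<in>I. (d k * cnj (d l)) * cis (of_int (\<phi> k - \<phi> l) * \<theta>))"
      unfolding cnj_sum complex_cnj_mult sum_product e ..
  qed
  also have "\<dots> = (\<Sum>k\<in>I. \<Sum>l\<in>I. mean (\<lambda>\<theta>. (d k * cnj (d l)) * cis (of_int (\<phi> k - \<phi> l) * \<theta>)))"
  proof -
    have b: "\<exists>C. ess_bdd (\<lambda>\<theta>. (d k * cnj (d l)) * cis (of_int (\<phi> k - \<phi> l) * \<theta>)) C" for k l
      using ess_bdd_cmult[OF ess_bdd_cis] by blast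
    show ?thesis
      by (subst mean_sum[OF ess_bdd_sum[OF b]], intro sum.cong refl, rule mean_sum[OF b])
  qed
  also have "\<dots> = (\<Sum>k\<in>I. \<Sum>l\<in>I. if l = k then d k * cnj (d k) else 0)"
    unfolding mean_cmult mean_cis
    using assms(2) by (intro sum.cong refl) (auto dest: inj_onD)
  also have "\<dots> = (\<Sum>k\<in>I. complex_of_real ((cmod (d k))\<^sup>2))"
    using assms(1) by (simp add: complex_norm_square del: of_real_power)
  finally have "complex_of_real (mean_sq (\<lambda>\<theta>. \<Sum>k\<in>I. d k * cis (of_int (\<phi> k) * \<theta>)))
    = complex_of_real (\<Sum>k\<in>I. (cmod (d k))\<^sup>2)" by (simp only: of_real_sum)
  then show ?thesis by (simp only: of_real_eq_iff)
qed

lemma bessel: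
  assumes f: "ess_bdd f C" and F: "finite F"
  shows "(\<Sum>n\<in>F. (cmod (fcoeff f n))\<^sup>2) \<le> mean_sq f"
proof -
  define p where "p \<theta> = (\<Sum>n\<in>F. fcoeff f n * cis (of_int n * \<theta>))" for \<theta>
  have "\<exists>C. ess_bdd p C" unfolding p_def using ess_bdd_cmult[OF ess_bdd_cis] by (intro ess_bdd_sum) blast
  then obtain D where p: "ess_bdd p D" by blast
  define S where "S = (\<Sum>n\<in>F. (cmod (fcoeff f n))\<^sup>2)"
  have cr: "mean (\<lambda>\<theta>. f \<theta> * cnj (p \<theta>)) = of_real S"
  proof -
    have "f \<theta> * cnj (p \<theta>) = (\<Sum>n\<in>F. cnj (fcoeff f n) * (f \<theta> * cis (- (of_int n * \<theta>))))" for \<theta>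
      by (simp add: p_def sum_distrib_left cis_cnj mult_ac)
    then have "mean (\<lambda>\<theta>. f \<theta> * cnj (p \<theta>)) = mean (\<lambda>\<theta>. \<Sum>n\<in>F. cnj (fcoeff f n) * (f \<theta> * cis (- (of_int n * \<theta>))))"
      by simp
    also have "\<dots> = (\<Sum>n\<in>F. mean (\<lambda>\<theta>. cnj (fcoeff f n) * (f \<theta> * cis (- (of_int n * \<theta>)))))"
      using ess_bdd_cmult[OF ess_bdd_fcoeff[OF f]] by (intro mean_sum) blast
    also have "\<dots> = (\<Sum>n\<in>F. complex_of_real ((cmod (fcoeff f n))\<^sup>2))"
      unfolding mean_cmult fcoeff_def[symmetric] by (simp add: complex_norm_square mult.commute del: of_real_power)
    finally show ?thesis by (simp add: S_def)
  qed
  have cr': "mean (\<lambda>\<theta>. cnj (f \<theta>) * p \<theta>) = of_real S"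
  proof -
    have "mean (\<lambda>\<theta>. cnj (f \<theta> * cnj (p \<theta>))) = cnj (mean (\<lambda>\<theta>. f \<theta> * cnj (p \<theta>)))"
      unfolding mean_def
      using integral_bounded_linear[OF bounded_linear_cnj ess_bdd_integrable[OF ess_bdd_mult[OF f ess_bdd_cnj[OF p]]]] by simp
    then show ?thesis by (simp add: cr)
  qed
  have pp: "mean (\<lambda>\<theta>. p \<theta> * cnj (p \<theta>)) = of_real S"
    unfolding of_real_mean_sq[symmetric] p_def S_def
    using mean_sq_trig[OF F, of "\<lambda>n. n" "fcoeff f"] by simp
  have "complex_of_real (mean_sq (\<lambda>\<theta>. f \<theta> - p \<theta>))
    = mean (\<lambda>\<theta>. (f \<theta> * cnj (f \<theta>) - f \<theta> * cnj (p \<theta>)) - (cnj (f \<theta>) * p \<theta> - p \<theta> * cnj (p \<theta>)))"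
    unfolding of_real_mean_sq by (simp add: algebra_simps)
  also have "\<dots> = (mean (\<lambda>\<theta>. f \<theta> * cnj (f \<theta>)) - of_real S) - (of_real S - of_real S)"
    by (subst mean_diff[OF ess_bdd_diff[OF ess_bdd_mult[OF f ess_bdd_cnj[OF f]] ess_bdd_mult[OF f ess_bdd_cnj[OF p]]]
          ess_bdd_diff[OF ess_bdd_mult[OF ess_bdd_cnj[OF f] p] ess_bdd_mult[OF p ess_bdd_cnj[OF p]]]],
        subst mean_diff[OF ess_bdd_mult[OF f ess_bdd_cnj[OF f]] ess_bdd_mult[OF f ess_bdd_cnj[OF p]]],
        subst mean_diff[OF ess_bdd_mult[OF ess_bdd_cnj[OF f] p] ess_bdd_mult[OF p ess_bdd_cnj[OF p]]])
      (simp only: cr cr' pp)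
  also have "\<dots> = complex_of_real (mean_sq f - S)" by (simp add: of_real_mean_sq)
  finally have "mean_sq (\<lambda>\<theta>. f \<theta> - p \<theta>) = mean_sq f - S" by (simp only: of_real_eq_iff)
  then show ?thesis using mean_sq_nonneg[of "\<lambda>\<theta>. f \<theta> - p \<theta>"] by (simp add: S_def)
qed

section \<open>Trigonometric polynomials and their density\<close>

inductive_set trig :: "(real \<Rightarrow> complex) set" where
  trig_cis: "(\<lambda>\<theta>. cis (of_int n * \<theta>)) \<in> trig"
| trig_add: "f \<in> trig \<Longrightarrow> g \<in> trig \<Longrightarrow> (\<lambda>\<theta>. f \<theta> + g \<theta>) \<in> trig"
| trig_cmult: "f \<in> trig \<Longrightarrow> (\<lambda>\<theta>. c * f \<theta>) \<in> trig"

lemma trig_const: "(\<lambda>\<theta>. c) \<in> trig"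
  using trig_cmult[OF trig_cis[of 0], of c] by simp

lemma trig_mult:
  assumes "f \<in> trig" "g \<in> trig"
  shows "(\<lambda>\<theta>. f \<theta> * g \<theta>) \<in> trig"
  using assms(1)
proof induction
  case (trig_cis m)
  show ?case using assms(2)
  proof induction
    case (trig_cis n)
    have "(\<lambda>\<theta>. cis (of_int m * \<theta>) * cis (of_int n * \<theta>)) = (\<lambda>\<theta>. cis (of_int (m + n) * \<theta>))"
      by (simp add: cis_mult algebra_simps)
    then show ?case using trig.trig_cis by metis
  next
    case (trig_add f g)
    then show ?case using trig.trig_add by (simp add: distrib_left)
  next
    case (trig_cmult f c)
    then show ?case using trig.trig_cmult by (simp add: mult.left_commute)
  qed
next
  case (trig_add f g')
  then show ?case using trig.trig_add by (simp add: distrib_right)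
next
  case (trig_cmult f c)
  then show ?case using trig.trig_cmult by (simp add: mult.assoc)
qed

lemma trig_ess_bdd: "f \<in> trig \<Longrightarrow> \<exists>C. ess_bdd f C"
  by (induction rule: trig.induct) (use ess_bdd_cis ess_bdd_add ess_bdd_cmult in blast)+

lemma trig_cos_sin: "(\<lambda>\<theta>. complex_of_real (cos \<theta>)) \<in> trig" "(\<lambda>\<theta>. complex_of_real (sin \<theta>)) \<in> trig"
proof -
  have c: "(\<lambda>\<theta>. complex_of_real (cos \<theta>)) = (\<lambda>\<theta>. (1 / 2) * (cis (of_int 1 * \<theta>) + cis (of_int (-1) * \<theta>)))"
    by (auto simp: complex_eq_iff)
  have s: "(\<lambda>\<theta>. complex_of_real (sin \<theta>)) = (\<lambda>\<theta>. (- \<i> / 2) * (cis (of_int 1 * \<theta>) + (-1) * cis (of_int (-1) * \<theta>)))"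
    by (auto simp: complex_eq_iff)
  show "(\<lambda>\<theta>. complex_of_real (cos \<theta>)) \<in> trig" "(\<lambda>\<theta>. complex_of_real (sin \<theta>)) \<in> trig"
    unfolding c s by (rule trig_cmult trig_add trig_cis)+
qed

text \<open>Stone-Weierstrass delivers polynomials in the real coordinates of the plane; on the
  circle these coordinates are cosine and sine.\<close>

lemma trig_real_polynomial:
  assumes "real_polynomial_function (p :: complex \<Rightarrow> real)"
  shows "(\<lambda>\<theta>. complex_of_real (p (cis \<theta>))) \<in> trig"
  using assms
proof induction
  case (linear h)
  interpret bounded_linear h by fact
  have "complex_of_real (h (cis \<theta>)) = complex_of_real (h 1) * complex_of_real (cos \<theta>) + complex_of_real (h \<i>) * complex_of_real (sin \<theta>)" for \<theta>
  proof -
    have "cis \<theta> = cos \<theta> *\<^sub>R 1 + sin \<theta> *\<^sub>R \<i>" by (simp add: complex_eq_iff)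
    then have "h (cis \<theta>) = cos \<theta> * h 1 + sin \<theta> * h \<i>" by (simp only: add scaleR real_scaleR_def)
    then show ?thesis by simp
  qed
  then show ?case using trig_add[OF trig_cmult[OF trig_cos_sin(1)] trig_cmult[OF trig_cos_sin(2)]] by simp
next
  case (const c)
  show ?case by (rule trig_const)
next
  case (add f g)
  then show ?case using trig_add by simp
next
  case (mult f g)
  then show ?case using trig_mult by simp
qed

lemma trig_polynomial:
  assumes "polynomial_function (p :: complex \<Rightarrow> complex)"
  shows "(\<lambda>\<theta>. p (cis \<theta>)) \<in> trig"
proof -
  have "real_polynomial_function (Re \<circ> p)" "real_polynomial_function (Im \<circ> p)"
    using assms bounded_linear_Re bounded_linear_Im unfolding polynomial_function_def by blast+
  then have "(\<lambda>\<theta>. complex_of_real ((Re \<circ> p) (cis \<theta>)) + \<i> * complex_of_real ((Im \<circ> p) (cis \<theta>))) \<in> trig"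
    by (intro trig_add trig_cmult trig_real_polynomial)
  then show ?thesis by (simp add: complex_eq[symmetric])
qed

text \<open>Bounded functions are limits of continuous ones almost everywhere; the factor
  \<open>min 1 (n (1 + cos \<theta>))\<close> makes these continuous on the circle, so that the
  Stone-Weierstrass theorem applies.\<close>

lemma trig_dense:
  assumes f: "ess_bdd f C" and e: "0 < e"
  obtains p where "p \<in> trig" "mean_sq (\<lambda>\<theta>. f \<theta> - p \<theta>) < e"
proof -
  have "f \<in> borel_measurable circle_measure" using f by (simp add: ess_bdd_def)
  then have "f measurable_on {-pi..pi}" by (simp add: measurable_on_iff_borel_measurable)
  then obtain N g where N: "negligible N" and g: "\<And>n. continuous_on UNIV (g n)"
    and lim: "\<And>x. x \<notin> N \<Longrightarrow> (\<lambda>n. g n x) \<longlonglongrightarrow> (if x \<in> {-pi..pi} then f x else 0)"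
    unfolding measurable_on_def by blast
  define D where "D = C + 1"
  have C0: "0 \<le> C" using f by (simp add: ess_bdd_def)
  then have D: "0 < D" by (simp add: D_def)
  \<comment> \<open>Radial retraction onto the disc of radius \<open>D\<close>: it keeps the
    continuous approximants uniformly bounded and leaves the essential values of \<open>f\<close>
    fixed.\<close>
  define cl where "cl z = complex_of_real (D / max D (cmod z)) * z" for z
  have cl_cont: "continuous_on UNIV cl" unfolding cl_def using D
    by (intro continuous_intros) (auto simp: max_def)
  have cl_bound: "cmod (cl z) \<le> D" for z
  proof -
    have "cmod (cl z) = D * (cmod z / max D (cmod z))" using D by (simp add: cl_def norm_mult norm_divide)
    also have "\<dots> \<le> D * 1" using D by (intro mult_left_mono) (auto simp: divide_le_eq_1 max_def)
    finally show ?thesis by simp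
  qed
  have cl_id: "cl z = z" if "cmod z \<le> D" for z using that D by (simp add: cl_def max_def)
  define \<kappa> where "\<kappa> n x = min 1 (real n * (1 + x))" for n x
  define h where "h n \<theta> = complex_of_real (\<kappa> n (cos \<theta>)) * cl (g n \<theta>)" for n \<theta>
  have chi: "0 \<le> \<kappa> n x" "\<kappa> n x \<le> 1" if "- 1 \<le> x" for n x using that by (auto simp: \<kappa>_def)
  have h_bound: "cmod (h n \<theta>) \<le> D" for n \<theta>
  proof -
    have "cmod (h n \<theta>) = \<kappa> n (cos \<theta>) * cmod (cl (g n \<theta>))" using chi[of "cos \<theta>" n] by (simp add: h_def norm_mult)
    also have "\<dots> \<le> 1 * D" using chi[of "cos \<theta>" n] D by (intro mult_mono cl_bound) auto
    finally show ?thesis by simp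
  qed
  have h_cont: "continuous_on UNIV (h n)" for n
    unfolding h_def \<kappa>_def
    by (intro continuous_intros continuous_on_compose2[OF cl_cont] g) auto
  have h_ess_bdd: "ess_bdd (h n) D" for n
    using continuous_circle_measurable[OF h_cont] D h_bound by (simp add: ess_bdd_def)
  have AE_lim: "AE \<theta> in circle_measure. (\<lambda>n. h n \<theta>) \<longlonglongrightarrow> f \<theta>"
  proof -
    \<comment> \<open>At the endpoints the cosine is -1 and the cut-off factor is 0 for all n; in
      between it eventually equals 1.\<close>
    have "N \<union> {-pi, pi} \<in> null_sets lebesgue"
      using N negligible_iff_null_sets negligible_Un negligible_finite by blast
    then have "AE \<theta> in lebesgue. \<theta> \<notin> N \<union> {-pi, pi}" by (rule AE_not_in)
    then have "AE \<theta> in circle_measure. \<theta> \<notin> N \<union> {-pi, pi}"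
      by (subst AE_restrict_space_iff) (auto elim: AE_mp)
    moreover have "AE \<theta> in circle_measure. cmod (f \<theta>) \<le> C" using f by (simp add: ess_bdd_def)
    moreover have "AE \<theta> in circle_measure. \<theta> \<in> space circle_measure" by (rule AE_space)
    ultimately show ?thesis
    proof eventually_elim
      case (elim \<theta>)
      then have t: "- pi < \<theta>" "\<theta> < pi" "\<theta> \<notin> N" by (auto simp: space_restrict_space less_le)
      have gl: "(\<lambda>n. g n \<theta>) \<longlonglongrightarrow> f \<theta>" using lim[OF t(3)] t by simp
      have "(\<lambda>n. cl (g n \<theta>)) \<longlonglongrightarrow> cl (f \<theta>)"
        by (rule continuous_on_tendsto_compose[OF cl_cont gl]) auto
      also have "cl (f \<theta>) = f \<theta>" using elim by (intro cl_id) (simp add: D_def)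
      finally have 1: "(\<lambda>n. cl (g n \<theta>)) \<longlonglongrightarrow> f \<theta>" .
      have pos: "0 < 1 + cos \<theta>"
      proof -
        have "cos pi < cos \<bar>\<theta>\<bar>" using t by (intro cos_monotone_0_pi) auto
        then show ?thesis by simp
      qed
      obtain n0 where n0: "1 / (1 + cos \<theta>) \<le> real n0" using real_arch_simple by blast
      have "\<kappa> n (cos \<theta>) = 1" if "n \<ge> n0" for n
      proof -
        have "1 / (1 + cos \<theta>) \<le> real n" using n0 that by linarith
        then show ?thesis using pos by (simp add: \<kappa>_def field_simps)
      qed
      then have "\<forall>\<^sub>F n in sequentially. cl (g n \<theta>) = h n \<theta>"
        by (intro eventually_sequentiallyI[of n0]) (simp add: h_def)
      then show ?case by (rule Lim_transform_eventually[OF 1])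
    qed
  qed
  have "(\<lambda>n. mean_sq (\<lambda>\<theta>. f \<theta> - h n \<theta>)) \<longlonglongrightarrow> 0"
  proof -
    have "(\<lambda>n. LINT \<theta>|circle_measure. (cmod (f \<theta> - h n \<theta>))\<^sup>2) \<longlonglongrightarrow> (LINT \<theta>|circle_measure. 0)"
    proof (rule integral_dominated_convergence[where w = "\<lambda>_. (C + D)\<^sup>2"])
      show "(\<lambda>\<theta>. (cmod (f \<theta> - h n \<theta>))\<^sup>2) \<in> borel_measurable circle_measure" for n
        using ess_bdd_sq_integrable[OF ess_bdd_diff[OF f h_ess_bdd]] by simp
      show "AE \<theta> in circle_measure. (\<lambda>n. (cmod (f \<theta> - h n \<theta>))\<^sup>2) \<longlonglongrightarrow> 0"
        using AE_lim
      proof eventually_elim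
        case (elim \<theta>)
        have "(\<lambda>n. (cmod (f \<theta> - h n \<theta>))\<^sup>2) \<longlonglongrightarrow> (cmod (f \<theta> - f \<theta>))\<^sup>2"
          by (intro tendsto_intros elim)
        then show ?case by simp
      qed
      show "AE \<theta> in circle_measure. norm ((cmod (f \<theta> - h n \<theta>))\<^sup>2) \<le> (C + D)\<^sup>2" for n
      proof -
        have "AE \<theta> in circle_measure. cmod (f \<theta> - h n \<theta>) \<le> C + D" using ess_bdd_diff[OF f h_ess_bdd] by (simp add: ess_bdd_def)
        then show ?thesis by eventually_elim (simp add: power_mono)
      qed
    qed auto
    then have "(\<lambda>n. (LINT \<theta>|circle_measure. (cmod (f \<theta> - h n \<theta>))\<^sup>2) / (2 * pi)) \<longlonglongrightarrow> 0 / (2 * pi)"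
      by (intro tendsto_divide tendsto_const) auto
    then show ?thesis by (simp add: mean_sq_def)
  qed
  then have "\<forall>\<^sub>F n in sequentially. mean_sq (\<lambda>\<theta>. f \<theta> - h n \<theta>) < e / 4"
    by (rule order_tendstoD(2)) (use e in simp)
  then obtain n where n: "mean_sq (\<lambda>\<theta>. f \<theta> - h n \<theta>) < e / 4"
    by (auto simp: eventually_sequentially)
  \<comment> \<open>\<open>h n\<close> transported to the circle. \<open>Arg\<close> jumps at -1,
    but there the cut-off factor vanishes and the other factor is bounded.\<close>
  define H where "H w = complex_of_real (\<kappa> n (Re w)) * cl (g n (Arg w))" for w
  have Hcont: "continuous_on (sphere 0 1) H"
    unfolding continuous_on_eq_continuous_within
  proof
    fix w :: complex assume w: "w \<in> sphere 0 1"
    show "continuous (at w within sphere 0 1) H"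
    proof (cases "w = - 1")
      case False
      have "w \<notin> \<real>\<^sub>\<le>\<^sub>0"
      proof
        assume "w \<in> \<real>\<^sub>\<le>\<^sub>0"
        then obtain r where r: "w = complex_of_real r" "r \<le> 0" by (auto elim!: nonpos_Reals_cases)
        then have "r = - 1" using w by (auto simp: abs_if split: if_splits)
        then show False using r False by simp
      qed
      then have A: "isCont Arg w" by (rule continuous_at_Arg)
      have "isCont (\<lambda>w. cl (g n (Arg w))) w"
        using continuous_at_compose[OF A, of "\<lambda>x. cl (g n x)"] continuous_on_compose2[OF cl_cont g[of n]]
        by (auto simp: o_def continuous_on_eq_continuous_at)
      moreover have "isCont Re w" by (simp add: isCont_def tendsto_Re)
      ultimately have "isCont H w"
        unfolding H_def[abs_def] \<kappa>_def by (intro continuous_intros)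
      then show ?thesis by (rule continuous_at_imp_continuous_within)
    next
      case True
      have H0: "H w = 0" by (simp add: H_def True \<kappa>_def)
      have "((\<lambda>w. H w) \<longlongrightarrow> 0) (at w within sphere 0 1)"
      proof (rule Lim_null_comparison)
        have "cmod (H z) \<le> real n * (1 + Re z) * D" if "z \<in> sphere 0 1" for z
        proof -
          have "- 1 \<le> Re z" using that abs_Re_le_cmod[of z] by auto
          then have "cmod (H z) = \<kappa> n (Re z) * cmod (cl (g n (Arg z)))" using chi[of "Re z" n] by (simp add: H_def norm_mult)
          also have "\<dots> \<le> (real n * (1 + Re z)) * D"
            using \<open>- 1 \<le> Re z\<close> D by (intro mult_mono cl_bound) (auto simp: \<kappa>_def)
          finally show ?thesis .
        qed
        then show "\<forall>\<^sub>F z in at w within sphere 0 1. norm (H z) \<le> real n * (1 + Re z) * D"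
          by (auto simp: eventually_at_filter)
        have "((\<lambda>z. real n * (1 + Re z) * D) \<longlongrightarrow> real n * (1 + Re w) * D) (at w within sphere 0 1)"
          by (intro tendsto_intros)
        then show "((\<lambda>z. real n * (1 + Re z) * D) \<longlongrightarrow> 0) (at w within sphere 0 1)" by (simp add: True)
      qed
      then show ?thesis by (simp add: continuous_within H0)
    qed
  qed
  \<comment> \<open>Chosen so that 2 * (e/4) + 2 * (e/8) stays below e in the last estimate.\<close>
  define d where "d = sqrt (e / 8)"
  have d: "0 < d" "d\<^sup>2 = e / 8" using e by (simp_all add: d_def)
  obtain P where P: "polynomial_function P" "\<And>w. w \<in> sphere 0 1 \<Longrightarrow> norm (H w - P w) < d"
    using Stone_Weierstrass_polynomial_function[OF compact_sphere Hcont d(1)] by blast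
  define p where "p \<theta> = P (cis \<theta>)" for \<theta>
  have p: "p \<in> trig" unfolding p_def[abs_def] by (rule trig_polynomial[OF P(1)])
  then obtain B where B: "ess_bdd p B" using trig_ess_bdd by blast
  have hp: "cmod (h n \<theta> - p \<theta>) \<le> d" if "\<theta> \<in> {-pi<..pi}" for \<theta>
    using P(2)[of "cis \<theta>"] Arg_cis[OF that] by (simp add: H_def h_def p_def)
  \<comment> \<open>\<open>Arg\<close> takes values in this half-open interval, so it inverts
    \<open>cis\<close> everywhere except at the left endpoint.\<close>
  have "AE \<theta> in circle_measure. \<theta> \<in> {-pi<..pi}"
  proof -
    have "AE \<theta> in lebesgue. \<theta> \<notin> {- pi}" by (rule AE_not_in) simp
    then have "AE \<theta> in circle_measure. \<theta> \<notin> {- pi}" by (subst AE_restrict_space_iff) (auto elim: AE_mp)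
    moreover have "AE \<theta> in circle_measure. \<theta> \<in> space circle_measure" by (rule AE_space)
    ultimately show ?thesis by eventually_elim (auto simp: space_restrict_space)
  qed
  then have "AE \<theta> in circle_measure. (cmod (f \<theta> - p \<theta>))\<^sup>2 \<le> 2 * (cmod (f \<theta> - h n \<theta>))\<^sup>2 + 2 * d\<^sup>2"
  proof eventually_elim
    case (elim \<theta>)
    have "cmod (f \<theta> - p \<theta>) \<le> cmod (f \<theta> - h n \<theta>) + d"
      using norm_triangle_ineq[of "f \<theta> - h n \<theta>" "h n \<theta> - p \<theta>"] hp[OF elim] by simp
    then have "(cmod (f \<theta> - p \<theta>))\<^sup>2 \<le> (cmod (f \<theta> - h n \<theta>) + d)\<^sup>2" by (rule power_mono) simp
    also have "\<dots> \<le> 2 * (cmod (f \<theta> - h n \<theta>))\<^sup>2 + 2 * d\<^sup>2"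
      using sum_squares_bound[of "cmod (f \<theta> - h n \<theta>)" d] by (simp add: power2_sum)
    finally show ?case .
  qed
  then have "(LINT \<theta>|circle_measure. (cmod (f \<theta> - p \<theta>))\<^sup>2)
    \<le> (LINT \<theta>|circle_measure. 2 * (cmod (f \<theta> - h n \<theta>))\<^sup>2 + 2 * d\<^sup>2)"
    using ess_bdd_sq_integrable[OF ess_bdd_diff[OF f B]] ess_bdd_sq_integrable[OF ess_bdd_diff[OF f h_ess_bdd]]
    by (intro integral_mono_AE) auto
  also have "\<dots> = 2 * (LINT \<theta>|circle_measure. (cmod (f \<theta> - h n \<theta>))\<^sup>2) + 2 * d\<^sup>2 * (2 * pi)"
    using ess_bdd_sq_integrable[OF ess_bdd_diff[OF f h_ess_bdd]] measure_circle
    by (subst Bochner_Integration.integral_add) auto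
  finally have "mean_sq (\<lambda>\<theta>. f \<theta> - p \<theta>) \<le> 2 * mean_sq (\<lambda>\<theta>. f \<theta> - h n \<theta>) + 2 * d\<^sup>2"
    unfolding mean_sq_def by (simp add: field_simps)
  also have "\<dots> < e" using n d(2) e by linarith
  finally show ?thesis using that p by blast
qed

section \<open>Fourier coefficients of a product\<close>

lemma bessel_product:
  assumes f: "ess_bdd f C" and g: "ess_bdd g D" and t: "0 < t" and F: "finite F"
  shows "(\<Sum>l\<in>F. cmod (fcoeff f l * fcoeff g (m - l))) \<le> t\<^sup>2 * mean_sq f + mean_sq g / t\<^sup>2"
proof -
  have "(\<Sum>l\<in>F. cmod (fcoeff f l * fcoeff g (m - l)))
    \<le> (\<Sum>l\<in>F. t\<^sup>2 * (cmod (fcoeff f l))\<^sup>2 + (cmod (fcoeff g (m - l)))\<^sup>2 / t\<^sup>2)"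
  proof (rule sum_mono)
    fix l
    let ?a = "cmod (fcoeff f l)" and ?b = "cmod (fcoeff g (m - l))"
    have "2 * (t * ?a) * (?b / t) \<le> (t * ?a)\<^sup>2 + (?b / t)\<^sup>2" by (rule sum_squares_bound)
    moreover have "0 \<le> ?a * ?b" by simp
    moreover have "2 * (t * ?a) * (?b / t) = 2 * (?a * ?b)" using t by simp
    ultimately show "cmod (fcoeff f l * fcoeff g (m - l)) \<le> t\<^sup>2 * ?a\<^sup>2 + ?b\<^sup>2 / t\<^sup>2"
      unfolding norm_mult power_mult_distrib power_divide by linarith
  qed
  also have "\<dots> = t\<^sup>2 * (\<Sum>l\<in>F. (cmod (fcoeff f l))\<^sup>2) + (\<Sum>l\<in>F. (cmod (fcoeff g (m - l)))\<^sup>2) / t\<^sup>2"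
    by (simp add: sum.distrib sum_distrib_left sum_divide_distrib)
  also have "(\<Sum>l\<in>F. (cmod (fcoeff g (m - l)))\<^sup>2) = (\<Sum>l\<in>(\<lambda>l. m - l) ` F. (cmod (fcoeff g l))\<^sup>2)"
    by (subst sum.reindex) (auto simp: inj_on_def)
  also have "t\<^sup>2 * (\<Sum>l\<in>F. (cmod (fcoeff f l))\<^sup>2) + \<dots> / t\<^sup>2 \<le> t\<^sup>2 * mean_sq f + mean_sq g / t\<^sup>2"
    using F by (intro add_mono mult_left_mono divide_right_mono bessel[OF f] bessel[OF g]) auto
  finally show ?thesis .
qed

lemma fcoeff_product_abs_summable:
  assumes "ess_bdd f C" "ess_bdd g D"
  shows "(\<lambda>l. norm (fcoeff f l * fcoeff g (m - l))) summable_on UNIV"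
proof (rule nonneg_bdd_above_summable_on)
  show "bdd_above (sum (\<lambda>l. norm (fcoeff f l * fcoeff g (m - l))) ` {F. F \<subseteq> UNIV \<and> finite F})"
    by (rule bdd_aboveI2[where M = "1\<^sup>2 * mean_sq f + mean_sq g / 1\<^sup>2"])
      (rule bessel_product[OF assms], auto)
qed simp

text \<open>The difference of both sides is bilinear, vanishes for trigonometric polynomials \<open>f\<close> and
  is bounded in the quadratic mean.\<close>

theorem fcoeff_mult_has_sum:
  assumes f: "ess_bdd f C" and g: "ess_bdd g D"
  shows "((\<lambda>l. fcoeff f l * fcoeff g (m - l)) has_sum fcoeff (\<lambda>\<theta>. f \<theta> * g \<theta>) m) UNIV"
proof -
  define s where "s h = infsum (\<lambda>l. fcoeff h l * fcoeff g (m - l)) UNIV" for h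
  have sum: "(\<lambda>l. fcoeff h l * fcoeff g (m - l)) summable_on UNIV" if "ess_bdd h B" for h B
    by (rule abs_summable_summable[OF fcoeff_product_abs_summable[OF that g]])
  have s_trig: "s p = fcoeff (\<lambda>\<theta>. p \<theta> * g \<theta>) m" if "p \<in> trig" for p
    using that
  proof induction
    case (trig_cis k)
    let ?a = "\<lambda>l. fcoeff (\<lambda>\<theta>. cis (of_int k * \<theta>)) l * fcoeff g (m - l)"
    have "(?a has_sum sum ?a {k}) {k}" by (rule has_sum_finite) simp
    then have "(?a has_sum sum ?a {k}) UNIV"
      by (rule has_sum_cong_neutral[THEN iffD1, rotated -1]) (auto simp: fcoeff_cis)
    then have "s (\<lambda>\<theta>. cis (of_int k * \<theta>)) = fcoeff g (m - k)"
      unfolding s_def by (simp add: infsumI fcoeff_cis)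
    then show ?case by (simp add: fcoeff_cis_mult)
  next
    case (trig_add p q)
    obtain B B' where B: "ess_bdd p B" "ess_bdd q B'" using trig_add trig_ess_bdd by blast
    have "s (\<lambda>\<theta>. p \<theta> + q \<theta>) = s p + s q"
      unfolding s_def fcoeff_add[OF B] distrib_right by (rule infsum_add[OF sum[OF B(1)] sum[OF B(2)]])
    moreover have "fcoeff (\<lambda>\<theta>. (p \<theta> + q \<theta>) * g \<theta>) m = fcoeff (\<lambda>\<theta>. p \<theta> * g \<theta>) m + fcoeff (\<lambda>\<theta>. q \<theta> * g \<theta>) m"
      unfolding distrib_right by (rule fcoeff_add[OF ess_bdd_mult[OF B(1) g] ess_bdd_mult[OF B(2) g]])
    ultimately show ?case using trig_add.IH by simp
  next
    case (trig_cmult p c)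
    then show ?case by (simp add: s_def fcoeff_cmult mult.assoc infsum_cmult_right')
  qed
  have "s f = fcoeff (\<lambda>\<theta>. f \<theta> * g \<theta>) m"
  proof (rule ccontr)
    define \<eta> where "\<eta> = cmod (s f - fcoeff (\<lambda>\<theta>. f \<theta> * g \<theta>) m)"
    assume "s f \<noteq> fcoeff (\<lambda>\<theta>. f \<theta> * g \<theta>) m"
    then have \<eta>: "0 < \<eta>" by (simp add: \<eta>_def)
    \<comment> \<open>\<open>t\<close> first makes the \<open>g\<close>-term smaller than \<eta>/4;
      then \<open>p\<close> is taken so close to \<open>f\<close> that the other term is too. Both
      parts of the difference are thus below \<eta>/2. The 1 covers the case that \<open>g\<close>
      has mean square 0.\<close>
    define t where "t = sqrt (4 * (mean_sq g + 1) / \<eta>)"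
    have mg: "0 < mean_sq g + 1" using mean_sq_nonneg[of g] by simp
    have t: "0 < t" "t\<^sup>2 = 4 * (mean_sq g + 1) / \<eta>" using \<eta> mg by (simp_all add: t_def)
    have tg: "mean_sq g / t\<^sup>2 < \<eta> / 4"
      unfolding t(2) using \<eta> mg by (simp add: field_simps)
    obtain p where p: "p \<in> trig" and close: "mean_sq (\<lambda>\<theta>. f \<theta> - p \<theta>) < \<eta> / (4 * t\<^sup>2)"
      using trig_dense[OF f, of "\<eta> / (4 * t\<^sup>2)"] \<eta> t(1) by (metis divide_pos_pos mult_pos_pos zero_less_numeral zero_less_power)
    obtain B where B: "ess_bdd p B" using trig_ess_bdd[OF p] by blast
    let ?h = "\<lambda>\<theta>. f \<theta> - p \<theta>"
    have h: "ess_bdd ?h (C + B)" by (rule ess_bdd_diff[OF f B])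
    have small: "t\<^sup>2 * mean_sq ?h + mean_sq g / t\<^sup>2 < \<eta> / 2"
    proof -
      have "t\<^sup>2 * mean_sq ?h < t\<^sup>2 * (\<eta> / (4 * t\<^sup>2))" using close t(1) by (intro mult_strict_left_mono) auto
      also have "\<dots> = \<eta> / 4" using t(1) by simp
      finally show ?thesis using tg by linarith
    qed
    have "s (\<lambda>\<theta>. ?h \<theta> + p \<theta>) = s ?h + s p"
      unfolding s_def fcoeff_add[OF h B] distrib_right by (rule infsum_add[OF sum[OF h] sum[OF B]])
    then have "s ?h = s f - s p" by simp
    moreover have "fcoeff (\<lambda>\<theta>. ?h \<theta> * g \<theta>) m = fcoeff (\<lambda>\<theta>. f \<theta> * g \<theta>) m - fcoeff (\<lambda>\<theta>. p \<theta> * g \<theta>) m"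
      unfolding left_diff_distrib by (rule fcoeff_diff[OF ess_bdd_mult[OF f g] ess_bdd_mult[OF B g]])
    ultimately have "\<eta> = cmod (s ?h - fcoeff (\<lambda>\<theta>. ?h \<theta> * g \<theta>) m)"
      unfolding \<eta>_def using s_trig[OF p] by simp
    also have "\<dots> \<le> cmod (s ?h) + cmod (fcoeff (\<lambda>\<theta>. ?h \<theta> * g \<theta>) m)" by (rule norm_triangle_ineq4)
    also have "cmod (s ?h) \<le> t\<^sup>2 * mean_sq ?h + mean_sq g / t\<^sup>2"
    proof -
      have "cmod (s ?h) \<le> infsum (\<lambda>l. cmod (fcoeff ?h l * fcoeff g (m - l))) UNIV"
        unfolding s_def by (rule norm_infsum_bound[OF fcoeff_product_abs_summable[OF h g]])
      also have "\<dots> \<le> t\<^sup>2 * mean_sq ?h + mean_sq g / t\<^sup>2"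
        by (rule infsum_le_finite_sums[OF fcoeff_product_abs_summable[OF h g]])
          (rule bessel_product[OF h g t(1)])
      finally show ?thesis .
    qed
    also have "cmod (fcoeff (\<lambda>\<theta>. ?h \<theta> * g \<theta>) m) \<le> t\<^sup>2 * mean_sq ?h + mean_sq g / t\<^sup>2"
    proof -
      have "mean_sq (\<lambda>\<theta>. g \<theta> * cis (- (of_int m * \<theta>))) = mean_sq g"
        by (simp add: mean_sq_def norm_mult)
      then show ?thesis
        using cmod_mean_mult_le[OF h ess_bdd_fcoeff[OF g, of m] t(1)] by (simp add: fcoeff_def mult.assoc)
    qed
    finally show False using small by simp
  qed
  then show ?thesis using has_sum_infsum[OF sum[OF f]] by (simp add: s_def)
qed

section \<open>Toeplitz and Hankel operators\<close>

definition circle_bdd :: "(complex \<Rightarrow> complex) \<Rightarrow> real \<Rightarrow> bool"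
  where "circle_bdd a C \<longleftrightarrow> ess_bdd (\<lambda>\<theta>. a (cis \<theta>)) C"

lemma circle_bdd_add: "circle_bdd a C \<Longrightarrow> circle_bdd b D \<Longrightarrow> circle_bdd (\<lambda>t. a t + b t) (C + D)"
  unfolding circle_bdd_def by (rule ess_bdd_add)

lemma circle_bdd_mult: "circle_bdd a C \<Longrightarrow> circle_bdd b D \<Longrightarrow> circle_bdd (\<lambda>t. a t * b t) (C * D)"
  unfolding circle_bdd_def by (rule ess_bdd_mult)

lemma circle_bdd_cmult: "circle_bdd a C \<Longrightarrow> circle_bdd (\<lambda>t. z * a t) (cmod z * C)"
  unfolding circle_bdd_def by (rule ess_bdd_cmult)

lemma fourier_eq_fcoeff: "fourier a n = fcoeff (\<lambda>\<theta>. a (cis \<theta>)) n"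
  by (simp add: fourier_def fcoeff_def mean_def)

text \<open>The matrix is a compression of multiplication by \<open>a\<close>: column
  \<open>k\<close> stands for the frequency \<open>\<psi> k\<close>, row \<open>j\<close> for the
  coefficient at \<open>\<phi> j\<close>. Bessel's inequality for a times a trigonometric polynomial
  bounds all finite blocks by \<open>C\<close>.\<close>

lemma circle_operator_exists:
  assumes a: "circle_bdd a C" and \<phi>: "inj \<phi>" and \<psi>: "inj \<psi>"
  shows "\<exists>A. (\<forall>j k. entry A j k = fourier a (\<phi> j - \<psi> k)) \<and> norm A \<le> C"
proof -
  note a = a[unfolded circle_bdd_def]
  have C: "0 \<le> C" using a by (simp add: ess_bdd_def)
  have bound: "(\<Sum>j<J. (cmod (\<Sum>k<n. fourier a (\<phi> j - \<psi> k) * f k))\<^sup>2) \<le> C\<^sup>2 * (\<Sum>k<n. (cmod (f k))\<^sup>2)"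
    for n f and J :: nat
  proof -
    define q where "q \<theta> = (\<Sum>k<n. f k * cis (of_int (\<psi> k) * \<theta>))" for \<theta>
    have "\<exists>B. ess_bdd q B" unfolding q_def using ess_bdd_cmult[OF ess_bdd_cis] by (intro ess_bdd_sum) blast
    then obtain B where q: "ess_bdd q B" by blast
    have aq: "ess_bdd (\<lambda>\<theta>. a (cis \<theta>) * q \<theta>) (C * B)" by (rule ess_bdd_mult[OF a q])
    have c: "fcoeff (\<lambda>\<theta>. a (cis \<theta>) * q \<theta>) m = (\<Sum>k<n. fourier a (m - \<psi> k) * f k)" for m
    proof -
      have "fcoeff (\<lambda>\<theta>. a (cis \<theta>) * q \<theta>) m
        = mean (\<lambda>\<theta>. \<Sum>k<n. f k * ((cis (of_int (\<psi> k) * \<theta>) * a (cis \<theta>)) * cis (- (of_int m * \<theta>))))"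
        unfolding fcoeff_def q_def by (simp add: sum_distrib_left sum_distrib_right mult_ac)
      also have "\<dots> = (\<Sum>k<n. mean (\<lambda>\<theta>. f k * ((cis (of_int (\<psi> k) * \<theta>) * a (cis \<theta>)) * cis (- (of_int m * \<theta>)))))"
        using ess_bdd_cmult[OF ess_bdd_fcoeff[OF ess_bdd_mult[OF ess_bdd_cis a]]] by (intro mean_sum) blast
      also have "\<dots> = (\<Sum>k<n. fourier a (m - \<psi> k) * f k)"
        unfolding mean_cmult fcoeff_def[symmetric] fcoeff_cis_mult fourier_eq_fcoeff by (simp add: mult.commute)
      finally show ?thesis .
    qed
    have "(\<Sum>j<J. (cmod (\<Sum>k<n. fourier a (\<phi> j - \<psi> k) * f k))\<^sup>2)
      = (\<Sum>m\<in>\<phi> ` {..<J}. (cmod (fcoeff (\<lambda>\<theta>. a (cis \<theta>) * q \<theta>) m))\<^sup>2)"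
      using \<phi> by (subst sum.reindex) (auto simp: c inj_on_def inj_def)
    also have "\<dots> \<le> mean_sq (\<lambda>\<theta>. a (cis \<theta>) * q \<theta>)" by (rule bessel[OF aq]) simp
    also have "\<dots> \<le> C\<^sup>2 * mean_sq q"
    proof (rule mean_sq_le_AE[OF aq q])
      have "AE \<theta> in circle_measure. cmod (a (cis \<theta>)) \<le> C" using a by (simp add: ess_bdd_def)
      then show "AE \<theta> in circle_measure. cmod (a (cis \<theta>) * q \<theta>) \<le> C * cmod (q \<theta>)"
        by eventually_elim (simp add: norm_mult mult_right_mono)
    qed
    also have "mean_sq q = (\<Sum>k<n. (cmod (f k))\<^sup>2)"
      unfolding q_def using \<psi> by (intro mean_sq_trig) (auto simp: inj_on_def inj_def)
    finally show ?thesis .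
  qed
  show ?thesis by (rule op_of_bounded_matrix[OF bound C]) blast
qed

lemma toeplitz_op:
  assumes "circle_bdd a C"
  shows "entry (toeplitz a) j k = fourier a (int j - int k)" "norm (toeplitz a) \<le> C"
proof -
  obtain A where A: "\<And>j k. entry A j k = fourier a (int j - int k)" "norm A \<le> C"
    using circle_operator_exists[OF assms, of int int] by auto
  then have "toeplitz a = A" unfolding toeplitz_def by (intro op_of_matrix_eqI)
  then show "entry (toeplitz a) j k = fourier a (int j - int k)" "norm (toeplitz a) \<le> C" using A by simp_all
qed

lemma hankel_op:
  assumes "circle_bdd a C"
  shows "entry (hankel a) j k = fourier a (int j + int k + 1)" "norm (hankel a) \<le> C"
proof -
  \<comment> \<open>The Hankel operator acts on the negative frequencies -1, -2, ...\<close>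
  have "inj (\<lambda>k. - int k - 1)" by (simp add: inj_def)
  then obtain A where "\<And>j k. entry A j k = fourier a (int j - (- int k - 1))" "norm A \<le> C"
    using circle_operator_exists[OF assms, of int "\<lambda>k. - int k - 1"] by auto
  then have A: "\<And>j k. entry A j k = fourier a (int j + int k + 1)" "norm A \<le> C" by (simp_all add: algebra_simps)
  then have "hankel a = A" unfolding hankel_def by (intro op_of_matrix_eqI)
  then show "entry (hankel a) j k = fourier a (int j + int k + 1)" "norm (hankel a) \<le> C" using A by simp_all
qed

lemma fourier_add: "circle_bdd a C \<Longrightarrow> circle_bdd b D \<Longrightarrow> fourier (\<lambda>t. a t + b t) n = fourier a n + fourier b n"
  unfolding fourier_eq_fcoeff circle_bdd_def by (rule fcoeff_add)

lemma fourier_cmult: "fourier (\<lambda>t. z * a t) n = z * fourier a n"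
  unfolding fourier_eq_fcoeff by (rule fcoeff_cmult)

lemma fourier_one: "fourier (\<lambda>_. 1) n = (if n = 0 then 1 else 0)"
  unfolding fourier_eq_fcoeff using fcoeff_cis[of 0 n] by simp

lemma fourier_bound:
  assumes "circle_bdd a C"
  shows "cmod (fourier a n) \<le> C"
proof -
  note assms = assms[unfolded circle_bdd_def]
  have "cmod (LINT \<theta>|circle_measure. a (cis \<theta>) * cis (- (of_int n * \<theta>)))
    \<le> (LINT \<theta>|circle_measure. cmod (a (cis \<theta>) * cis (- (of_int n * \<theta>))))" by (rule integral_norm_bound)
  also have "\<dots> \<le> (LINT \<theta>|circle_measure. C)"
    using ess_bdd_fcoeff[OF assms] ess_bdd_integrable[OF ess_bdd_fcoeff[OF assms]]
    by (intro integral_mono_AE integrable_norm) (auto simp: ess_bdd_def)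
  also have "\<dots> = 2 * pi * C" using measure_circle by simp
  finally have "cmod (LINT \<theta>|circle_measure. a (cis \<theta>) * cis (- (of_int n * \<theta>))) / (2 * pi) \<le> 2 * pi * C / (2 * pi)"
    by (rule divide_right_mono) simp
  then show ?thesis by (simp add: fourier_def norm_mult norm_divide)
qed

lemma fourier_tilde: "fourier (tilde a) n = fourier a (- n)"
proof -
  have "(LINT \<theta>|circle_measure. tilde a (cis \<theta>) * cis (- (of_int n * \<theta>)))
    = (LINT \<theta>|lebesgue_on {-pi..- (- pi)}. (\<lambda>\<theta>. a (cis \<theta>) * cis (- (of_int (- n) * \<theta>))) (- \<theta>))"
    by (simp add: tilde_def)
  also have "\<dots> = (LINT \<theta>|lebesgue_on {-pi..pi}. a (cis \<theta>) * cis (- (of_int (- n) * \<theta>)))"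
    by (rule Equivalence_Lebesgue_Henstock_Integration.integral_reflect_real)
  finally show ?thesis by (simp add: fourier_def)
qed

lemma fourier_mult_has_sum:
  assumes "circle_bdd a C" "circle_bdd b D"
  shows "((\<lambda>l. fourier a l * fourier b (m - l)) has_sum fourier (\<lambda>t. a t * b t) m) UNIV"
  unfolding fourier_eq_fcoeff by (rule fcoeff_mult_has_sum[OF assms[unfolded circle_bdd_def]])

lemma has_sum_int_split:
  fixes f :: "int \<Rightarrow> complex"
  assumes "(f has_sum s) UNIV" and "(\<lambda>l. f (int l)) sums p" and "(\<lambda>l. f (- int l - 1)) sums q"
  shows "s = p + q"
proof -
  have sm: "f summable_on UNIV" using assms(1) by (auto simp: summable_on_def)
  have b1: "bij_betw int UNIV {0..}"
    by (rule bij_betw_byWitness[where f' = nat]) auto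
  have b2: "bij_betw (\<lambda>l. - int l - 1) UNIV {..<0}"
    by (rule bij_betw_byWitness[where f' = "\<lambda>n. nat (- n - 1)"]) auto
  have s1: "f summable_on {0..}" and s2: "f summable_on {..<0}"
    using summable_on_subset_banach[OF sm] by auto
  have "((\<lambda>l. f (int l)) has_sum infsum f {0..}) UNIV"
    using has_sum_infsum[OF s1] has_sum_reindex_bij_betw[OF b1, of f] by simp
  then have p: "infsum f {0..} = p" using has_sum_imp_sums assms(2) sums_unique2 by blast
  have "((\<lambda>l. f (- int l - 1)) has_sum infsum f {..<0}) UNIV"
    using has_sum_infsum[OF s2] has_sum_reindex_bij_betw[OF b2, of f] by simp
  then have q: "infsum f {..<0} = q" using has_sum_imp_sums assms(3) sums_unique2 by blast
  have "infsum f ({0..} \<union> {..<0}) = infsum f {0..} + infsum f {..<0}"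
    by (rule infsum_Un_disjoint[OF s1 s2]) auto
  moreover have "{0..} \<union> {..<0} = (UNIV :: int set)" by auto
  ultimately show ?thesis using infsumI[OF assms(1)] p q by simp
qed

text \<open>The convolution over all integers is split at 0. Non-negative indices give the Toeplitz
  product; the negative ones, written as -l-1, give the Hankel product.\<close>

theorem toeplitz_mult:
  assumes a: "circle_bdd a C" and b: "circle_bdd b D" and b': "circle_bdd (tilde b) D'"
  shows "toeplitz (\<lambda>t. a t * b t) = toeplitz a * toeplitz b + hankel a * hankel (tilde b)"
proof (rule op_eqI)
  fix j k
  define f where "f l = fourier a (int j - l) * fourier b (l - int k)" for l
  have "((\<lambda>l. fourier a l * fourier b (int j - int k - l)) has_sum fourier (\<lambda>t. a t * b t) (int j - int k)) UNIV"
    by (rule fourier_mult_has_sum[OF a b])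
  moreover have "bij (\<lambda>l. int j - l)" by (rule bij_betw_byWitness[where f' = "\<lambda>l. int j - l"]) auto
  ultimately have "((\<lambda>l. fourier a (int j - l) * fourier b (int j - int k - (int j - l)))
    has_sum fourier (\<lambda>t. a t * b t) (int j - int k)) UNIV"
    using has_sum_reindex_bij_betw[of "\<lambda>l. int j - l" UNIV UNIV "\<lambda>l. fourier a l * fourier b (int j - int k - l)"] by simp
  then have "(f has_sum fourier (\<lambda>t. a t * b t) (int j - int k)) UNIV"
    unfolding f_def by (simp add: algebra_simps)
  moreover have "(\<lambda>l. f (int l)) sums entry (toeplitz a * toeplitz b) j k"
    using entry_mult_sums[of "toeplitz a" j "toeplitz b" k] by (simp add: toeplitz_op[OF a] toeplitz_op[OF b] f_def)
  moreover have "(\<lambda>l. f (- int l - 1)) sums entry (hankel a * hankel (tilde b)) j k"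
  proof -
    have e: "int j - (- int l - 1) = int j + int l + 1" "- int l - 1 - int k = - (int l + int k + 1)" for l by simp_all
    have "f (- int l - 1) = entry (hankel a) j l * entry (hankel (tilde b)) l k" for l
      unfolding f_def hankel_op(1)[OF a] hankel_op(1)[OF b'] fourier_tilde e ..
    then show ?thesis using entry_mult_sums[of "hankel a" j "hankel (tilde b)" k] by simp
  qed
  ultimately have "fourier (\<lambda>t. a t * b t) (int j - int k)
    = entry (toeplitz a * toeplitz b) j k + entry (hankel a * hankel (tilde b)) j k"
    by (rule has_sum_int_split)
  then show "entry (toeplitz (\<lambda>t. a t * b t)) j k = entry (toeplitz a * toeplitz b + hankel a * hankel (tilde b)) j k"
    by (simp add: toeplitz_op(1)[OF circle_bdd_mult[OF a b]] entry_simps)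
qed

lemma toeplitz_add:
  assumes "circle_bdd a C" "circle_bdd b D"
  shows "toeplitz (\<lambda>t. a t + b t) = toeplitz a + toeplitz b"
  by (rule op_eqI) (simp add: toeplitz_op(1)[OF circle_bdd_add[OF assms]] toeplitz_op(1)[OF assms(1)]
      toeplitz_op(1)[OF assms(2)] entry_simps fourier_add[OF assms])

lemma hankel_add:
  assumes "circle_bdd a C" "circle_bdd b D"
  shows "hankel (\<lambda>t. a t + b t) = hankel a + hankel b"
  by (rule op_eqI) (simp add: hankel_op(1)[OF circle_bdd_add[OF assms]] hankel_op(1)[OF assms(1)]
      hankel_op(1)[OF assms(2)] entry_simps fourier_add[OF assms])

lemma toeplitz_scale: "circle_bdd a C \<Longrightarrow> toeplitz (\<lambda>t. z * a t) = z *\<^sub>C toeplitz a"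
  by (rule op_eqI) (simp add: toeplitz_op(1)[OF circle_bdd_cmult] toeplitz_op(1) entry_simps fourier_cmult)

lemma hankel_scale: "circle_bdd a C \<Longrightarrow> hankel (\<lambda>t. z * a t) = z *\<^sub>C hankel a"
  by (rule op_eqI) (simp add: hankel_op(1)[OF circle_bdd_cmult] hankel_op(1) entry_simps fourier_cmult)

lemma toeplitz_one: "toeplitz (\<lambda>_. 1) = 1"
proof (rule op_eqI)
  have "circle_bdd (\<lambda>_. 1) 1" using ess_bdd_const[of 1] by (simp add: circle_bdd_def)
  then show "entry (toeplitz (\<lambda>_. 1)) j k = entry 1 j k" for j k
    by (simp add: toeplitz_op(1) fourier_one entry_simps)
qed

lemma hankel_cong:
  assumes "circle_bdd a C" "circle_bdd b D" "\<And>n. 0 < n \<Longrightarrow> fourier a n = fourier b n"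
  shows "hankel a = hankel b"
  by (rule op_eqI) (simp add: hankel_op(1)[OF assms(1)] hankel_op(1)[OF assms(2)] assms(3))

lemma hankel_eq_0:
  assumes "circle_bdd a C" "\<And>n. 0 < n \<Longrightarrow> fourier a n = 0"
  shows "hankel a = 0"
  by (rule op_eqI) (simp add: hankel_op(1)[OF assms(1)] assms(2) entry_simps)

section \<open>Exponentials in the function algebra\<close>

context circle_banach_algebra
begin

lemma diff: "a \<in> S \<Longrightarrow> b \<in> S \<Longrightarrow> (\<lambda>t. a t - b t) \<in> S"
  using add[OF _ scale[of b "-1"]] by simp

lemma zero: "(\<lambda>_. 0) \<in> S"
  using scale[OF one, of 0] by simp

lemma nrm_diff_commute: "a \<in> S \<Longrightarrow> b \<in> S \<Longrightarrow> nrm (\<lambda>t. a t - b t) = nrm (\<lambda>t. b t - a t)"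
  using nrm_scale[OF diff, of b a "-1"] by (simp add: algebra_simps)

lemma nrm_le_diff:
  assumes "a \<in> S" "b \<in> S"
  shows "nrm a \<le> nrm b + nrm (\<lambda>t. a t - b t)"
  using nrm_add[OF assms(2) diff[OF assms]] by simp

lemma nrm_zero_fun [simp]: "nrm (\<lambda>_. 0) = 0"
  using nrm_scale[OF one, of 0] by simp

lemma nrm_cong:
  assumes "a \<in> S" "b \<in> S" "circle_ae_eq a b"
  shows "nrm a = nrm b"
proof -
  have "circle_ae_eq (\<lambda>t. a t - b t) (\<lambda>_. 0)" using assms(3) by (simp add: circle_ae_eq_def)
  then have "nrm (\<lambda>t. a t - b t) = 0" using nrm_zero[OF diff[OF assms(1,2)]] by simp
  then show ?thesis
    using nrm_le_diff[OF assms(1,2)] nrm_le_diff[OF assms(2,1)] nrm_diff_commute[OF assms(1,2)] by simp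
qed

lemma circle_bdd_nrm: "\<exists>C\<ge>0. \<forall>a\<in>S. circle_bdd a (C * nrm a)"
proof -
  obtain C where C: "\<And>a. a \<in> S \<Longrightarrow> AE \<theta> in circle_measure. cmod (a (cis \<theta>)) \<le> C * nrm a"
    using embedding by blast
  have "circle_bdd a (\<bar>C\<bar> * nrm a)" if a: "a \<in> S" for a
  proof -
    have "C * nrm a \<le> \<bar>C\<bar> * nrm a" using nrm_nonneg[OF a] by (intro mult_right_mono) auto
    then have "AE \<theta> in circle_measure. cmod (a (cis \<theta>)) \<le> \<bar>C\<bar> * nrm a"
      using C[OF a] by (auto elim!: eventually_mono)
    then show ?thesis using measurable[OF a] nrm_nonneg[OF a] by (simp add: circle_bdd_def ess_bdd_def)
  qed
  then show ?thesis by (intro exI[of _ "\<bar>C\<bar>"]) simp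
qed

text \<open>One embedding constant chosen for the whole context, so that boundedness of every
  element of \<open>S\<close> can be cited as a fact.\<close>

definition bnd :: real where "bnd = (SOME C. 0 \<le> C \<and> (\<forall>a\<in>S. circle_bdd a (C * nrm a)))"

lemma bnd: "0 \<le> bnd" "a \<in> S \<Longrightarrow> circle_bdd a (bnd * nrm a)"
  using someI_ex[of "\<lambda>C. 0 \<le> C \<and> (\<forall>a\<in>S. circle_bdd a (C * nrm a))"] circle_bdd_nrm unfolding bnd_def by auto

definition sconv :: "(nat \<Rightarrow> complex \<Rightarrow> complex) \<Rightarrow> (complex \<Rightarrow> complex) \<Rightarrow> bool"
  where "sconv f a \<longleftrightarrow> (\<forall>n. f n \<in> S) \<and> a \<in> S \<and> (\<lambda>n. nrm (\<lambda>t. f n t - a t)) \<longlonglongrightarrow> 0"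

lemma sconv_fourier:
  assumes "sconv f a"
  shows "(\<lambda>n. fourier (f n) m) \<longlonglongrightarrow> fourier a m"
proof -
  have S: "f n \<in> S" "a \<in> S" for n using assms by (simp_all add: sconv_def)
  have "(\<lambda>n. fourier (f n) m - fourier a m) \<longlonglongrightarrow> 0"
  proof (rule Lim_null_comparison[OF always_eventually])
    show "\<forall>n. norm (fourier (f n) m - fourier a m) \<le> bnd * nrm (\<lambda>t. f n t - a t)"
    proof
      fix n
      have "fourier (\<lambda>t. f n t + (-1) * a t) m = fourier (f n) m + (-1) * fourier a m"
        using fourier_add[OF bnd(2)[OF S(1)] bnd(2)[OF scale[OF S(2), of "-1"]]] by (simp only: fourier_cmult)
      then show "norm (fourier (f n) m - fourier a m) \<le> bnd * nrm (\<lambda>t. f n t - a t)"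
        using fourier_bound[OF bnd(2)[OF diff[OF S]], of n m] by simp
    qed
    show "(\<lambda>n. bnd * nrm (\<lambda>t. f n t - a t)) \<longlonglongrightarrow> 0"
      using assms tendsto_mult_right_zero by (auto simp: sconv_def)
  qed
  then show ?thesis by (simp add: LIM_zero_iff)
qed

definition exp_sum :: "(complex \<Rightarrow> complex) \<Rightarrow> nat \<Rightarrow> complex \<Rightarrow> complex"
  where "exp_sum b n = (\<lambda>t. \<Sum>k<n. b t ^ k / fact k)"

lemma power_in: "b \<in> S \<Longrightarrow> (\<lambda>t. b t ^ k) \<in> S"
  by (induction k) (use one mult in auto)

text \<open>Only positive exponents occur, because the norm of the constant 1 is not assumed to be
  1.\<close>

lemma nrm_power: "b \<in> S \<Longrightarrow> nrm (\<lambda>t. b t ^ Suc k) \<le> nrm b ^ Suc k"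
proof (induction k)
  case (Suc k)
  have "nrm (\<lambda>t. b t * b t ^ Suc k) \<le> nrm b * nrm (\<lambda>t. b t ^ Suc k)"
    by (rule nrm_mult[OF Suc.prems power_in[OF Suc.prems]])
  also have "\<dots> \<le> nrm b * nrm b ^ Suc k"
    by (intro mult_left_mono Suc nrm_nonneg[OF Suc.prems])
  finally show ?case by simp
qed simp

lemma exp_term_in: "b \<in> S \<Longrightarrow> (\<lambda>t. b t ^ k / fact k) \<in> S"
  using scale[OF power_in, of b "1 / fact k" k] by simp

lemma sum_in: "(\<And>i. i \<in> I \<Longrightarrow> f i \<in> S) \<Longrightarrow> (\<lambda>t. \<Sum>i\<in>I. f i t) \<in> S"
  by (induction I rule: infinite_finite_induct) (auto intro: zero add)

lemma exp_sum_in: "b \<in> S \<Longrightarrow> exp_sum b n \<in> S"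
  unfolding exp_sum_def by (intro sum_in exp_term_in)

lemma nrm_sum: "finite I \<Longrightarrow> (\<And>i. i \<in> I \<Longrightarrow> f i \<in> S) \<Longrightarrow> nrm (\<lambda>t. \<Sum>i\<in>I. f i t) \<le> (\<Sum>i\<in>I. nrm (f i))"
proof (induction I rule: finite_induct)
  case (insert x I)
  have "nrm (\<lambda>t. f x t + (\<Sum>i\<in>I. f i t)) \<le> nrm (f x) + nrm (\<lambda>t. \<Sum>i\<in>I. f i t)"
    using insert.prems by (intro nrm_add sum_in) auto
  then show ?case using insert by simp
qed simp

lemma nrm_exp_sum_tail:
  assumes b: "b \<in> S" and m: "1 \<le> m"
  shows "nrm (\<lambda>t. \<Sum>k\<in>{m..<n}. b t ^ k / fact k) \<le> (\<Sum>k\<in>{m..<n}. nrm b ^ k / fact k)"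
proof -
  have "nrm (\<lambda>t. \<Sum>k\<in>{m..<n}. b t ^ k / fact k) \<le> (\<Sum>k\<in>{m..<n}. nrm (\<lambda>t. b t ^ k / fact k))"
    by (intro nrm_sum exp_term_in b) simp
  also have "\<dots> \<le> (\<Sum>k\<in>{m..<n}. nrm b ^ k / fact k)"
  proof (rule sum_mono)
    fix k assume "k \<in> {m..<n}"
    then obtain i where k: "k = Suc i" using m by (cases k) auto
    have "nrm (\<lambda>t. b t ^ k / fact k) = nrm (\<lambda>t. b t ^ k) / fact k"
      using nrm_scale[OF power_in[OF b], of "1 / fact k" k] by (simp add: norm_divide)
    then show "nrm (\<lambda>t. b t ^ k / fact k) \<le> nrm b ^ k / fact k"
      using nrm_power[OF b, of i] by (simp add: k divide_right_mono del: power_Suc)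
  qed
  finally show ?thesis .
qed

text \<open>Completeness yields some limit in \<open>S\<close>; the embedding into bounded functions
  identifies it almost everywhere with the pointwise exponential, which then belongs to
  \<open>S\<close> by \<open>ae_closed\<close>.\<close>

theorem exp_sconv:
  assumes b: "b \<in> S"
  shows "sconv (exp_sum b) (\<lambda>t. exp (b t))"
proof -
  let ?r = "\<lambda>k. nrm b ^ k / fact k"
  have sr: "summable ?r" using summable_exp[of "nrm b"] by (simp add: field_simps)
  have diff_eq: "(\<lambda>t. exp_sum b n t - exp_sum b m t) = (\<lambda>t. \<Sum>k\<in>{m..<n}. b t ^ k / fact k)" if "m \<le> n" for m n
    using that by (auto simp: exp_sum_def sum_diff_nat_ivl lessThan_atLeast0 fun_eq_iff)
  have "\<exists>n0. \<forall>m\<ge>n0. \<forall>n\<ge>n0. nrm (\<lambda>t. exp_sum b m t - exp_sum b n t) < e" if e: "0 < e" for e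
  proof -
    obtain N where N: "\<And>m n. N \<le> m \<Longrightarrow> norm (sum ?r {m..<n}) < e"
      using sr e unfolding summable_Cauchy by blast
    have main: "nrm (\<lambda>t. exp_sum b n t - exp_sum b m t) < e" if "max 1 N \<le> m" "m \<le> n" for m n
    proof -
      have "nrm (\<lambda>t. exp_sum b n t - exp_sum b m t) \<le> sum ?r {m..<n}"
        unfolding diff_eq[OF that(2)] using that by (intro nrm_exp_sum_tail b) simp
      also have "\<dots> < e" using N[of m n] that by auto
      finally show ?thesis .
    qed
    have "nrm (\<lambda>t. exp_sum b m t - exp_sum b n t) < e" if "max 1 N \<le> m" "max 1 N \<le> n" for m n
      using main[of m n] main[of n m] that nrm_diff_commute[OF exp_sum_in[OF b] exp_sum_in[OF b], of m n]
      by (cases "m \<le> n") auto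
    then show ?thesis by blast
  qed
  then obtain a where a: "a \<in> S" "(\<lambda>n. nrm (\<lambda>t. exp_sum b n t - a t)) \<longlonglongrightarrow> 0"
    using complete[of "exp_sum b"] exp_sum_in[OF b] by blast
  \<comment> \<open>One null set serves all n at once, being a countable union.\<close>
  have "AE \<theta> in circle_measure. \<forall>n. cmod (exp_sum b n (cis \<theta>) - a (cis \<theta>)) \<le> bnd * nrm (\<lambda>t. exp_sum b n t - a t)"
    using bnd(2)[OF diff[OF exp_sum_in[OF b] a(1)]] unfolding AE_all_countable circle_bdd_def ess_bdd_def by blast
  then have "circle_ae_eq a (\<lambda>t. exp (b t))"
    unfolding circle_ae_eq_def
  proof eventually_elim
    case (elim \<theta>)
    have lim: "(\<lambda>n. bnd * nrm (\<lambda>t. exp_sum b n t - a t)) \<longlonglongrightarrow> 0"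
      using tendsto_mult_right_zero[OF a(2)] .
    have "(\<lambda>n. exp_sum b n (cis \<theta>) - a (cis \<theta>)) \<longlonglongrightarrow> 0"
      by (rule Lim_null_comparison[OF always_eventually lim]) (rule elim)
    then have "(\<lambda>n. exp_sum b n (cis \<theta>)) \<longlonglongrightarrow> a (cis \<theta>)" by (simp add: LIM_zero_iff)
    moreover have "(\<lambda>n. exp_sum b n (cis \<theta>)) \<longlonglongrightarrow> exp (b (cis \<theta>))"
      using exp_converges[of "b (cis \<theta>)"] unfolding sums_def exp_sum_def
      by (simp add: scaleR_conv_of_real divide_inverse mult.commute)
    ultimately show ?case by (rule LIMSEQ_unique)
  qed
  note ae = this
  have e: "(\<lambda>t. exp (b t)) \<in> S" by (rule ae_closed[OF a(1) ae])
  have "nrm (\<lambda>t. exp_sum b n t - exp (b t)) = nrm (\<lambda>t. exp_sum b n t - a t)" for n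
    using ae by (intro nrm_cong diff exp_sum_in b e a) (auto simp: circle_ae_eq_def elim!: eventually_mono)
  then show ?thesis using a e exp_sum_in[OF b] by (simp add: sconv_def)
qed

lemma exp_in: "b \<in> S \<Longrightarrow> (\<lambda>t. exp (b t)) \<in> S"
  using exp_sconv by (simp add: sconv_def)

lemma nrm_exp_remainder:
  assumes b: "b \<in> S"
  shows "nrm (\<lambda>t. exp (b t) - 1 - b t) \<le> (nrm b)\<^sup>2 * exp (nrm b)"
proof (rule LIMSEQ_le_const2)
  have S: "(\<lambda>t. exp (b t)) \<in> S" "exp_sum b n \<in> S" for n using exp_in exp_sum_in b by auto
  have r: "(\<lambda>t. exp (b t) - 1 - b t) \<in> S" by (intro diff S one b)
  have rn: "(\<lambda>t. exp_sum b n t - 1 - b t) \<in> S" for n by (intro diff S one b)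
  have le: "\<bar>nrm (\<lambda>t. exp_sum b n t - 1 - b t) - nrm (\<lambda>t. exp (b t) - 1 - b t)\<bar> \<le> nrm (\<lambda>t. exp_sum b n t - exp (b t))" for n
    using nrm_le_diff[OF r rn[of n]] nrm_le_diff[OF rn[of n] r] nrm_diff_commute[OF S(1) S(2)[of n]] by simp
  have lim: "(\<lambda>n. nrm (\<lambda>t. exp_sum b n t - exp (b t))) \<longlonglongrightarrow> 0"
    using exp_sconv[OF b] by (simp add: sconv_def)
  have "(\<lambda>n. nrm (\<lambda>t. exp_sum b n t - 1 - b t) - nrm (\<lambda>t. exp (b t) - 1 - b t)) \<longlonglongrightarrow> 0"
    by (rule Lim_null_comparison[OF always_eventually lim]) (simp add: le)
  then show "(\<lambda>n. nrm (\<lambda>t. exp_sum b n t - 1 - b t)) \<longlonglongrightarrow> nrm (\<lambda>t. exp (b t) - 1 - b t)"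
    by (simp add: LIM_zero_iff)
  have "nrm (\<lambda>t. exp_sum b n t - 1 - b t) \<le> (nrm b)\<^sup>2 * exp (nrm b)" if n: "2 \<le> n" for n
  proof -
    have "{..<n} = {0, 1} \<union> {2..<n}" using n by auto
    then have "exp_sum b n t = 1 + b t + (\<Sum>k\<in>{2..<n}. b t ^ k / fact k)" for t
      by (simp add: exp_sum_def sum.union_disjoint)
    then have "(\<lambda>t. exp_sum b n t - 1 - b t) = (\<lambda>t. \<Sum>k\<in>{2..<n}. b t ^ k / fact k)" by auto
    then have "nrm (\<lambda>t. exp_sum b n t - 1 - b t) \<le> (\<Sum>k\<in>{2..<n}. nrm b ^ k / fact k)"
      using nrm_exp_sum_tail[OF b, of 2 n] by simp
    also have "\<dots> = (\<Sum>k<n - 2. nrm b ^ (k + 2) / fact (k + 2))"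
    proof (rule sum.reindex_bij_witness[where i = "\<lambda>k. k + 2" and j = "\<lambda>k. k - 2"])
      fix k assume "k \<in> {2..<n}"
      then have "k - 2 + 2 = k" by (metis atLeastLessThan_iff le_add_diff_inverse2)
      then show "nrm b ^ (k - 2 + 2) / fact (k - 2 + 2) = nrm b ^ k / fact k" by (simp only:)
    qed (use n in auto)
    also have "\<dots> \<le> (\<Sum>k<n - 2. (nrm b)\<^sup>2 * (nrm b ^ k / fact k))"
    proof (rule sum_mono)
      fix k
      have "(fact k :: real) \<le> fact (k + 2)" by (rule fact_mono) simp
      then have "nrm b ^ (k + 2) / fact (k + 2) \<le> nrm b ^ (k + 2) / fact k"
        using nrm_nonneg[OF b] by (intro divide_left_mono) auto
      moreover have "(nrm b)\<^sup>2 * (nrm b ^ k / fact k) = nrm b ^ (k + 2) / fact k"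
        by (simp add: power2_eq_square)
      ultimately show "nrm b ^ (k + 2) / fact (k + 2) \<le> (nrm b)\<^sup>2 * (nrm b ^ k / fact k)" by (simp only:)
    qed
    also have "\<dots> = (nrm b)\<^sup>2 * (\<Sum>k<n - 2. nrm b ^ k / fact k)" by (simp add: sum_distrib_left)
    also have "\<dots> \<le> (nrm b)\<^sup>2 * exp (nrm b)"
    proof (rule mult_left_mono)
      have "(\<lambda>k. nrm b ^ k / fact k) sums exp (nrm b)"
        using exp_converges[of "nrm b"] by (simp add: divide_inverse mult.commute)
      then show "(\<Sum>k<n - 2. nrm b ^ k / fact k) \<le> exp (nrm b)"
        using sum_le_suminf[of "\<lambda>k. nrm b ^ k / fact k" "{..<n - 2}"] nrm_nonneg[OF b]
        by (simp add: sums_iff)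
    qed simp
    finally show ?thesis .
  qed
  then show "\<exists>N. \<forall>n\<ge>N. nrm (\<lambda>t. exp_sum b n t - 1 - b t) \<le> (nrm b)\<^sup>2 * exp (nrm b)" by blast
qed

text \<open>After multiplication by n the quadratic remainder at b/n is still of order 1/n. This is
  where the generators of the one-parameter groups come from; \<open>Suc n\<close> keeps the
  denominator nonzero.\<close>

lemma sconv_exp_difference_quotient:
  assumes b: "b \<in> S"
  shows "sconv (\<lambda>n t. of_nat (Suc n) * (exp (b t / of_nat (Suc n)) - 1)) b"
proof -
  have bn: "(\<lambda>t. b t / of_nat (Suc n)) \<in> S" for n using scale[OF b, of "1 / of_nat (Suc n)"] by simp
  have nbn: "nrm (\<lambda>t. b t / of_nat (Suc n)) = nrm b / real (Suc n)" for n
    using nrm_scale[OF b, of "1 / of_nat (Suc n)"] by (simp add: norm_divide del: of_nat_Suc)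
  have fS: "(\<lambda>t. of_nat (Suc n) * (exp (b t / of_nat (Suc n)) - 1)) \<in> S" for n
    by (intro scale diff exp_in bn one)
  have le: "nrm (\<lambda>t. of_nat (Suc n) * (exp (b t / of_nat (Suc n)) - 1) - b t)
    \<le> (nrm b)\<^sup>2 * exp (nrm b) * inverse (real (Suc n))" for n
  proof -
    let ?m = "of_nat (Suc n) :: complex"
    let ?r = "\<lambda>t. exp (b t / ?m) - 1 - b t / ?m"
    have "(\<lambda>t. ?m * (exp (b t / ?m) - 1) - b t) = (\<lambda>t. ?m * ?r t)"
      by (auto simp: right_diff_distrib simp del: of_nat_Suc)
    then have "nrm (\<lambda>t. ?m * (exp (b t / ?m) - 1) - b t) = cmod ?m * nrm ?r"
      using nrm_scale[of ?r ?m] by (simp add: diff exp_in bn one del: of_nat_Suc)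
    also have "\<dots> \<le> real (Suc n) * ((nrm b / real (Suc n))\<^sup>2 * exp (nrm b / real (Suc n)))"
      using nrm_exp_remainder[OF bn[of n]] unfolding nbn norm_of_nat by (intro mult_left_mono) auto
    also have "\<dots> \<le> real (Suc n) * ((nrm b / real (Suc n))\<^sup>2 * exp (nrm b))"
      using nrm_nonneg[OF b] by (intro mult_left_mono) (auto simp: divide_le_eq mult_le_cancel_left1)
    also have "\<dots> = (nrm b)\<^sup>2 * exp (nrm b) * inverse (real (Suc n))"
      by (simp add: power2_eq_square field_simps del: of_nat_Suc)
    finally show ?thesis .
  qed
  have lim: "(\<lambda>n. (nrm b)\<^sup>2 * exp (nrm b) * inverse (real (Suc n))) \<longlonglongrightarrow> 0"
    by (rule tendsto_mult_right_zero[OF LIMSEQ_inverse_real_of_nat])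
  have "(\<lambda>n. nrm (\<lambda>t. of_nat (Suc n) * (exp (b t / of_nat (Suc n)) - 1) - b t)) \<longlonglongrightarrow> 0"
  proof (rule Lim_null_comparison[OF always_eventually lim], rule allI)
    fix n
    show "norm (nrm (\<lambda>t. of_nat (Suc n) * (exp (b t / of_nat (Suc n)) - 1) - b t))
      \<le> (nrm b)\<^sup>2 * exp (nrm b) * inverse (real (Suc n))"
      using le[of n] nrm_nonneg[OF diff[OF fS[of n] b]] unfolding real_norm_def by linarith
  qed
  then show ?thesis using fS b by (simp add: sconv_def)
qed

end

lemma has_sum_fun_zero:
  assumes "(f has_sum s) UNIV" "\<And>l. l \<noteq> k \<Longrightarrow> f l = 0"
  shows "s = (f k :: complex)"
proof -
  have "(f has_sum sum f {k}) {k}" by (rule has_sum_finite) simp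
  then have "(f has_sum sum f {k}) UNIV"
    by (rule has_sum_cong_neutral[THEN iffD1, rotated -1]) (use assms(2) in auto)
  then have "infsum f UNIV = sum f {k}" by (rule infsumI)
  then show ?thesis using infsumI[OF assms(1)] by simp
qed

context circle_banach_algebra
begin

section \<open>Plus and minus parts, and continuity of the linear maps\<close>

lemma bndS: "a \<in> S \<Longrightarrow> circle_bdd a (bnd * nrm a)" by (rule bnd(2))

text \<open>The convolution of two plus functions runs over 0 <= l <= m, so it is empty for m < 0
  and has the single term l = 0 for m = 0.\<close>

lemma fourier_mult_plus:
  assumes a: "a \<in> plus_part S" and b: "b \<in> plus_part S"
  shows "(\<lambda>t. a t * b t) \<in> plus_part S" "fourier (\<lambda>t. a t * b t) 0 = fourier a 0 * fourier b 0"
proof -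
  have S: "a \<in> S" "b \<in> S" using a b by (auto simp: plus_part_def)
  have z: "fourier a l * fourier b (m - l) = 0" if "l \<noteq> 0 \<or> m \<noteq> 0" "m \<le> 0" for l m
    using a b that by (cases "l < 0") (auto simp: plus_part_def)
  note hs = fourier_mult_has_sum[OF bndS[OF S(1)] bndS[OF S(2)]]
  have "fourier (\<lambda>t. a t * b t) m = 0" if "m < 0" for m
    using has_sum_fun_zero[OF hs[of m], of 0] z[of _ m] z[of 0 m] that by auto
  then show "(\<lambda>t. a t * b t) \<in> plus_part S" using mult[OF S] by (simp add: plus_part_def)
  show "fourier (\<lambda>t. a t * b t) 0 = fourier a 0 * fourier b 0"
    using has_sum_fun_zero[OF hs[of 0], of 0] z[of _ 0] by simp
qed

lemma fourier_addS: "a \<in> S \<Longrightarrow> b \<in> S \<Longrightarrow> fourier (\<lambda>t. a t + b t) n = fourier a n + fourier b n"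
  by (rule fourier_add[OF bndS bndS])

lemma plus_add: "a \<in> plus_part S \<Longrightarrow> b \<in> plus_part S \<Longrightarrow> (\<lambda>t. a t + b t) \<in> plus_part S"
  by (auto simp: plus_part_def add fourier_addS)

lemma plus_scale: "a \<in> plus_part S \<Longrightarrow> (\<lambda>t. z * a t) \<in> plus_part S"
  by (auto simp: plus_part_def scale fourier_cmult)

lemma minus_add: "a \<in> minus_part S \<Longrightarrow> b \<in> minus_part S \<Longrightarrow> (\<lambda>t. a t + b t) \<in> minus_part S"
  by (auto simp: minus_part_def add fourier_addS)

lemma minus_scale: "a \<in> minus_part S \<Longrightarrow> (\<lambda>t. z * a t) \<in> minus_part S"
  by (auto simp: minus_part_def scale fourier_cmult)

lemma plus_one: "(\<lambda>_. 1) \<in> plus_part S" and minus_one: "(\<lambda>_. 1) \<in> minus_part S"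
  by (auto simp: plus_part_def minus_part_def one fourier_one)

lemma exp_sum_plus:
  assumes u: "u \<in> plus_part S"
  shows "exp_sum u n \<in> plus_part S \<and> fourier (exp_sum u n) 0 = (\<Sum>k<n. fourier u 0 ^ k / fact k)"
proof (induction n)
  case 0
  have "(\<lambda>_. 0) \<in> plus_part S" using plus_scale[OF plus_one, of 0] by simp
  moreover have "fourier (\<lambda>_. 0) 0 = 0" using fourier_cmult[of 0 "\<lambda>_. 1" 0] by simp
  ultimately show ?case by (simp add: exp_sum_def)
next
  case (Suc n)
  have pw: "(\<lambda>t. u t ^ k) \<in> plus_part S \<and> fourier (\<lambda>t. u t ^ k) 0 = fourier u 0 ^ k" for k
    by (induction k) (use plus_one fourier_mult_plus[OF u] in \<open>auto simp: fourier_one\<close>)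
  have t: "(\<lambda>t. (1 / fact n) * u t ^ n) \<in> plus_part S" using pw plus_scale by blast
  have e: "exp_sum u (Suc n) = (\<lambda>t. exp_sum u n t + (1 / fact n) * u t ^ n)"
    by (simp add: exp_sum_def)
  have "fourier (exp_sum u (Suc n)) 0 = fourier (exp_sum u n) 0 + (1 / fact n) * fourier u 0 ^ n"
  proof -
    have f: "fourier (\<lambda>t. (1 / fact n) * u t ^ n) 0 = (1 / fact n) * fourier u 0 ^ n"
      unfolding fourier_cmult using pw[of n] by simp
    show ?thesis unfolding e f[symmetric]
      by (rule fourier_addS) (use Suc t in \<open>auto simp: plus_part_def\<close>)
  qed
  moreover have "exp_sum u (Suc n) \<in> plus_part S" unfolding e using Suc t by (intro plus_add) auto
  ultimately show ?case using Suc by simp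
qed

text \<open>The zeroth coefficient is multiplicative on the plus part and therefore commutes with
  the exponential series. It is the diagonal of a triangular Toeplitz operator and leads to
  \<open>const_G\<close>.\<close>

lemma exp_plus:
  assumes u: "u \<in> plus_part S"
  shows "(\<lambda>t. exp (u t)) \<in> plus_part S" "fourier (\<lambda>t. exp (u t)) 0 = exp (fourier u 0)"
proof -
  have S: "u \<in> S" using u by (simp add: plus_part_def)
  note lim = sconv_fourier[OF exp_sconv[OF S]]
  have "fourier (\<lambda>t. exp (u t)) m = 0" if "m < 0" for m
  proof -
    have "(\<lambda>n. 0) \<longlonglongrightarrow> fourier (\<lambda>t. exp (u t)) m"
      using lim[of m] exp_sum_plus[OF u] that by (simp add: plus_part_def)
    then show ?thesis by (rule LIMSEQ_unique[OF _ tendsto_const])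
  qed
  then show "(\<lambda>t. exp (u t)) \<in> plus_part S" using exp_in[OF S] by (simp add: plus_part_def)
  have "(\<lambda>n. \<Sum>k<n. fourier u 0 ^ k / fact k) \<longlonglongrightarrow> fourier (\<lambda>t. exp (u t)) 0"
    using lim[of 0] exp_sum_plus[OF u] by simp
  moreover have "(\<lambda>n. \<Sum>k<n. fourier u 0 ^ k / fact k) \<longlonglongrightarrow> exp (fourier u 0)"
    using exp_converges[of "fourier u 0"] unfolding sums_def
    by (simp add: scaleR_conv_of_real divide_inverse mult.commute)
  ultimately show "fourier (\<lambda>t. exp (u t)) 0 = exp (fourier u 0)" by (rule LIMSEQ_unique)
qed

lemma nonneg_const:
  assumes "\<exists>C. \<forall>a\<in>S. X a \<le> C * nrm a"
  obtains C where "0 \<le> C" "\<And>a. a \<in> S \<Longrightarrow> X a \<le> C * nrm a"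
proof -
  obtain C where C: "\<And>a. a \<in> S \<Longrightarrow> X a \<le> C * nrm a" using assms by blast
  have "X a \<le> \<bar>C\<bar> * nrm a" if "a \<in> S" for a
  proof -
    have "C * nrm a \<le> \<bar>C\<bar> * nrm a" using nrm_nonneg[OF that] by (intro mult_right_mono) auto
    then show ?thesis using C[OF that] by simp
  qed
  then show ?thesis using that[of "\<bar>C\<bar>"] by simp
qed

lemma toeplitz_norm: "a \<in> S \<Longrightarrow> norm (toeplitz a) \<le> bnd * nrm a"
  by (rule toeplitz_op(2)[OF bndS])

lemma toeplitz_addS: "a \<in> S \<Longrightarrow> b \<in> S \<Longrightarrow> toeplitz (\<lambda>t. a t + b t) = toeplitz a + toeplitz b"
  by (rule toeplitz_add[OF bndS bndS])

lemma hankel_addS: "a \<in> S \<Longrightarrow> b \<in> S \<Longrightarrow> hankel (\<lambda>t. a t + b t) = hankel a + hankel b"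
  by (rule hankel_add[OF bndS bndS])

lemma toeplitz_scaleS: "a \<in> S \<Longrightarrow> toeplitz (\<lambda>t. z * a t) = z *\<^sub>C toeplitz a"
  by (rule toeplitz_scale[OF bndS])

lemma hankel_scaleS: "a \<in> S \<Longrightarrow> hankel (\<lambda>t. z * a t) = z *\<^sub>C hankel a"
  by (rule hankel_scale[OF bndS])

lemma hankel_one: "hankel (\<lambda>_. 1) = 0"
  by (rule hankel_eq_0[OF bndS[OF one]]) (simp add: fourier_one)

lemma hankel_minus: "a \<in> minus_part S \<Longrightarrow> hankel a = 0"
  using hankel_eq_0[OF bndS[of a]] by (simp add: minus_part_def)

lemma linear_diff:
  assumes "\<And>a b. a \<in> S \<Longrightarrow> b \<in> S \<Longrightarrow> L (\<lambda>t. a t + b t) = L a + (L b :: ell2_op)"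
    and "\<And>a z. a \<in> S \<Longrightarrow> L (\<lambda>t. z * a t) = z *\<^sub>C L a" and "a \<in> S" "b \<in> S"
  shows "L (\<lambda>t. a t - b t) = L a - L b"
  using assms(1)[OF assms(3) scale[OF assms(4), of "-1"]] assms(2)[OF assms(4), of "-1"]
  by (simp add: op_algebra_scaleC)

lemma hankel_diff: "a \<in> S \<Longrightarrow> b \<in> S \<Longrightarrow> hankel (\<lambda>t. a t - b t) = hankel a - hankel b"
  by (rule linear_diff[OF hankel_addS hankel_scaleS])

lemma sconv_linear:
  assumes "\<And>a b. a \<in> S \<Longrightarrow> b \<in> S \<Longrightarrow> L (\<lambda>t. a t + b t) = L a + (L b :: ell2_op)"
    and "\<And>a z. a \<in> S \<Longrightarrow> L (\<lambda>t. z * a t) = z *\<^sub>C L a"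
    and bound: "\<And>a. a \<in> S \<Longrightarrow> norm (L a) \<le> C * nrm a" and f: "sconv f a"
  shows "(\<lambda>n. L (f n)) \<longlonglongrightarrow> L a"
proof -
  have S: "f n \<in> S" "a \<in> S" for n using f by (simp_all add: sconv_def)
  have lim: "(\<lambda>n. C * nrm (\<lambda>t. f n t - a t)) \<longlonglongrightarrow> 0"
    using f tendsto_mult_right_zero by (auto simp: sconv_def)
  have eq: "L (f n) - L a = L (\<lambda>t. f n t - a t)" for n
    by (rule linear_diff[of L, OF assms(1,2) S, symmetric])
  have "(\<lambda>n. L (f n) - L a) \<longlonglongrightarrow> 0"
  proof (rule Lim_null_comparison[OF always_eventually lim], rule allI)
    show "norm (L (f n) - L a) \<le> C * nrm (\<lambda>t. f n t - a t)" for n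
      unfolding eq by (rule bound[OF diff[OF S]])
  qed
  then show ?thesis by (simp add: LIM_zero_iff)
qed

lemma sconv_toeplitz: "sconv f a \<Longrightarrow> (\<lambda>n. toeplitz (f n)) \<longlonglongrightarrow> toeplitz a"
  by (rule sconv_linear[OF toeplitz_addS toeplitz_scaleS toeplitz_norm])

lemma sconv_exp_one:
  assumes b: "b \<in> S"
  shows "sconv (\<lambda>n t. exp (b t / of_nat (Suc n))) (\<lambda>_. 1)"
proof -
  let ?q = "\<lambda>n t. of_nat (Suc n) * (exp (b t / of_nat (Suc n)) - 1)"
  have q: "sconv ?q b" by (rule sconv_exp_difference_quotient[OF b])
  then have qS: "?q n \<in> S" for n by (simp add: sconv_def)
  have e: "(\<lambda>t. exp (b t / of_nat (Suc n)) - 1) = (\<lambda>t. (1 / of_nat (Suc n)) * ?q n t)" for n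
    by (simp del: of_nat_Suc)
  have eS: "(\<lambda>t. exp (b t / of_nat (Suc n))) \<in> S" for n
    using exp_in[OF scale[OF b, of "1 / of_nat (Suc n)"]] by simp
  have nq: "nrm (\<lambda>t. exp (b t / of_nat (Suc n)) - 1) = inverse (real (Suc n)) * nrm (?q n)" for n
    unfolding e nrm_scale[OF qS] by (simp add: norm_divide norm_inverse inverse_eq_divide del: of_nat_Suc)
  have "(\<lambda>n. nrm (?q n) - nrm b) \<longlonglongrightarrow> 0"
  proof (rule Lim_null_comparison[OF always_eventually], rule allI)
    fix n
    have bS: "nrm (\<lambda>t. b t - ?q n t) = nrm (\<lambda>t. ?q n t - b t)" by (rule nrm_diff_commute[OF b qS])
    show "norm (nrm (?q n) - nrm b) \<le> nrm (\<lambda>t. ?q n t - b t)"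
      using nrm_le_diff[OF qS[of n] b] nrm_le_diff[OF b qS[of n]] unfolding bS real_norm_def by linarith
    show "(\<lambda>n. nrm (\<lambda>t. ?q n t - b t)) \<longlonglongrightarrow> 0" using q by (simp add: sconv_def)
  qed
  then have "(\<lambda>n. nrm (?q n)) \<longlonglongrightarrow> nrm b" by (simp add: LIM_zero_iff)
  then have "(\<lambda>n. inverse (real (Suc n)) * nrm (?q n)) \<longlonglongrightarrow> 0 * nrm b"
    by (intro tendsto_mult LIMSEQ_inverse_real_of_nat)
  then show ?thesis using eS one by (simp add: sconv_def nq del: of_nat_Suc)
qed

end

context compatible_pair
begin

section \<open>Toeplitz operators and \<open>M\<close> on a compatible pair\<close>

lemma tilde_in: "a \<in> S \<Longrightarrow> Defs.tilde a \<in> S"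
  using tilde by blast

lemma tilde_plus: "a \<in> plus_part S \<Longrightarrow> Defs.tilde a \<in> minus_part S"
  and tilde_minus: "a \<in> minus_part S \<Longrightarrow> Defs.tilde a \<in> plus_part S"
  by (auto simp: plus_part_def minus_part_def tilde_in fourier_tilde)

lemma exp_minus_part:
  assumes "v \<in> minus_part S"
  shows "(\<lambda>t. exp (v t)) \<in> minus_part S" "fourier (\<lambda>t. exp (v t)) 0 = exp (fourier v 0)"
proof -
  have e: "(\<lambda>t. exp (v t)) = Defs.tilde (\<lambda>t. exp (Defs.tilde v t))" by (simp add: tilde_def)
  note p = exp_plus[OF tilde_minus[OF assms]]
  show "(\<lambda>t. exp (v t)) \<in> minus_part S" unfolding e by (rule tilde_plus[OF p(1)])
  show "fourier (\<lambda>t. exp (v t)) 0 = exp (fourier v 0)"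
    unfolding e fourier_tilde using p(2) by (simp add: fourier_tilde)
qed

lemma toeplitz_multS:
  "a \<in> S \<Longrightarrow> b \<in> S \<Longrightarrow> toeplitz (\<lambda>t. a t * b t) = toeplitz a * toeplitz b + hankel a * hankel (Defs.tilde b)"
  by (rule toeplitz_mult[OF bndS bndS bndS[OF tilde_in]])

lemma toeplitz_mult_minus:
  "a \<in> minus_part S \<Longrightarrow> b \<in> S \<Longrightarrow> toeplitz (\<lambda>t. a t * b t) = toeplitz a * toeplitz b"
  using toeplitz_multS[of a b] hankel_minus[of a] by (simp add: minus_part_def)

lemma toeplitz_mult_plus:
  "a \<in> S \<Longrightarrow> b \<in> plus_part S \<Longrightarrow> toeplitz (\<lambda>t. a t * b t) = toeplitz a * toeplitz b"
  using toeplitz_multS[of a b] hankel_minus[OF tilde_plus, of b] by (simp add: plus_part_def)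

lemma M_minus: "a \<in> minus_part S \<Longrightarrow> b \<in> S \<Longrightarrow> M (\<lambda>t. a t * b t) = toeplitz a * M b"
  using M_mult[of a b "\<lambda>_. 1"] one by (simp add: even_part_def circle_ae_eq_def tilde_def M_one)

lemma M_even: "b \<in> S \<Longrightarrow> c \<in> even_part S \<Longrightarrow> M (\<lambda>t. b t * c t) = M b * M c"
  using M_mult[OF minus_one, of b c] by (simp add: toeplitz_one)

lemma M_minus_eq: "a \<in> minus_part S \<Longrightarrow> M a = toeplitz a"
  using M_minus[OF _ one, of a] by (simp add: M_one)

definition \<Delta> :: "(complex \<Rightarrow> complex) \<Rightarrow> ell2_op" where "\<Delta> a = M a - toeplitz a"

lemma Delta_tc: "a \<in> S \<Longrightarrow> trace_class (\<Delta> a)"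
  using M_toeplitz by (auto simp: \<Delta>_def)

lemma Delta_add: "a \<in> S \<Longrightarrow> b \<in> S \<Longrightarrow> \<Delta> (\<lambda>t. a t + b t) = \<Delta> a + \<Delta> b"
  by (simp add: \<Delta>_def M_add toeplitz_addS)

lemma Delta_scale: "a \<in> S \<Longrightarrow> \<Delta> (\<lambda>t. z * a t) = z *\<^sub>C \<Delta> a"
  by (rule op_eqI) (simp add: \<Delta>_def M_scale toeplitz_scaleS entry_simps algebra_simps)

lemma Delta_diff: "a \<in> S \<Longrightarrow> b \<in> S \<Longrightarrow> \<Delta> (\<lambda>t. a t - b t) = \<Delta> a - \<Delta> b"
  by (rule linear_diff[OF Delta_add Delta_scale])

lemma Delta_minus: "a \<in> minus_part S \<Longrightarrow> \<Delta> a = 0"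
  by (simp add: \<Delta>_def M_minus_eq)

lemma Delta_bound: obtains C where "0 \<le> C" "\<And>a. a \<in> S \<Longrightarrow> trace_norm (\<Delta> a) \<le> C * nrm a"
proof -
  have "\<exists>C. \<forall>a\<in>S. trace_norm (\<Delta> a) \<le> C * nrm a" using M_toeplitz unfolding \<Delta>_def by blast
  then show ?thesis by (rule nonneg_const) (rule that)
qed

lemma sconv_Delta:
  assumes f: "sconv f a"
  shows "tends_tc (\<lambda>n. \<Delta> (f n)) (\<Delta> a)"
proof -
  have S: "f n \<in> S" "a \<in> S" for n using f by (simp_all add: sconv_def)
  obtain C where C: "0 \<le> C" "\<And>a. a \<in> S \<Longrightarrow> trace_norm (\<Delta> a) \<le> C * nrm a" by (rule Delta_bound) blast
  have "(\<lambda>n. trace_norm (\<Delta> (f n) - \<Delta> a)) \<longlonglongrightarrow> 0"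
  proof (rule trace_norm_le_imp_tendsto)
    show "trace_norm (\<Delta> (f n) - \<Delta> a) \<le> C * nrm (\<lambda>t. f n t - a t)" for n
      unfolding Delta_diff[OF S, symmetric] by (rule C(2)[OF diff[OF S]])
    show "(\<lambda>n. C * nrm (\<lambda>t. f n t - a t)) \<longlonglongrightarrow> 0"
      using f tendsto_mult_right_zero by (auto simp: sconv_def)
  qed (intro trace_class_diff Delta_tc S)
  then show ?thesis using S by (simp add: tends_tc_def Delta_tc)
qed

lemma sconv_M:
  assumes "sconv f a"
  shows "(\<lambda>n. M (f n)) \<longlonglongrightarrow> M a"
proof -
  obtain C where "\<And>a. a \<in> S \<Longrightarrow> norm (M a) \<le> C * nrm a" using M_bounded by blast
  then show ?thesis by (intro sconv_linear[of M, OF M_add M_scale _ assms])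
qed

text \<open>The Riesz projection turns the second factor into an even function with the same Hankel
  operator, for which the defining properties of the pair apply.\<close>

lemma hankel_hankel_bound:
  obtains C where "0 \<le> C" "\<And>a b. a \<in> S \<Longrightarrow> b \<in> S \<Longrightarrow>
    trace_class (hankel a * hankel b) \<and> trace_norm (hankel a * hankel b) \<le> C * nrm a * nrm b"
proof -
  obtain C1 where C1: "0 \<le> C1" "\<And>a. a \<in> S \<Longrightarrow> trace_norm (\<Delta> a) \<le> C1 * nrm a" by (rule Delta_bound) blast
  obtain C2 where C2: "0 \<le> C2" "\<And>a. a \<in> S \<Longrightarrow> norm (M a) \<le> C2 * nrm a"
    by (rule nonneg_const[OF M_bounded]) blast
  have "\<exists>C. \<forall>a\<in>S. nrm (Defs.tilde a) \<le> C * nrm a" using tilde by blast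
  then obtain C3 where C3: "0 \<le> C3" "\<And>a. a \<in> S \<Longrightarrow> nrm (Defs.tilde a) \<le> C3 * nrm a"
    by (rule nonneg_const) blast
  obtain C4 where C4: "\<forall>a\<in>S. \<exists>p\<in>S. (\<forall>n. fourier p n = (if 0 \<le> n then fourier a n else 0)) \<and> nrm p \<le> C4 * nrm a"
    using riesz_projection by blast
  define C5 where "C5 = (1 + C3) * \<bar>C4\<bar>"
  \<comment> \<open>The 4 and the 2 arise from applying the triangle inequality with factor 2
    twice.\<close>
  define C where "C = (4 * (C2 * C1 + bnd * C1) + 2 * C1) * C5"
  have "trace_class (hankel a * hankel b) \<and> trace_norm (hankel a * hankel b) \<le> C * nrm a * nrm b"
    if a: "a \<in> S" and b: "b \<in> S" for a b
  proof -
    obtain p where p: "p \<in> S" "\<And>n. fourier p n = (if 0 \<le> n then fourier b n else 0)" "nrm p \<le> C4 * nrm b"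
      using C4 b by blast
    \<comment> \<open>Symmetrizing doubles the zeroth coefficient, but Hankel operators see only
      positive indices.\<close>
    define c where "c t = p t + Defs.tilde p t" for t
    have cS: "c \<in> S" unfolding c_def[abs_def] by (intro add p tilde_in)
    have ct: "Defs.tilde c = c" by (auto simp: c_def tilde_def)
    have ce: "c \<in> even_part S" using cS by (simp add: even_part_def circle_ae_eq_def ct)
    have "fourier c n = fourier b n" if "0 < n" for n
      using that unfolding c_def[abs_def] by (simp add: fourier_addS p tilde_in fourier_tilde)
    then have H: "hankel c = hankel b" by (rule hankel_cong[OF bndS[OF cS] bndS[OF b]])
    have "nrm c \<le> nrm p + nrm (Defs.tilde p)" unfolding c_def[abs_def] by (intro nrm_add p tilde_in)
    also have "\<dots> \<le> (1 + C3) * nrm p" using C3(2)[OF p(1)] by (simp add: distrib_right)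
    also have "\<dots> \<le> (1 + C3) * (\<bar>C4\<bar> * nrm b)"
    proof (rule mult_left_mono)
      have "C4 * nrm b \<le> \<bar>C4\<bar> * nrm b" using nrm_nonneg[OF b] by (intro mult_right_mono) auto
      then show "nrm p \<le> \<bar>C4\<bar> * nrm b" using p(3) by simp
    qed (use C3 in simp)
    finally have nc: "nrm c \<le> C5 * nrm b" by (simp add: C5_def mult.assoc)
    \<comment> \<open>\<open>M\<close> is multiplicative on \<open>a * c\<close> while the Toeplitz
      map has the defect \<open>hankel a * hankel c\<close>. Comparing the two expresses this defect
      by values of \<open>\<Delta>\<close>.\<close>
    have eq: "hankel a * hankel b = (\<Delta> a * M c + toeplitz a * \<Delta> c) - \<Delta> (\<lambda>t. a t * c t)"
      using toeplitz_multS[OF a cS] M_even[OF a ce] by (simp add: ct H \<Delta>_def algebra_simps)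
    have tc: "trace_class (\<Delta> a)" "trace_class (\<Delta> c)" "trace_class (\<Delta> (\<lambda>t. a t * c t))"
      by (intro Delta_tc mult a cS)+
    have tc2: "trace_class (\<Delta> a * M c)" "trace_class (toeplitz a * \<Delta> c)"
      by (intro trace_class_mult_left trace_class_mult_right tc)+
    have n0: "0 \<le> nrm a" "0 \<le> nrm c" "0 \<le> nrm b" using nrm_nonneg a b cS by auto
    have "trace_norm (\<Delta> a * M c) \<le> C2 * nrm c * (C1 * nrm a)"
      by (rule order.trans[OF trace_class_mult_right(2)[OF tc(1)]])
        (intro mult_mono C1 C2 a cS trace_norm_nonneg tc mult_nonneg_nonneg n0)
    moreover have "trace_norm (toeplitz a * \<Delta> c) \<le> bnd * nrm a * (C1 * nrm c)"
      by (rule order.trans[OF trace_class_mult_left(2)[OF tc(2)]])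
        (intro mult_mono C1 toeplitz_norm a cS trace_norm_nonneg tc mult_nonneg_nonneg n0 bnd)
    moreover have "trace_norm (\<Delta> (\<lambda>t. a t * c t)) \<le> C1 * (nrm a * nrm c)"
      by (rule order.trans[OF C1(2)[OF mult[OF a cS]]]) (intro mult_left_mono nrm_mult a cS C1)
    moreover have "trace_norm (hankel a * hankel b)
      \<le> 2 * (2 * (trace_norm (\<Delta> a * M c) + trace_norm (toeplitz a * \<Delta> c)) + trace_norm (\<Delta> (\<lambda>t. a t * c t)))"
      unfolding eq
      by (rule order.trans[OF trace_class_diff(2)[OF trace_class_add(1)[OF tc2] tc(3)]])
        (intro mult_left_mono add_mono order_refl trace_class_add(2) tc2; simp)
    ultimately have "trace_norm (hankel a * hankel b) \<le> (4 * (C2 * C1 + bnd * C1) + 2 * C1) * nrm a * nrm c"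
      by (simp add: algebra_simps)
    also have "\<dots> \<le> (4 * (C2 * C1 + bnd * C1) + 2 * C1) * nrm a * (C5 * nrm b)"
      by (intro mult_left_mono nc mult_nonneg_nonneg n0) (use C1 C2 bnd in auto)
    also have "\<dots> = C * nrm a * nrm b" by (simp add: C_def mult_ac)
    finally show ?thesis using tc tc2 by (simp add: eq trace_class_add trace_class_diff)
  qed
  moreover have "0 \<le> C" unfolding C_def C5_def using C1 C2 C3 bnd by auto
  ultimately show ?thesis using that by blast
qed

lemma hankel_hankel_tc: "a \<in> S \<Longrightarrow> b \<in> S \<Longrightarrow> trace_class (hankel a * hankel b)"
  by (rule hankel_hankel_bound) blast

lemma sconv_hankel_hankel:
  assumes f: "sconv f a" and g: "sconv g b"
  shows "tends_tc (\<lambda>n. hankel (f n) * hankel (g n)) (hankel a * hankel b)"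
proof -
  have S: "f n \<in> S" "a \<in> S" "g n \<in> S" "b \<in> S" for n using f g by (simp_all add: sconv_def)
  obtain C where C: "0 \<le> C" "\<And>a b. a \<in> S \<Longrightarrow> b \<in> S \<Longrightarrow>
    trace_class (hankel a * hankel b) \<and> trace_norm (hankel a * hankel b) \<le> C * nrm a * nrm b"
    by (rule hankel_hankel_bound) blast
  let ?f = "\<lambda>n. nrm (\<lambda>t. f n t - a t)" and ?g = "\<lambda>n. nrm (\<lambda>t. g n t - b t)"
  have lim: "?f \<longlonglongrightarrow> 0" "?g \<longlonglongrightarrow> 0" using f g by (simp_all add: sconv_def)
  have eq: "hankel (f n) * hankel (g n) - hankel a * hankel b
    = hankel (\<lambda>t. f n t - a t) * hankel (g n) + hankel a * hankel (\<lambda>t. g n t - b t)" for n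
    by (simp add: hankel_diff S algebra_simps)
  have "(\<lambda>n. trace_norm (hankel (f n) * hankel (g n) - hankel a * hankel b)) \<longlonglongrightarrow> 0"
  proof (rule trace_norm_le_imp_tendsto)
    fix n
    show "trace_class (hankel (f n) * hankel (g n) - hankel a * hankel b)"
      by (intro trace_class_diff hankel_hankel_tc S)
    have 1: "trace_class (hankel (\<lambda>t. f n t - a t) * hankel (g n))"
      "trace_norm (hankel (\<lambda>t. f n t - a t) * hankel (g n)) \<le> C * ?f n * nrm (g n)"
      using C(2)[OF diff[OF S(1,2)] S(3), of n n] by auto
    have 2: "trace_class (hankel a * hankel (\<lambda>t. g n t - b t))"
      "trace_norm (hankel a * hankel (\<lambda>t. g n t - b t)) \<le> C * nrm a * ?g n"
      using C(2)[OF S(2) diff[OF S(3,4)], of n] by auto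
    have 3: "C * ?f n * nrm (g n) \<le> C * ?f n * (nrm b + ?g n)"
      by (intro mult_left_mono nrm_le_diff S mult_nonneg_nonneg C nrm_nonneg diff)
    show "trace_norm (hankel (f n) * hankel (g n) - hankel a * hankel b)
      \<le> 2 * (C * ?f n * (nrm b + ?g n) + C * nrm a * ?g n)"
      unfolding eq
      by (rule order.trans[OF trace_class_add(2)[OF 1(1) 2(1)]])
        (intro mult_left_mono add_mono order.trans[OF 1(2) 3] 2(2); simp)
  next
    have "(\<lambda>n. 2 * (C * ?f n * (nrm b + ?g n) + C * nrm a * ?g n)) \<longlonglongrightarrow> 2 * (C * 0 * (nrm b + 0) + C * nrm a * 0)"
      by (intro tendsto_intros lim)
    then show "(\<lambda>n. 2 * (C * ?f n * (nrm b + ?g n) + C * nrm a * ?g n)) \<longlonglongrightarrow> 0" by simp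
  qed
  then show ?thesis using S by (simp add: tends_tc_def hankel_hankel_tc)
qed

end

section \<open>Triangular sections\<close>

lemma section_det_mult:
  assumes "\<And>j k. j < N \<Longrightarrow> k < N \<Longrightarrow> entry (A * B) j k = (\<Sum>l<N. entry A j l * entry B l k)"
  shows "section_det N (A * B) = section_det N A * section_det N B"
proof -
  have "mat N N (\<lambda>(j, k). entry (A * B) j k) = mat N N (\<lambda>(j, k). entry A j k) * mat N N (\<lambda>(j, k). entry B j k)"
    using assms by (intro eq_matI) (auto simp: scalar_prod_def atLeast0LessThan)
  then show ?thesis
    unfolding section_det_def by (subst det_mult[symmetric, where n = N]) auto
qed

text \<open>Row j < N of a lower triangular left factor has no entries beyond column j, so the inner
  summation never leaves the section. The next lemma is the counterpart for an upper triangular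
  right factor.\<close>

lemma section_det_mult_lower:
  assumes "\<And>j l. j < l \<Longrightarrow> entry L j l = 0"
  shows "section_det N (L * A) = section_det N L * section_det N A"
proof (rule section_det_mult)
  fix j k assume j: "j < N"
  have "(\<lambda>l. entry L j l * entry A l k) sums (\<Sum>l<N. entry L j l * entry A l k)"
    by (rule sums_finite) (use j in \<open>auto intro!: assms\<close>)
  then show "entry (L * A) j k = (\<Sum>l<N. entry L j l * entry A l k)"
    by (rule sums_unique2[OF entry_mult_sums])
qed

lemma section_det_mult_upper:
  assumes "\<And>l k. k < l \<Longrightarrow> entry U l k = 0"
  shows "section_det N (A * U) = section_det N A * section_det N U"
proof (rule section_det_mult)
  fix j k assume k: "k < N"
  have "(\<lambda>l. entry A j l * entry U l k) sums (\<Sum>l<N. entry A j l * entry U l k)"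
    by (rule sums_finite) (use k in \<open>auto intro!: assms\<close>)
  then show "entry (A * U) j k = (\<Sum>l<N. entry A j l * entry U l k)"
    by (rule sums_unique2[OF entry_mult_sums])
qed

lemma section_det_lower:
  assumes "\<And>j l. j < l \<Longrightarrow> entry L j l = 0" and "\<And>j. entry L j j = d"
  shows "section_det N L = d ^ N"
proof -
  have "Determinant.det (mat N N (\<lambda>(j, k). entry L j k)) = prod_list (diag_mat (mat N N (\<lambda>(j, k). entry L j k)))"
    by (rule det_lower_triangular[where n = N]) (auto simp: assms)
  also have "diag_mat (mat N N (\<lambda>(j, k). entry L j k)) = replicate N d"
    by (intro nth_equalityI) (auto simp: diag_mat_def assms)
  finally show ?thesis by (simp add: section_det_def)
qed

lemma section_det_upper:
  assumes "\<And>j l. l < j \<Longrightarrow> entry U j l = 0" and "\<And>j. entry U j j = d"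
  shows "section_det N U = d ^ N"
proof -
  have "Determinant.det (mat N N (\<lambda>(j, k). entry U j k)) = prod_list (diag_mat (mat N N (\<lambda>(j, k). entry U j k)))"
    by (rule det_upper_triangular[where n = N]) (auto simp: assms upper_triangular_def)
  also have "diag_mat (mat N N (\<lambda>(j, k). entry U j k)) = replicate N d"
    by (intro nth_equalityI) (auto simp: diag_mat_def assms)
  finally show ?thesis by (simp add: section_det_def)
qed

lemma op_inverse_eqI:
  assumes "A * B = 1" "B * A = 1"
  shows "op_inverse A = B"
  unfolding op_inverse_def
proof (rule the_equality)
  fix C assume "A * C = 1 \<and> C * A = 1"
  then have "C = (B * A) * C" "A * C = 1" using assms by simp_all
  then show "C = B" by (simp add: mult.assoc)
qed (use assms in simp)

section \<open>The determinant identity\<close>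

context compatible_pair
begin

text \<open>Indexed by logarithms: products become sums, inverses negatives, and powers integer
  multiples.\<close>

definition Te :: "(complex \<Rightarrow> complex) \<Rightarrow> ell2_op" where "Te x = toeplitz (\<lambda>t. exp (x t))"
definition Me :: "(complex \<Rightarrow> complex) \<Rightarrow> ell2_op" where "Me x = M (\<lambda>t. exp (x t))"

lemma Te_add_minus: "v \<in> minus_part S \<Longrightarrow> x \<in> S \<Longrightarrow> Te (\<lambda>t. v t + x t) = Te v * Te x"
  unfolding Te_def exp_add by (rule toeplitz_mult_minus[OF exp_minus_part(1) exp_in])

lemma Te_add_plus: "x \<in> S \<Longrightarrow> u \<in> plus_part S \<Longrightarrow> Te (\<lambda>t. x t + u t) = Te x * Te u"
  unfolding Te_def exp_add by (rule toeplitz_mult_plus[OF exp_in exp_plus(1)])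

lemma even_exp: "c \<in> S \<Longrightarrow> Defs.tilde c = c \<Longrightarrow> (\<lambda>t. exp (c t)) \<in> even_part S"
proof -
  assume c: "c \<in> S" "Defs.tilde c = c"
  have "Defs.tilde (\<lambda>t. exp (c t)) = (\<lambda>t. exp (Defs.tilde c t))" by (simp add: tilde_def)
  then show "(\<lambda>t. exp (c t)) \<in> even_part S"
    using exp_in[OF c(1)] c(2) by (simp add: even_part_def circle_ae_eq_def)
qed

lemma Me_add_even: "x \<in> S \<Longrightarrow> c \<in> S \<Longrightarrow> Defs.tilde c = c \<Longrightarrow> Me (\<lambda>t. x t + c t) = Me x * Me c"
  unfolding Me_def exp_add by (rule M_even[OF exp_in even_exp])

lemma Me_add_minus: "v \<in> minus_part S \<Longrightarrow> x \<in> S \<Longrightarrow> Me (\<lambda>t. v t + x t) = Te v * Me x"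
  unfolding Me_def Te_def exp_add by (rule M_minus[OF exp_minus_part(1) exp_in])

lemma Te_0: "Te (\<lambda>_. 0) = 1" by (simp add: Te_def toeplitz_one)
lemma Me_0: "Me (\<lambda>_. 0) = 1" by (simp add: Me_def M_one)

lemma in_S: "u \<in> plus_part S \<Longrightarrow> u \<in> S" "v \<in> minus_part S \<Longrightarrow> v \<in> S"
  by (auto simp: plus_part_def minus_part_def)

lemma uminus_in:
  "a \<in> S \<Longrightarrow> (\<lambda>t. - a t) \<in> S"
  "u \<in> plus_part S \<Longrightarrow> (\<lambda>t. - u t) \<in> plus_part S" "v \<in> minus_part S \<Longrightarrow> (\<lambda>t. - v t) \<in> minus_part S"
  using scale[of a "-1"] plus_scale[of u "-1"] minus_scale[of v "-1"] by simp_all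

lemma Te_inverse_plus:
  assumes "u \<in> plus_part S"
  shows "Te u * Te (\<lambda>t. - u t) = 1" "Te (\<lambda>t. - u t) * Te u = 1"
  using Te_add_plus[OF in_S(1)[OF assms] uminus_in(2)[OF assms]]
    Te_add_plus[OF in_S(1)[OF uminus_in(2)[OF assms]] assms] by (simp_all add: Te_0)

lemma Te_inverse_minus:
  assumes "v \<in> minus_part S"
  shows "Te v * Te (\<lambda>t. - v t) = 1" "Te (\<lambda>t. - v t) * Te v = 1"
  using Te_add_minus[OF assms in_S(2)[OF uminus_in(3)[OF assms]]]
    Te_add_minus[OF uminus_in(3)[OF assms] in_S(2)[OF assms]] by (simp_all add: Te_0)

lemma Me_inverse_even:
  assumes "c \<in> S" "Defs.tilde c = c"
  shows "Me c * Me (\<lambda>t. - c t) = 1" "Me (\<lambda>t. - c t) * Me c = 1"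
proof -
  have "Defs.tilde (\<lambda>t. - c t) = (\<lambda>t. - c t)" using assms(2) by (simp add: tilde_def fun_eq_iff)
  then show "Me c * Me (\<lambda>t. - c t) = 1" "Me (\<lambda>t. - c t) * Me c = 1"
    using Me_add_even[OF assms(1) uminus_in(1)[OF assms(1)]] Me_add_even[OF uminus_in(1)[OF assms(1)] assms]
    by (simp_all add: Me_0)
qed

lemma nth_in:
  "a \<in> S \<Longrightarrow> (\<lambda>t. a t / z) \<in> S"
  "u \<in> plus_part S \<Longrightarrow> (\<lambda>t. u t / z) \<in> plus_part S" "v \<in> minus_part S \<Longrightarrow> (\<lambda>t. v t / z) \<in> minus_part S"
  using scale[of a "1 / z"] plus_scale[of u "1 / z"] minus_scale[of v "1 / z"] by simp_all

lemma Te_power_plus: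
  assumes "u \<in> plus_part S"
  shows "Te u ^ m = Te (\<lambda>t. of_nat m * u t)"
proof (induction m)
  case (Suc m)
  have "Te (\<lambda>t. u t + of_nat m * u t) = Te u * Te (\<lambda>t. of_nat m * u t)"
    by (rule Te_add_plus[OF in_S(1)[OF assms] plus_scale[OF assms]])
  then show ?case using Suc by (simp add: distrib_right)
qed (simp add: Te_0)

lemma Te_power_minus:
  assumes "v \<in> minus_part S"
  shows "Te v ^ m = Te (\<lambda>t. of_nat m * v t)"
proof (induction m)
  case (Suc m)
  have "Te (\<lambda>t. v t + of_nat m * v t) = Te v * Te (\<lambda>t. of_nat m * v t)"
    by (rule Te_add_minus[OF assms scale[OF in_S(2)[OF assms]]])
  then show ?case using Suc by (simp add: distrib_right)
qed (simp add: Te_0)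

lemma Me_power_even:
  assumes "c \<in> S" "Defs.tilde c = c"
  shows "Me c ^ m = Me (\<lambda>t. of_nat m * c t)"
proof (induction m)
  case (Suc m)
  have "Defs.tilde (\<lambda>t. of_nat m * c t) = (\<lambda>t. of_nat m * c t)" using assms(2) by (simp add: tilde_def fun_eq_iff)
  then have "Me (\<lambda>t. c t + of_nat m * c t) = Me c * Me (\<lambda>t. of_nat m * c t)"
    by (intro Me_add_even assms scale)
  then show ?case using Suc by (simp add: distrib_right)
qed (simp add: Me_0)

section \<open>Behaviour of the one-parameter groups near the identity\<close>

lemma sconv_Te: "x \<in> S \<Longrightarrow> (\<lambda>n. Te (\<lambda>t. x t / of_nat (Suc n))) \<longlonglongrightarrow> 1"
  using sconv_toeplitz[OF sconv_exp_one] by (simp add: Te_def toeplitz_one)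

lemma sconv_Me: "x \<in> S \<Longrightarrow> (\<lambda>n. Me (\<lambda>t. x t / of_nat (Suc n))) \<longlonglongrightarrow> 1"
  using sconv_M[OF sconv_exp_one] by (simp add: Me_def M_one)

definition dq :: "(complex \<Rightarrow> complex) \<Rightarrow> nat \<Rightarrow> complex \<Rightarrow> complex"
  where "dq x n = (\<lambda>t. of_nat (Suc n) * (exp (x t / of_nat (Suc n)) - 1))"

lemma dq: "x \<in> S \<Longrightarrow> sconv (dq x) x"
  unfolding dq_def by (rule sconv_exp_difference_quotient)

text \<open>An exact identity, not an expansion: linear maps turn it into constant plus 1/n times
  the value at \<open>dq\<close>, and convergence enters only through \<open>dq\<close>.\<close>

lemma exp_eq_dq: "(\<lambda>t. exp (x t / of_nat (Suc n))) = (\<lambda>t. 1 + (1 / of_nat (Suc n)) * dq x n t)"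
  by (simp add: dq_def fun_eq_iff del: of_nat_Suc)

lemma dq_in: "x \<in> S \<Longrightarrow> dq x n \<in> S"
  using dq by (simp add: sconv_def)

lemma hankel_exp_dq: "x \<in> S \<Longrightarrow> hankel (\<lambda>t. exp (x t / of_nat (Suc n))) = (1 / of_nat (Suc n)) *\<^sub>C hankel (dq x n)"
  unfolding exp_eq_dq by (simp only: hankel_addS[OF one scale] hankel_one hankel_scaleS dq_in add_0)

lemma Delta_exp_dq: "x \<in> S \<Longrightarrow> \<Delta> (\<lambda>t. exp (x t / of_nat (Suc n))) = (1 / of_nat (Suc n)) *\<^sub>C \<Delta> (dq x n)"
  unfolding exp_eq_dq by (simp only: Delta_add[OF one scale] Delta_minus[OF minus_one] Delta_scale dq_in add_0)

lemma toeplitz_exp_dq: "x \<in> S \<Longrightarrow> toeplitz (\<lambda>t. exp (x t / of_nat (Suc n))) = 1 + (1 / of_nat (Suc n)) *\<^sub>C toeplitz (dq x n)"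
  unfolding exp_eq_dq by (simp only: toeplitz_addS[OF one scale] toeplitz_one toeplitz_scaleS dq_in)

lemma hankel_exp_product:
  assumes "x \<in> S" "y \<in> S"
  shows "complex_of_real (real (Suc n) ^ 2) *\<^sub>C (hankel (\<lambda>t. exp (x t / of_nat (Suc n))) * hankel (\<lambda>t. exp (y t / of_nat (Suc n))))
    = hankel (dq x n) * hankel (dq y n)"
  unfolding hankel_exp_dq[OF assms(1)] hankel_exp_dq[OF assms(2)] op_algebra_scaleC
  by (simp add: power2_eq_square op_algebra_scaleC del: of_nat_Suc)

lemma trace_class_of_scaleC:
  assumes "trace_class (complex_of_real s *\<^sub>C A)" "s \<noteq> 0"
  shows "trace_class A"
  using trace_class_scaleC(1)[OF assms(1), of "1 / complex_of_real s"] assms(2) by (simp add: op_algebra_scaleC)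

lemma uminus_div: "(\<lambda>t. - (u t / z)) = (\<lambda>t. - u t / z :: complex)" by simp

section \<open>The constant E\<close>

text \<open>At parameter 1/n the commutator differs from 1 by about n^-2 times a Hankel product, and
  the determinant at parameter 1 is the n^2-th power of the one at 1/n.\<close>

lemma toeplitz_commutator_det:
  assumes u: "u \<in> plus_part S" and v: "v \<in> minus_part S"
  shows "fredholm_det (Te (\<lambda>t. - v t) * Te (\<lambda>t. - u t) * Te v * Te u)
    = exp (op_trace (hankel u * hankel (Defs.tilde v)))"
proof -
  define P P' Q Q' where "P n = Te (\<lambda>t. u t / of_nat (Suc n))" and "P' n = Te (\<lambda>t. - u t / of_nat (Suc n))"
    and "Q n = Te (\<lambda>t. v t / of_nat (Suc n))" and "Q' n = Te (\<lambda>t. - v t / of_nat (Suc n))" for n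
  have S: "u \<in> S" "v \<in> S" "Defs.tilde v \<in> S" "(\<lambda>t. - u t) \<in> S" "(\<lambda>t. - v t) \<in> S"
    using in_S u v tilde_in uminus_in by blast+
  have P: "P n * P' n = 1" "P' n * P n = 1" for n
    using Te_inverse_plus[OF nth_in(2)[OF u]] unfolding P_def P'_def uminus_div by auto
  have Q: "Q n * Q' n = 1" "Q' n * Q n = 1" for n
    using Te_inverse_minus[OF nth_in(3)[OF v]] unfolding Q_def Q'_def uminus_div by auto
  have pow: "P n ^ Suc n = Te u" "P' n ^ Suc n = Te (\<lambda>t. - u t)" "Q n ^ Suc n = Te v" "Q' n ^ Suc n = Te (\<lambda>t. - v t)" for n
    unfolding P_def P'_def Q_def Q'_def
    by (simp_all add: Te_power_plus Te_power_minus nth_in u v uminus_in del: of_nat_Suc power_Suc)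
  define A where "A n = Q' n * P' n * Q n * P n - 1" for n
  \<comment> \<open>The difference from 1 is the additive commutator of \<open>P'\<close> and
    \<open>Q\<close> between invertible factors. One order of the two multiplies exactly, since a
    minus factor stands on the left; the other leaves a Hankel product.\<close>
  have A: "A n = - (Q' n * (hankel (\<lambda>t. exp (- u t / of_nat (Suc n))) * hankel (\<lambda>t. exp (Defs.tilde v t / of_nat (Suc n)))) * P n)" for n
  proof -
    let ?x = "\<lambda>t. - u t / of_nat (Suc n)" and ?y = "\<lambda>t. v t / of_nat (Suc n)"
    have t: "Defs.tilde (\<lambda>t. exp (?y t)) = (\<lambda>t. exp (Defs.tilde v t / of_nat (Suc n)))" by (simp add: tilde_def)
    have "toeplitz (\<lambda>t. exp (?x t) * exp (?y t)) = P' n * Q n + hankel (\<lambda>t. exp (?x t)) * hankel (\<lambda>t. exp (Defs.tilde v t / of_nat (Suc n)))"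
      unfolding P'_def Q_def Te_def t[symmetric]
      by (rule toeplitz_multS[OF exp_in[OF nth_in(1)[OF S(4)]] exp_in[OF nth_in(1)[OF S(2)]]])
    moreover have "toeplitz (\<lambda>t. exp (?y t) * exp (?x t)) = Q n * P' n"
      unfolding P'_def Q_def Te_def
      by (rule toeplitz_mult_minus[OF exp_minus_part(1)[OF nth_in(3)[OF v]] exp_in[OF nth_in(1)[OF S(4)]]])
    ultimately have "P' n * Q n - Q n * P' n = - (hankel (\<lambda>t. exp (?x t)) * hankel (\<lambda>t. exp (Defs.tilde v t / of_nat (Suc n))))"
      by (simp add: mult.commute[of "exp (?x _)"] algebra_simps)
    moreover have "A n = Q' n * (P' n * Q n - Q n * P' n) * P n"
    proof -
      have "Q' n * (P' n * Q n - Q n * P' n) * P n = Q' n * P' n * Q n * P n - (Q' n * Q n) * (P' n * P n)"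
        by (simp add: algebra_simps)
      then show ?thesis by (simp add: A_def P Q)
    qed
    ultimately show ?thesis by simp
  qed
  have conv: "tends_tc (\<lambda>n. complex_of_real (real (Suc n) ^ 2) *\<^sub>C A n) (hankel u * hankel (Defs.tilde v))"
  proof -
    have "complex_of_real (real (Suc n) ^ 2) *\<^sub>C A n = - (Q' n * (hankel (dq (\<lambda>t. - u t) n) * hankel (dq (Defs.tilde v) n)) * P n)" for n
      unfolding A hankel_exp_product[OF S(4,3), symmetric]
      by (rule op_eqI) (simp add: entry_simps op_algebra_scaleC)
    moreover have "tends_tc (\<lambda>n. - (Q' n * (hankel (dq (\<lambda>t. - u t) n) * hankel (dq (Defs.tilde v) n)) * P n))
      (- (1 * (hankel (\<lambda>t. - u t) * hankel (Defs.tilde v)) * 1))"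
      unfolding Q'_def P_def
      by (intro tends_tc_uminus tends_tc_mult_right tends_tc_mult_left sconv_Te sconv_hankel_hankel dq S)
    \<comment> \<open>The sign of the commutator cancels against the sign of \<open>- u\<close>
      inside the Hankel operator.\<close>
    moreover have "- (1 * (hankel (\<lambda>t. - u t) * hankel (Defs.tilde v)) * 1) = hankel u * hankel (Defs.tilde v)"
      using hankel_scaleS[OF S(1), of "-1"] by (simp add: op_algebra_scaleC)
    ultimately show ?thesis by simp
  qed
  have tcA: "trace_class (A n)" for n
  proof (rule trace_class_of_scaleC)
    show "trace_class (complex_of_real (real (Suc n) ^ 2) *\<^sub>C A n)" using conv unfolding tends_tc_def by blast
  qed simp
  have lim: "(\<lambda>n. fredholm_det (1 + A n) ^ (Suc n * Suc n)) \<longlonglongrightarrow> exp (complex_of_real 1 * op_trace (hankel u * hankel (Defs.tilde v)))"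
  proof (rule tendsto_fredholm_det_power[OF conv])
    show "filterlim (\<lambda>n. real (Suc n) ^ 2) at_top sequentially"
      by (intro filterlim_pow_at_top filterlim_compose[OF filterlim_real_sequentially filterlim_Suc]) simp
    have r: "real (Suc n * Suc n) / real (Suc n) ^ 2 = 1" for n
      unfolding of_nat_mult power2_eq_square by (rule divide_self) simp
    show "(\<lambda>n. real (Suc n * Suc n) / real (Suc n) ^ 2) \<longlonglongrightarrow> 1"
      unfolding r by (rule tendsto_const)
  qed simp
  \<comment> \<open>By the power formula the sequence is constant in n, so its limit is its
    value.\<close>
  have det: "fredholm_det (1 + A n) ^ (Suc n * Suc n) = fredholm_det (Te (\<lambda>t. - v t) * Te (\<lambda>t. - u t) * Te v * Te u)" for n
    using det_commutator_power[OF Q P, of n n "Suc n"] tcA[of n] unfolding pow A_def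
    by (simp only: add_diff_cancel_left' add.commute[of 1] diff_add_cancel)
  show ?thesis using lim unfolding det by (simp add: LIMSEQ_const_iff)
qed

section \<open>The constant F\<close>

text \<open>The three factors run through one-parameter groups, but their product does not.
  \<open>det_power_product\<close> separates a first-order part, raised to the power n, from a
  commutator of order n^-2, raised to a power of about n^2/2; they yield the two terms of the
  exponent.\<close>

lemma compatible_det:
  assumes u: "u \<in> plus_part S"
  defines "c \<equiv> \<lambda>t. u t + Defs.tilde u t"
  shows "fredholm_det (Te (\<lambda>t. - u t) * Te (\<lambda>t. - Defs.tilde u t) * Me c)
    = exp (op_trace (\<Delta> c) - 1 / 2 * op_trace (hankel u * hankel u))"
proof -
  define w where "w = Defs.tilde u"
  have w: "w \<in> minus_part S" unfolding w_def by (rule tilde_plus[OF u])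
  have S: "u \<in> S" "w \<in> S" "c \<in> S" "(\<lambda>t. - u t) \<in> S" "(\<lambda>t. - w t) \<in> S" "(\<lambda>t. - c t) \<in> S"
    using in_S u w uminus_in add[of u w] unfolding c_def w_def by blast+
  have ct: "Defs.tilde c = c" by (auto simp: c_def tilde_def)
  have ci: "c (inverse t) = c t" for t using fun_cong[OF ct, of t] by (simp add: tilde_def)
  define P P' W W' R R' where "P n = Te (\<lambda>t. u t / of_nat (Suc n))" and "P' n = Te (\<lambda>t. - u t / of_nat (Suc n))"
    and "W n = Te (\<lambda>t. w t / of_nat (Suc n))" and "W' n = Te (\<lambda>t. - w t / of_nat (Suc n))"
    and "R n = Me (\<lambda>t. c t / of_nat (Suc n))" and "R' n = Me (\<lambda>t. - c t / of_nat (Suc n))" for n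
  have te: "Defs.tilde (\<lambda>t. c t / z) = (\<lambda>t. c t / z)" "Defs.tilde (\<lambda>t. - c t / z) = (\<lambda>t. - c t / z)" for z
    using ct by (simp_all add: tilde_def fun_eq_iff)
  have P: "P n * P' n = 1" "P' n * P n = 1" for n
    using Te_inverse_plus[OF nth_in(2)[OF u]] unfolding P_def P'_def uminus_div by auto
  have W: "W n * W' n = 1" "W' n * W n = 1" for n
    using Te_inverse_minus[OF nth_in(3)[OF w]] unfolding W_def W'_def uminus_div by auto
  have R: "R n * R' n = 1" "R' n * R n = 1" for n
    using Me_inverse_even[OF nth_in(1)[OF S(3)] te(1)] unfolding R_def R'_def uminus_div by auto
  have pow: "P' n ^ Suc n = Te (\<lambda>t. - u t)" "W' n ^ Suc n = Te (\<lambda>t. - w t)" "R n ^ Suc n = Me c" for n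
    unfolding P'_def W'_def R_def
    by (simp_all add: Te_power_plus Te_power_minus Me_power_even te nth_in u w S uminus_in del: of_nat_Suc power_Suc)
  define A B where "A n = P' n * W' n * R n - 1" and "B n = P' n * R' n * P n * R n - 1" for n
  \<comment> \<open>The two Toeplitz factors invert the Toeplitz operator of the exponential of c/n,
    which leaves only the deviation of \<open>M\<close> from it.\<close>
  have A: "A n = P' n * W' n * \<Delta> (\<lambda>t. exp (c t / of_nat (Suc n)))" for n
  proof -
    have e: "(\<lambda>t. c t / of_nat (Suc n)) = (\<lambda>t. w t / of_nat (Suc n) + u t / of_nat (Suc n))"
      by (simp add: c_def w_def add_divide_distrib add.commute)
    have "Te (\<lambda>t. c t / of_nat (Suc n)) = W n * P n"
      unfolding e W_def P_def by (rule Te_add_minus[OF nth_in(3)[OF w] nth_in(1)[OF S(1)]])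
    then have "toeplitz (\<lambda>t. exp (c t / of_nat (Suc n))) = W n * P n" by (simp only: Te_def)
    then have "P' n * W' n * \<Delta> (\<lambda>t. exp (c t / of_nat (Suc n))) = P' n * W' n * R n - P' n * (W' n * W n) * P n"
      unfolding \<Delta>_def R_def Me_def by (simp add: algebra_simps)
    then show ?thesis by (simp add: A_def P W)
  qed
  have convA: "tends_tc (\<lambda>n. complex_of_real (real (Suc n)) *\<^sub>C A n) (\<Delta> c)"
  proof -
    have "complex_of_real (real (Suc n)) *\<^sub>C A n = P' n * W' n * \<Delta> (dq c n)" for n
      unfolding A Delta_exp_dq[OF S(3)] by (simp add: op_algebra_scaleC del: of_nat_Suc)
    moreover have "tends_tc (\<lambda>n. P' n * W' n * \<Delta> (dq c n)) (1 * 1 * \<Delta> c)"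
      unfolding P'_def W'_def by (intro tends_tc_mult_left tendsto_mult sconv_Te sconv_Delta dq S)
    ultimately show ?thesis by simp
  qed
  \<comment> \<open>The limit of n^2 times the commutator minus 1: the additive commutator of
    \<open>M\<close> at \<open>- c\<close> with the Toeplitz operator of \<open>u\<close>, sorted
    into trace class pieces.\<close>
  define D where "D = \<Delta> (\<lambda>t. - c t) * toeplitz u - toeplitz u * \<Delta> (\<lambda>t. - c t) + hankel u * hankel (\<lambda>t. - c t)"
  have B: "B n = P' n * (\<Delta> x * toeplitz y - toeplitz y * \<Delta> x + hankel y * hankel x) * R n"
    if x: "x = (\<lambda>t. exp (- c t / of_nat (Suc n)))" and y: "y = (\<lambda>t. exp (u t / of_nat (Suc n)))" for n x y
  proof -
    have xS: "x \<in> S" "y \<in> plus_part S" unfolding x y using exp_in nth_in(1)[OF S(6)] exp_plus(1) nth_in(2)[OF u] by blast+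
    have xt: "Defs.tilde x = x" unfolding x by (simp add: tilde_def ci)
    have "toeplitz (\<lambda>t. x t * y t) = toeplitz x * toeplitz y" by (rule toeplitz_mult_plus[OF xS])
    moreover have "toeplitz (\<lambda>t. y t * x t) = toeplitz y * toeplitz x + hankel y * hankel x"
      using toeplitz_multS[OF in_S(1)[OF xS(2)] xS(1)] by (simp add: xt)
    moreover have "(\<lambda>t. y t * x t) = (\<lambda>t. x t * y t)" by (simp add: mult.commute)
    ultimately have H: "hankel y * hankel x = toeplitz x * toeplitz y - toeplitz y * toeplitz x" by simp
    have "\<Delta> x * toeplitz y - toeplitz y * \<Delta> x + hankel y * hankel x = M x * toeplitz y - toeplitz y * M x"
      unfolding \<Delta>_def H by (simp add: algebra_simps)
    also have "\<dots> = R' n * P n - P n * R' n" unfolding R'_def P_def Me_def Te_def x y ..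
    finally have e: "\<Delta> x * toeplitz y - toeplitz y * \<Delta> x + hankel y * hankel x = R' n * P n - P n * R' n" .
    have "P' n * (\<Delta> x * toeplitz y - toeplitz y * \<Delta> x + hankel y * hankel x) * R n
      = P' n * R' n * P n * R n - (P' n * P n) * (R' n * R n)" unfolding e by (simp add: algebra_simps)
    then show ?thesis by (simp add: B_def P R)
  qed
  have convB: "tends_tc (\<lambda>n. complex_of_real (real (Suc n) ^ 2) *\<^sub>C B n) D"
  proof -
    have eq: "complex_of_real (real (Suc n) ^ 2) *\<^sub>C B n
      = P' n * (\<Delta> (dq (\<lambda>t. - c t) n) * toeplitz (dq u n) - toeplitz (dq u n) * \<Delta> (dq (\<lambda>t. - c t) n)
          + hankel (dq u n) * hankel (dq (\<lambda>t. - c t) n)) * R n" for n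
    proof -
      define s where "s = complex_of_real (real (Suc n))"
      have s: "s \<noteq> 0" "complex_of_nat (Suc n) = s" "complex_of_real (real (Suc n) ^ 2) = s * s"
        by (simp_all add: s_def power2_eq_square del: of_nat_Suc)
      let ?D = "\<Delta> (dq (\<lambda>t. - c t) n)" and ?T = "toeplitz (dq u n)"
        and ?H = "hankel (dq u n)" and ?K = "hankel (dq (\<lambda>t. - c t) n)"
      have "(1 / s) *\<^sub>C ?D * (1 + (1 / s) *\<^sub>C ?T) - (1 + (1 / s) *\<^sub>C ?T) * ((1 / s) *\<^sub>C ?D) + (1 / s) *\<^sub>C ?H * ((1 / s) *\<^sub>C ?K)
        = (1 / (s * s)) *\<^sub>C (?D * ?T - ?T * ?D + ?H * ?K)"
        by (rule op_eqI) (simp add: distrib_left distrib_right op_algebra_scaleC entry_simps algebra_simps)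
      then have h: "(s * s) *\<^sub>C B n = (s * s) *\<^sub>C (P' n * ((1 / (s * s)) *\<^sub>C (?D * ?T - ?T * ?D + ?H * ?K)) * R n)"
        unfolding B[OF refl refl] Delta_exp_dq[OF S(6)] toeplitz_exp_dq[OF S(1)]
          hankel_exp_dq[OF S(1)] hankel_exp_dq[OF S(6)]
        unfolding s(2) by simp
      have "(s * s) *\<^sub>C (P' n * ((1 / (s * s)) *\<^sub>C A) * R n) = P' n * A * R n" for A
        using s(1) by (simp add: op_algebra_scaleC(1-3,6))
      then show ?thesis unfolding s(3) h .
    qed
    have "tends_tc (\<lambda>n. P' n * (\<Delta> (dq (\<lambda>t. - c t) n) * toeplitz (dq u n) - toeplitz (dq u n) * \<Delta> (dq (\<lambda>t. - c t) n)
          + hankel (dq u n) * hankel (dq (\<lambda>t. - c t) n)) * R n) (1 * D * 1)"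
      unfolding P'_def R_def D_def
      by (intro tends_tc_mult_right tends_tc_mult_left tends_tc_add tends_tc_diff sconv_Te sconv_Me
          sconv_Delta sconv_toeplitz sconv_hankel_hankel dq S)
    then show ?thesis unfolding eq by simp
  qed
  \<comment> \<open>The commutator with \<open>\<Delta>\<close> has trace 0 by cyclicity. What
    remains is the Hankel product, in which \<open>c\<close> may be replaced by \<open>u\<close>
    because they share their positive coefficients.\<close>
  have trD: "op_trace D = - op_trace (hankel u * hankel u)"
  proof -
    have tc: "trace_class (\<Delta> (\<lambda>t. - c t))" by (rule Delta_tc[OF S(6)])
    have "fourier c n = fourier u n" if "0 < n" for n
      using that w S unfolding c_def by (simp add: fourier_addS[OF S(1) S(2)[unfolded w_def]] minus_part_def w_def)
    then have H: "hankel c = hankel u" by (rule hankel_cong[OF bndS[OF S(3)] bndS[OF S(1)]])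
    have "op_trace D = op_trace (\<Delta> (\<lambda>t. - c t) * toeplitz u) - op_trace (toeplitz u * \<Delta> (\<lambda>t. - c t))
      + op_trace (hankel u * hankel (\<lambda>t. - c t))"
      unfolding D_def using tc S
      by (simp add: op_trace_add op_trace_diff trace_class_diff trace_class_mult_left trace_class_mult_right hankel_hankel_tc)
    also have "\<dots> = op_trace (hankel u * hankel (\<lambda>t. - c t))" by (simp add: op_trace_swap[OF tc])
    also have "hankel u * hankel (\<lambda>t. - c t) = - (hankel u * hankel u)"
      using hankel_scaleS[OF S(3), of "-1"] by (simp add: op_algebra_scaleC H)
    finally show ?thesis by (simp add: op_trace_uminus hankel_hankel_tc S)
  qed
  have tcA: "trace_class (A n)" for n
  proof (rule trace_class_of_scaleC)
    show "trace_class (complex_of_real (real (Suc n)) *\<^sub>C A n)" using convA unfolding tends_tc_def by blast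
  qed simp
  have tcB: "trace_class (B n)" for n
  proof (rule trace_class_of_scaleC)
    show "trace_class (complex_of_real (real (Suc n) ^ 2) *\<^sub>C B n)" using convB unfolding tends_tc_def by blast
  qed simp
  have lim: "filterlim (\<lambda>n. real (Suc n)) at_top sequentially"
    by (rule filterlim_compose[OF filterlim_real_sequentially filterlim_Suc])
  have limA: "(\<lambda>n. fredholm_det (1 + A n) ^ Suc n) \<longlonglongrightarrow> exp (complex_of_real 1 * op_trace (\<Delta> c))"
    by (rule tendsto_fredholm_det_power[OF convA _ lim]) (simp_all del: of_nat_Suc)
  have limB: "(\<lambda>n. fredholm_det (1 + B n) ^ (\<Sum>i<Suc n. i)) \<longlonglongrightarrow> exp (complex_of_real (1 / 2) * op_trace D)"
  proof (rule tendsto_fredholm_det_power[OF convB])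
    show "filterlim (\<lambda>n. real (Suc n) ^ 2) at_top sequentially"
      by (intro filterlim_pow_at_top lim) simp
    have gauss: "real (\<Sum>i<Suc n. i) = real n * (real n + 1) / 2" for n
      by (induction n) (simp_all add: field_simps)
    \<comment> \<open>With m = n + 1 the exponent is m (m - 1) / 2, so divided by m^2 it tends to
      the 1/2 of the formula for F.\<close>
    have r: "real (\<Sum>i<Suc n. i) / real (Suc n) ^ 2 = 1 / 2 - 1 / 2 * inverse (real (Suc n))" for n
    proof -
      define m where "m = real (Suc n)"
      have m: "m \<noteq> 0" "real n = m - 1" "real n + 1 = m" by (simp_all add: m_def)
      show ?thesis unfolding gauss m_def[symmetric] m(3) unfolding m(2)
        using m(1) by (simp add: power2_eq_square field_simps)
    qed
    have "(\<lambda>n. 1 / 2 - 1 / 2 * inverse (real (Suc n))) \<longlonglongrightarrow> 1 / 2 - 1 / 2 * 0"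
      by (intro tendsto_diff tendsto_mult tendsto_const LIMSEQ_inverse_real_of_nat)
    then show "(\<lambda>n. real (\<Sum>i<Suc n. i) / real (Suc n) ^ 2) \<longlonglongrightarrow> 1 / 2"
      unfolding r by simp
  qed simp
  have det: "fredholm_det (1 + A n) ^ Suc n * fredholm_det (1 + B n) ^ (\<Sum>i<Suc n. i)
    = fredholm_det (Te (\<lambda>t. - u t) * Te (\<lambda>t. - w t) * Me c)" for n
    using det_power_product[OF P R, of n "W' n" n "Suc n"] tcA[of n] tcB[of n] unfolding pow A_def B_def
    by (simp only: add.commute[of 1] diff_add_cancel)
  have "(\<lambda>n :: nat. fredholm_det (Te (\<lambda>t. - u t) * Te (\<lambda>t. - w t) * Me c))
    \<longlonglongrightarrow> exp (complex_of_real 1 * op_trace (\<Delta> c)) * exp (complex_of_real (1 / 2) * op_trace D)"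
    using tendsto_mult[OF limA limB] unfolding det .
  then show ?thesis
    by (simp add: LIMSEQ_const_iff w_def trD exp_add[symmetric])
qed

end

section \<open>The identity for the finite sections\<close>

text \<open>\<open>op_inverse\<close>, \<open>op_trace\<close> and \<open>fredholm_det\<close> are
  total functions. The clauses on invertibility and trace class certify that the formulas carry
  their intended meaning.\<close>

theorem proposition4p2:
  fixes S :: "(complex \<Rightarrow> complex) set" and nrm :: "(complex \<Rightarrow> complex) \<Rightarrow> real"
    and M :: "(complex \<Rightarrow> complex) \<Rightarrow> ell2_op"
    and b_p b_m a_p a_m a b :: "complex \<Rightarrow> complex" and K :: ell2_op and N :: nat
  assumes "compatible_pair S nrm M"
    and "b_p \<in> plus_part S" and "b_m \<in> minus_part S"
    and "a_p = (\<lambda>t. exp (b_p t))" and "a_m = (\<lambda>t. exp (b_m t))"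
    and "b = (\<lambda>t. b_p t + b_m t)" and "a = (\<lambda>t. a_p t * a_m t)"
    and "K = M (\<lambda>t. a_m t * inverse (a_p t) * inverse (tilde a_p t))
             * toeplitz (\<lambda>t. a_p t * tilde a_p t * inverse (a_m t)) - 1"
    and "N \<ge> 1"
  shows "op_invertible (toeplitz a) \<and>
    trace_class (op_inverse (toeplitz a) * M a - 1) \<and>
    trace_class (toeplitz (\<lambda>t. inverse (a t)) * toeplitz a - 1) \<and>
    trace_class (op_Q N * K * op_Q N) \<and>
    trace_class (M b - toeplitz b) \<and>
    trace_class (hankel b * hankel b) \<and>
    trace_class (hankel b * hankel (tilde b)) \<and>
    section_det N (M a) =
      const_G b ^ N * const_E a * const_F M a * fredholm_det (1 + op_Q N * K * op_Q N) \<and>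
    const_F M a =
      exp (op_trace (M b - toeplitz b) - 1 / 2 * op_trace (hankel b * hankel b)) \<and>
    const_E a = exp (op_trace (hankel b * hankel (tilde b)))"
proof -
  interpret compatible_pair S nrm M by fact
  define u v w c where "u = b_p" and "v = b_m" and "w = Defs.tilde b_p" and "c = (\<lambda>t. u t + Defs.tilde u t)"
  have u: "u \<in> plus_part S" and v: "v \<in> minus_part S" using assms by (simp_all add: u_def v_def)
  have w: "w \<in> minus_part S" unfolding w_def using tilde_plus u by (simp add: u_def)
  have c: "c = (\<lambda>t. w t + u t)" by (simp add: c_def w_def u_def add.commute)
  have S: "u \<in> S" "v \<in> S" "w \<in> S" "c \<in> S" "(\<lambda>t. - u t) \<in> S" "(\<lambda>t. - v t) \<in> S" "(\<lambda>t. - w t) \<in> S" "b \<in> S"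
    using in_S u v w uminus_in add[of w u] add[of u v] unfolding c assms(6) u_def v_def by blast+
  have ct: "Defs.tilde c = c" by (auto simp: c_def tilde_def)
  note uu = Te_inverse_plus[OF u] and vv = Te_inverse_minus[OF v] and ww = Te_inverse_minus[OF w]
    and cc = Me_inverse_even[OF S(4) ct]
  have a: "a = (\<lambda>t. exp (v t + u t))" and a': "(\<lambda>t. inverse (a t)) = (\<lambda>t. exp (- v t + - u t))"
    by (auto simp: assms(4,5,7) u_def v_def exp_add exp_minus exp_diff divide_inverse)
  have Ta: "toeplitz a = Te v * Te u"
    using Te_add_minus[OF v S(1)] by (simp add: a Te_def)
  have Ta': "toeplitz (\<lambda>t. inverse (a t)) = Te (\<lambda>t. - v t) * Te (\<lambda>t. - u t)"
    using Te_add_minus[OF uminus_in(3)[OF v] S(5)] by (simp add: a' Te_def)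
  define Ti where "Ti = Te (\<lambda>t. - u t) * Te (\<lambda>t. - v t)"
  have Ti: "toeplitz a * Ti = 1" "Ti * toeplitz a = 1"
  proof -
    have "toeplitz a * Ti = Te v * (Te u * Te (\<lambda>t. - u t)) * Te (\<lambda>t. - v t)"
      unfolding Ta Ti_def by (simp add: mult.assoc)
    then show "toeplitz a * Ti = 1" by (simp add: uu vv)
    have "Ti * toeplitz a = Te (\<lambda>t. - u t) * (Te (\<lambda>t. - v t) * Te v) * Te u"
      unfolding Ta Ti_def by (simp add: mult.assoc)
    then show "Ti * toeplitz a = 1" by (simp add: uu vv)
  qed
  have inv: "op_inverse (toeplitz a) = Ti" by (rule op_inverse_eqI[OF Ti])
  have invertible: "op_invertible (toeplitz a)" unfolding op_invertible_def using Ti by blast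
  \<comment> \<open>Since u = -w + c with -w in the minus part and c even, the plus factor is
    reached through the two rules available for \<open>M\<close>.\<close>
  have Ma: "M a = Te v * (Te (\<lambda>t. - w t) * Me c)"
  proof -
    have "Me u = Te (\<lambda>t. - w t) * Me c"
      using Me_add_minus[OF uminus_in(3)[OF w] S(4)] by (simp add: c)
    then show ?thesis using Me_add_minus[OF v S(1)] by (simp add: a Me_def)
  qed
  define Z1 Z2 where "Z1 = toeplitz (\<lambda>t. inverse (a t)) * toeplitz a" and "Z2 = Ti * M a"
  have Z2: "Z2 = Te (\<lambda>t. - u t) * Te (\<lambda>t. - w t) * Me c"
  proof -
    have "Z2 = Te (\<lambda>t. - u t) * (Te (\<lambda>t. - v t) * Te v) * (Te (\<lambda>t. - w t) * Me c)"
      unfolding Z2_def Ti_def Ma by (simp add: mult.assoc)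
    then show ?thesis by (simp add: vv mult.assoc)
  qed
  have Hb: "hankel b = hankel u"
  proof (rule hankel_cong[OF bndS[OF S(8)] bndS[OF S(1)]])
    fix n :: int assume "0 < n"
    then show "fourier b n = fourier u n"
      unfolding assms(6) using v S by (simp add: fourier_addS minus_part_def flip: u_def v_def)
  qed
  have Hbt: "hankel (tilde b) = hankel (tilde v)"
  proof (rule hankel_cong[OF bndS[OF tilde_in[OF S(8)]] bndS[OF tilde_in[OF S(2)]]])
    fix n :: int assume "0 < n"
    then show "fourier (tilde b) n = fourier (tilde v) n"
      unfolding assms(6) fourier_tilde using u S by (simp add: fourier_addS plus_part_def flip: u_def v_def)
  qed
  \<comment> \<open>\<open>b\<close>, \<open>u\<close> and \<open>c\<close> differ only by minus
    functions, on which \<open>M\<close> and the Toeplitz map agree.\<close>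
  have Db: "M b - toeplitz b = \<Delta> c"
  proof -
    have "\<Delta> b = \<Delta> u" unfolding assms(6) using Delta_add[OF S(1,2)] Delta_minus[OF v] by (simp add: u_def v_def)
    moreover have "\<Delta> c = \<Delta> u" unfolding c using Delta_add[OF S(3,1)] Delta_minus[OF w] by simp
    ultimately show ?thesis by (simp add: \<Delta>_def)
  qed
  have tcb: "trace_class (M b - toeplitz b)" unfolding Db by (rule Delta_tc[OF S(4)])
  have tcHH: "trace_class (hankel b * hankel b)" "trace_class (hankel b * hankel (tilde b))"
    by (intro hankel_hankel_tc S tilde_in)+
  have "a \<in> S" unfolding a by (rule exp_in[OF add[OF S(2,1)]])
  moreover have "(\<lambda>t. inverse (a t)) \<in> S" unfolding a' by (rule exp_in[OF add[OF S(6,5)]])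
  ultimately have aS: "a \<in> S" "(\<lambda>t. inverse (a t)) \<in> S" by blast+
  have tc1: "trace_class (Z1 - 1)"
  proof -
    have "(\<lambda>t. inverse (a t) * a t) = (\<lambda>_. 1)" by (simp add: a)
    then have "Z1 - 1 = - (hankel (\<lambda>t. inverse (a t)) * hankel (tilde a))"
      using toeplitz_multS[OF aS(2,1)] by (simp add: Z1_def toeplitz_one algebra_simps)
    then show ?thesis by (simp add: trace_class_uminus hankel_hankel_tc aS tilde_in)
  qed
  have tc2: "trace_class (Z2 - 1)"
  proof -
    have "Z2 - 1 = Ti * \<Delta> a" by (simp add: Z2_def \<Delta>_def right_diff_distrib Ti)
    then show ?thesis by (simp add: trace_class_mult_left Delta_tc aS)
  qed
  have E: "const_E a = fredholm_det Z1" by (simp add: const_E_def Z1_def)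
  have F: "const_F M a = fredholm_det Z2" by (simp add: const_F_def Z2_def inv)
  have Eexp: "const_E a = exp (op_trace (hankel b * hankel (tilde b)))"
    unfolding E Z1_def Ta Ta' Hb Hbt using toeplitz_commutator_det[OF u v] by (simp add: mult.assoc)
  have Fexp: "const_F M a = exp (op_trace (M b - toeplitz b) - 1 / 2 * op_trace (hankel b * hankel b))"
    unfolding F Z2 Hb Db using compatible_det[OF u] by (simp add: c_def w_def u_def)
  \<comment> \<open>\<open>Y\<close> is 1 + K written as a product of group elements, so that both
    products with \<open>X\<close> telescope.\<close>
  define X Y where "X = Te (\<lambda>t. - u t) * M a * Te (\<lambda>t. - v t)"
    and "Y = Te v * Me (\<lambda>t. - c t) * (Te w * Te (\<lambda>t. - v t) * Te u)"
  have KY: "K = Y - 1"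
  proof -
    have at: "tilde (\<lambda>t. exp (b_p t)) t = exp (w t)" for t by (simp add: w_def tilde_def)
    have ce: "Defs.tilde (\<lambda>t. - c t) = (\<lambda>t. - c t)" using ct by (simp add: tilde_def fun_eq_iff)
    have "(\<lambda>t. a_m t * inverse (a_p t) * inverse (tilde a_p t)) = (\<lambda>t. exp (v t + - c t))"
      by (auto simp: at assms(4,5) c u_def v_def exp_add exp_minus exp_diff divide_inverse)
    then have "M (\<lambda>t. a_m t * inverse (a_p t) * inverse (tilde a_p t)) = Te v * Me (\<lambda>t. - c t)"
      using Me_add_minus[OF v uminus_in(1)[OF S(4)]] by (simp add: Me_def)
    moreover have "(\<lambda>t. a_p t * tilde a_p t * inverse (a_m t)) = (\<lambda>t. exp ((w t + - v t) + u t))"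
      by (auto simp: at assms(4,5) u_def v_def exp_add exp_minus exp_diff divide_inverse)
    then have "toeplitz (\<lambda>t. a_p t * tilde a_p t * inverse (a_m t)) = Te w * Te (\<lambda>t. - v t) * Te u"
      using Te_add_minus[OF minus_add[OF w uminus_in(3)[OF v]] S(1)] Te_add_minus[OF w S(6)] by (simp add: Te_def)
    ultimately show ?thesis by (simp add: assms(8) Y_def)
  qed
  have XY: "X * Y = 1"
  proof -
    have "X * Y = Te (\<lambda>t. - u t) * Te v * Te (\<lambda>t. - w t) * Me c * (Te (\<lambda>t. - v t) * Te v) * Me (\<lambda>t. - c t)
      * Te w * Te (\<lambda>t. - v t) * Te u" unfolding X_def Y_def Ma by (simp add: mult.assoc)
    also have "\<dots> = Te (\<lambda>t. - u t) * Te v * Te (\<lambda>t. - w t) * (Me c * Me (\<lambda>t. - c t)) * Te w * Te (\<lambda>t. - v t) * Te u"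
      by (simp add: vv mult.assoc)
    also have "\<dots> = Te (\<lambda>t. - u t) * Te v * (Te (\<lambda>t. - w t) * Te w) * Te (\<lambda>t. - v t) * Te u"
      by (simp add: cc mult.assoc)
    also have "\<dots> = Te (\<lambda>t. - u t) * (Te v * Te (\<lambda>t. - v t)) * Te u" by (simp add: ww mult.assoc)
    also have "\<dots> = 1" by (simp add: uu vv)
    finally show ?thesis .
  qed
  have YX: "Y * X = 1"
  proof -
    have "Y * X = Te v * Me (\<lambda>t. - c t) * Te w * Te (\<lambda>t. - v t) * (Te u * Te (\<lambda>t. - u t)) * Te v * Te (\<lambda>t. - w t)
      * Me c * Te (\<lambda>t. - v t)" unfolding X_def Y_def Ma by (simp add: mult.assoc)
    also have "\<dots> = Te v * Me (\<lambda>t. - c t) * Te w * (Te (\<lambda>t. - v t) * Te v) * Te (\<lambda>t. - w t) * Me c * Te (\<lambda>t. - v t)"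
      by (simp add: uu mult.assoc)
    also have "\<dots> = Te v * Me (\<lambda>t. - c t) * (Te w * Te (\<lambda>t. - w t)) * Me c * Te (\<lambda>t. - v t)"
      by (simp add: vv mult.assoc)
    also have "\<dots> = Te v * (Me (\<lambda>t. - c t) * Me c) * Te (\<lambda>t. - v t)" by (simp add: ww mult.assoc)
    also have "\<dots> = 1" by (simp add: cc vv)
    finally show ?thesis .
  qed
  \<comment> \<open>\<open>X\<close> is similar to \<open>Z1 * Z2\<close>, whose determinant is the
    product of the constants E and F; the inner factors meet in the Toeplitz operator of
    \<open>a\<close> and its inverse.\<close>
  have XZ: "X = Te v * (Z1 * Z2) * Te (\<lambda>t. - v t)"
  proof -
    have "Te v * (Z1 * Z2) * Te (\<lambda>t. - v t)
      = (Te v * Te (\<lambda>t. - v t)) * Te (\<lambda>t. - u t) * (toeplitz a * Ti) * M a * Te (\<lambda>t. - v t)"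
      unfolding Z1_def Z2_def Ta' by (simp add: mult.assoc)
    also have "\<dots> = X" by (simp add: vv Ti X_def)
    finally show ?thesis ..
  qed
  note ZZ = fredholm_det_mult[OF tc1 tc2]
  have tcX: "trace_class (X - 1)" unfolding XZ by (rule fredholm_det_conj(1)[OF ZZ(1) vv])
  have detX: "fredholm_det X = const_E a * const_F M a"
    unfolding XZ fredholm_det_conj(2)[OF ZZ(1) vv] ZZ(2) E F ..
  note J = section_det_eq_complementary[OF tcX XY YX, of N, folded KY]
  \<comment> \<open>The left outer factor of \<open>X\<close> is lower triangular and the right one
    upper triangular, so the section determinant splits. Their constant diagonals, the exponentials
    of the negated zeroth coefficients, produce the inverse of \<open>const_G b ^ N\<close>.\<close>
  have sec: "section_det N X = exp (- fourier u 0) ^ N * section_det N (M a) * exp (- fourier v 0) ^ N"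
  proof -
    have eu: "(\<lambda>t. exp (- u t)) \<in> plus_part S" "fourier (\<lambda>t. exp (- u t)) 0 = exp (- fourier u 0)"
      using exp_plus[OF uminus_in(2)[OF u]] fourier_cmult[of "-1" u 0] by simp_all
    have ev: "(\<lambda>t. exp (- v t)) \<in> minus_part S" "fourier (\<lambda>t. exp (- v t)) 0 = exp (- fourier v 0)"
      using exp_minus_part[OF uminus_in(3)[OF v]] fourier_cmult[of "-1" v 0] by simp_all
    have entry_u: "entry (Te (\<lambda>t. - u t)) j k = fourier (\<lambda>t. exp (- u t)) (int j - int k)" for j k
      unfolding Te_def by (rule toeplitz_op(1)[OF bndS[OF in_S(1)[OF eu(1)]]])
    have entry_v: "entry (Te (\<lambda>t. - v t)) j k = fourier (\<lambda>t. exp (- v t)) (int j - int k)" for j k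
      unfolding Te_def by (rule toeplitz_op(1)[OF bndS[OF in_S(2)[OF ev(1)]]])
    have lu: "entry (Te (\<lambda>t. - u t)) j k = 0" if "j < k" for j k
      using eu(1) that by (simp add: entry_u plus_part_def)
    have uv: "entry (Te (\<lambda>t. - v t)) j k = 0" if "k < j" for j k
      using ev(1) that by (simp add: entry_v minus_part_def)
    have "section_det N X = section_det N (Te (\<lambda>t. - u t) * M a) * section_det N (Te (\<lambda>t. - v t))"
      unfolding X_def by (rule section_det_mult_upper) (rule uv)
    also have "section_det N (Te (\<lambda>t. - u t) * M a) = section_det N (Te (\<lambda>t. - u t)) * section_det N (M a)"
      by (rule section_det_mult_lower) (rule lu)
    also have "section_det N (Te (\<lambda>t. - u t)) = exp (- fourier u 0) ^ N"
      by (rule section_det_lower) (erule lu, simp add: entry_u eu(2))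
    also have "section_det N (Te (\<lambda>t. - v t)) = exp (- fourier v 0) ^ N"
      by (rule section_det_upper) (erule uv, simp add: entry_v ev(2))
    finally show ?thesis .
  qed
  have G: "const_G b = exp (fourier u 0) * exp (fourier v 0)"
  proof -
    have "const_G b = exp (fourier b 0)" by (simp add: const_G_def fourier_def)
    also have "fourier b 0 = fourier u 0 + fourier v 0"
      unfolding assms(6) using fourier_addS[OF S(1,2)] by (simp add: u_def v_def)
    finally show ?thesis by (simp add: exp_add)
  qed
  have GG: "const_G b ^ N * (exp (- fourier u 0) ^ N * exp (- fourier v 0) ^ N) = 1"
    unfolding G power_mult_distrib[symmetric] by (simp add: exp_minus field_simps)
  have "section_det N (M a)
    = const_G b ^ N * (exp (- fourier u 0) ^ N * exp (- fourier v 0) ^ N) * section_det N (M a)"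
    by (simp add: GG)
  also have "\<dots> = const_G b ^ N * section_det N X" unfolding sec by (simp add: mult_ac)
  finally have main: "section_det N (M a)
    = const_G b ^ N * const_E a * const_F M a * fredholm_det (1 + op_Q N * K * op_Q N)"
    unfolding J(2) detX by (simp add: mult.assoc)
  show ?thesis
    using invertible tc2 tc1 J(1) tcb tcHH main Fexp Eexp unfolding Z1_def Z2_def inv by blast
qed

end
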